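(* Let $X$ be a Polish space equipped with a continuous scaling $T$ and a topologically and scaling consistent ideal $\mathcal{X}$ with a countable open base. Let $Y$ be another Polish space, and let $\mathcal{Z}$ be the ideal on $Y\times X$ generated by $Y\times B$, $B\in\mathcal{X}$. Let $\zeta=\sum_i\delta_{y_i}$ be a finite point process on $Y$ (the ground process) and let $\eta=\sum_i\delta_{(y_i,\xi_i)}$, where $\xi_1,\xi_2,\dots$ are i.i.d. copies of a random element $\xi$ in $X$ (the typical mark), independent of $\zeta$. Let $k\in\mathbb{N}$ and assume that $\mathbf{E}\,\zeta(Y)^k<\infty$ and $\mathbf{P}\{\zeta(Y)\ge k\}>0$, so that the $k$-th factorial moment measure $\kappa^{(k)}$ of $\zeta$ is finite and non-trivial. If $\xi\in\mathrm{RV}(X,T,\mathcal{X},g,\mu)$, then $\eta$ is regularly varying on $M_p(\mathcal{Z})$ with the lifted scaling arising from $T_t(y,x)=(y,T_tx)$, the ideal $\mathcal{M}_p^{(k)}(\mathcal{Z})$, the normalising function $g^k$, and the tail measure $$\mu^*_{(k)}(D)=\frac1{k!}\int_{Y^k}\int_{X^k}\mathbf{1}\Big\{\sum_{i=1}^k\delta_{(y_i,x_i)}\in D\Big\}\,\mu^{\otimes k}(d(x_1,\dots,x_k))\,\kappa^{(k)}(d(y_1,\dots,y_k))$$ for Borel $D$ from $\mathcal{M}_p^{(k)}(\mathcal{Z})$.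
   Context: A continuous scaling is a family of maps $T_t:X\to X$, $t>0$, with $T_tT_s=T_{ts}$, $T_1=\mathrm{id}$, $(x,t)\mapsto T_tx$ jointly continuous. An ideal $\mathcal{S}$ is a family of subsets closed under finite unions and subsets, with union $U_{\mathcal{S}}$; scaling consistent if $T_tB\in\mathcal{S}$ for $B\in\mathcal{S}$, $t>0$; topologically consistent (in metric spaces) if each $B\in\mathcal{S}$ lies in a closed member of $\mathcal{S}$ and each point of $U_{\mathcal{S}}$ has an open neighbourhood in $\mathcal{S}$. A countable open base is a countable family of open sets in $\mathcal{S}$ such that each member of $\mathcal{S}$ is contained in one of them. $M(\mathcal{S})$: Borel measures finite on Borel sets in $\mathcal{S}$ and vanishing outside $U_{\mathcal{S}}$; non-trivial means $\mu(B)>0$ for some $B\in\mathcal{S}$. For a space $E$ with ideal $\mathcal{S}$, $C(E,\mathcal{S})$ denotes the bounded continuous $f:U_{\mathcal{S}}\to\mathbb{R}$ with support (closure in $E$ of $\{f\ne0\}$) in $\mathcal{S}$. The vague topology on $M(\mathcal{S})$ is generated by $\mu\mapsto\int f\,d\mu$, $f\in C(E,\mathcal{S})$. A random element $\eta$ of $E$ satisfies $\eta\in\mathrm{RV}(E,T,\mathcal{S},g,\mu)$ ("regularly varying on $E$ with scaling $T$, ideal $\mathcal{S}$, normalising function $g$, tail measure $\mu$") if $g:[0,\infty)\to[0,\infty)$ is measurable, $g(t)\to\infty$, $\mu\in M(\mathcal{S})$ is non-trivial, and $g(t)\mathbf{E}f(T_{t^{-1}}\eta)\to\int f\,d\mu$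 as $t\to\infty$ for all $f\in C(E,\mathcal{S})$. $M_p(\mathcal{Z})\subset M(\mathcal{Z})$ is the set of integer-valued (counting) measures with the vague topology and lifted scaling $(T_tm)(A)=m(T_{t^{-1}}A)$. All counting measures in $M_p(\mathcal{Z})$ are supported by the union of the sets in $\mathcal{Z}$; $\eta$ is regarded as an element of $M_p(\mathcal{Z})$ by retaining only its atoms in this union. $\mathcal{M}_p^{(k)}(\mathcal{Z})$ is the ideal of all $D\subset M_p(\mathcal{Z})$ for which there is a Borel $A\in\mathcal{Z}$ with $m(A)\ge k$ for all $m\in D$. The factorial moment measure $\kappa^{(k)}$ on $Y^k$ is the intensity measure of $\zeta^{(k)}=\sum\delta_{(y_{i_1},\dots,y_{i_k})}$, the sum being over $k$-tuples of pairwise distinct indices (atoms listed with multiplicities). *)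

theory Defs
  imports "HOL-Probability.Probability"
begin

text \<open>
  Regular variation is needed both on a Polish space and on a space of counting measures. The
  latter carries the vague topology, which is not a type class topology, so the notions involved in
  the definition of regular variation are relative to an explicit topology \<open>E\<close>.
\<close>

definition borel_of :: "'a topology \<Rightarrow> 'a measure" where
  "borel_of E = sigma (topspace E) {U. openin E U}"

lemma borel_of_euclidean: "borel_of (euclidean :: 'a::topological_space topology) = borel"
  by (simp only: borel_of_def borel_def open_openin topspace_euclidean)


section \<open>Scalings and ideals\<close>

definition continuous_scaling :: "(real \<Rightarrow> 'a::topological_space \<Rightarrow> 'a) \<Rightarrow> bool" where
  "continuous_scaling T \<longleftrightarrow>
     (\<forall>t>0. \<forall>s>0. T t \<circ> T s = T (t * s)) \<and> T 1 = id \<and>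
     continuous_on (UNIV \<times> {0<..}) (\<lambda>(x, t). T t x)"

definition set_ideal :: "'a set set \<Rightarrow> bool" where
  "set_ideal S \<longleftrightarrow>
     {} \<in> S \<and> (\<forall>A\<in>S. \<forall>B\<in>S. A \<union> B \<in> S) \<and> (\<forall>A\<in>S. \<forall>B. B \<subseteq> A \<longrightarrow> B \<in> S)"

definition scaling_consistent :: "(real \<Rightarrow> 'a \<Rightarrow> 'a) \<Rightarrow> 'a set set \<Rightarrow> bool" where
  "scaling_consistent T S \<longleftrightarrow> (\<forall>B\<in>S. \<forall>t>0. T t ` B \<in> S)"

definition topologically_consistent :: "'a::topological_space set set \<Rightarrow> bool" where
  "topologically_consistent S \<longleftrightarrow>
     (\<forall>B\<in>S. \<exists>C\<in>S. closed C \<and> B \<subseteq> C) \<and> (\<forall>x\<in>\<Union>S. \<exists>G\<in>S. open G \<and> x \<in> G)"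

definition countable_open_base :: "'a::topological_space set set \<Rightarrow> bool" where
  "countable_open_base S \<longleftrightarrow>
     (\<exists>\<G>. countable \<G> \<and> (\<forall>G\<in>\<G>. open G \<and> G \<in> S) \<and> (\<forall>B\<in>S. \<exists>G\<in>\<G>. B \<subseteq> G))"


section \<open>Measures, vague topology and regular variation\<close>

definition ideal_measures :: "'a topology \<Rightarrow> 'a set set \<Rightarrow> 'a measure set" where
  "ideal_measures E S =
     {\<mu>. sets \<mu> = sets (borel_of E) \<and>
         (\<forall>A\<in>sets \<mu>. A \<in> S \<longrightarrow> emeasure \<mu> A < \<infinity>) \<and>
         (\<forall>A\<in>sets \<mu>. A \<inter> \<Union>S = {} \<longrightarrow> emeasure \<mu> A = 0)}"

definition nontrivial_measure :: "'a set set \<Rightarrow> 'a measure \<Rightarrow> bool" where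
  "nontrivial_measure S \<mu> \<longleftrightarrow> (\<exists>B\<in>sets \<mu>. B \<in> S \<and> emeasure \<mu> B > 0)"

text \<open>
  A test function lives on the union of the ideal; it is represented by its extension by zero to
  the whole type.
\<close>

definition test_functions :: "'a topology \<Rightarrow> 'a set set \<Rightarrow> ('a \<Rightarrow> real) set" where
  "test_functions E S =
     {f. continuous_map (subtopology E (\<Union>S)) euclideanreal f \<and> bounded (f ` \<Union>S) \<and>
         E closure_of {x \<in> \<Union>S. f x \<noteq> 0} \<in> S \<and> (\<forall>x. x \<notin> \<Union>S \<longrightarrow> f x = 0)}"

definition vague_topology :: "'a topology \<Rightarrow> 'a set set \<Rightarrow> 'a measure topology" where
  "vague_topology E S = topology_generated_by
     {{\<mu> \<in> ideal_measures E S. (\<integral>x. f x \<partial>\<mu>) \<in> V} | f V. f \<in> test_functions E S \<and> open V}"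

definition regularly_varying ::
  "'w measure \<Rightarrow> ('w \<Rightarrow> 'e) \<Rightarrow> 'e topology \<Rightarrow> (real \<Rightarrow> 'e \<Rightarrow> 'e) \<Rightarrow> 'e set set \<Rightarrow>
     (real \<Rightarrow> real) \<Rightarrow> 'e measure \<Rightarrow> bool" where
  "regularly_varying P \<eta> E T S g \<mu> \<longleftrightarrow>
     \<eta> \<in> measurable P (borel_of E) \<and>
     (\<forall>t\<ge>0. g t \<ge> 0) \<and> g \<in> borel_measurable (restrict_space borel {0..}) \<and>
     filterlim g at_top at_top \<and>
     \<mu> \<in> ideal_measures E S \<and> nontrivial_measure S \<mu> \<and>
     (\<forall>f\<in>test_functions E S.
        ((\<lambda>t. g t * (\<integral>\<omega>. f (T (inverse t) (\<eta> \<omega>)) \<partial>P)) \<longlongrightarrow> (\<integral>x. f x \<partial>\<mu>)) at_top)"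


section \<open>Counting measures\<close>

definition counting_measures :: "'a topology \<Rightarrow> 'a set set \<Rightarrow> 'a measure set" where
  "counting_measures E S =
     {m \<in> ideal_measures E S. \<forall>A\<in>sets m. emeasure m A \<in> range ennreal_of_enat}"

definition counting_topology :: "'a topology \<Rightarrow> 'a set set \<Rightarrow> 'a measure topology" where
  "counting_topology E S = subtopology (vague_topology E S) (counting_measures E S)"

text \<open>Since \<open>T (inverse t)\<close> is inverse to \<open>T t\<close>, the push-forward gives \<open>A\<close> the
  mass \<open>m (T t -` A) = m (T (inverse t) ` A)\<close>.\<close>

definition lifted_scaling :: "(real \<Rightarrow> 'a \<Rightarrow> 'a) \<Rightarrow> real \<Rightarrow> 'a measure \<Rightarrow> 'a measure" where
  "lifted_scaling T t m = distr m m (T t)"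

definition counting_ideal :: "nat \<Rightarrow> 'a topology \<Rightarrow> 'a set set \<Rightarrow> 'a measure set set" where
  "counting_ideal k E S =
     {D. D \<subseteq> counting_measures E S \<and>
         (\<exists>A\<in>sets (borel_of E). A \<in> S \<and> (\<forall>m\<in>D. emeasure m A \<ge> of_nat k))}"

text \<open>The image of the counting measure on \<open>I\<close> under \<open>z\<close> is the sum over \<open>i \<in> I\<close> of the Dirac
  measures at \<open>z i\<close>, with multiplicities.\<close>

definition dirac_sum :: "'i set \<Rightarrow> 'a measure \<Rightarrow> ('i \<Rightarrow> 'a) \<Rightarrow> 'a measure" where
  "dirac_sum I M z = distr (count_space I) M z"

lemma emeasure_dirac_sum:
  assumes I: "finite I" and z: "z ` I \<subseteq> space M" and A: "A \<in> sets M"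
  shows "emeasure (dirac_sum I M z) A = (\<Sum>i\<in>I. indicator A (z i))"
proof -
  have "emeasure (dirac_sum I M z) A = emeasure (count_space I) (z -` A \<inter> I)"
    unfolding dirac_sum_def using z A
    by (subst emeasure_distr)
      (auto simp only: measurable_count_space_eq1 space_count_space Pi_iff image_subset_iff)
  also have "\<dots> = of_nat (card (z -` A \<inter> I))"
    using I by (intro emeasure_count_space_finite) simp_all
  also have "\<dots> = (\<Sum>i\<in>I \<inter> z -` A. 1)"
    by (simp only: Int_commute of_nat_sum card_eq_sum of_nat_1)
  also have "\<dots> = (\<Sum>i\<in>I. if i \<in> z -` A then 1 else 0)"
    using I by (rule sum.inter_restrict)
  also have "\<dots> = (\<Sum>i\<in>I. indicator A (z i))"
    by (rule sum.cong) (simp_all only: indicator_def vimage_eq of_bool_def)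
  finally show ?thesis .
qed


section \<open>Marked point processes\<close>

definition mark_ideal :: "'x set set \<Rightarrow> ('y \<times> 'x) set set" where
  "mark_ideal S = set_ideal hull {UNIV \<times> B | B. B \<in> S}"

definition mark_scaling :: "(real \<Rightarrow> 'x \<Rightarrow> 'x) \<Rightarrow> real \<Rightarrow> 'y \<times> 'x \<Rightarrow> 'y \<times> 'x" where
  "mark_scaling T t = (\<lambda>(y, x). (y, T t x))"

text \<open>The library constant \<open>prob_space.indep_var\<close> forces both variables to have the same type.\<close>

definition independent_rvs ::
  "'w measure \<Rightarrow> 'a measure \<Rightarrow> ('w \<Rightarrow> 'a) \<Rightarrow> 'b measure \<Rightarrow> ('w \<Rightarrow> 'b) \<Rightarrow> bool" where
  "independent_rvs P M U N V \<longleftrightarrow>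
     U \<in> measurable P M \<and> V \<in> measurable P N \<and>
     prob_space.indep_set P {U -` A \<inter> space P | A. A \<in> sets M} {V -` A \<inter> space P | A. A \<in> sets N}"

definition intensity_measure :: "'w measure \<Rightarrow> 'a measure \<Rightarrow> ('w \<Rightarrow> 'a measure) \<Rightarrow> 'a measure" where
  "intensity_measure P M \<zeta> =
     measure_of (space M) (sets M) (\<lambda>A. \<integral>\<^sup>+\<omega>. emeasure (\<zeta> \<omega>) A \<partial>P)"

text \<open>The points of the process are \<open>y i \<omega>\<close> for \<open>i < n \<omega>\<close>; the \<open>k\<close>-tuples of pairwise distinct
  indices are the injections from \<open>{..<k}\<close> to \<open>{..<n \<omega>}\<close>.\<close>

definition factorial_moment_measure ::
  "'w measure \<Rightarrow> nat \<Rightarrow> ('w \<Rightarrow> nat) \<Rightarrow> (nat \<Rightarrow> 'w \<Rightarrow> 'y::topological_space) \<Rightarrow> (nat \<Rightarrow> 'y) measure"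
  where
  "factorial_moment_measure P k n y =
     intensity_measure P (\<Pi>\<^sub>M l\<in>{..<k}. borel)
       (\<lambda>\<omega>. dirac_sum {j \<in> {..<k} \<rightarrow>\<^sub>E {..<n \<omega>}. inj_on j {..<k}} (\<Pi>\<^sub>M l\<in>{..<k}. borel)
              (\<lambda>j. \<lambda>l\<in>{..<k}. y (j l) \<omega>))"

definition tail_mass ::
  "nat \<Rightarrow> (nat \<Rightarrow> 'y) measure \<Rightarrow> 'x measure \<Rightarrow>
     ('y::topological_space \<times> 'x::topological_space) measure set \<Rightarrow> ennreal" where
  "tail_mass k \<kappa> \<mu> D =
     (\<integral>\<^sup>+ y. (\<integral>\<^sup>+ x. indicator D (dirac_sum {..<k} borel (\<lambda>i. (y i, x i)))
        \<partial>(\<Pi>\<^sub>M i\<in>{..<k}. \<mu>)) \<partial>\<kappa>) / fact k"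

text \<open>\<open>measure_of\<close> yields the zero measure when the given set function is not a measure; a
  regularly varying element never has the zero measure as its tail measure.\<close>

definition tail_measure ::
  "nat \<Rightarrow> (nat \<Rightarrow> 'y) measure \<Rightarrow> 'x measure \<Rightarrow>
     ('y::topological_space \<times> 'x::topological_space) measure topology \<Rightarrow>
     ('y \<times> 'x) measure measure" where
  "tail_measure k \<kappa> \<mu> E = measure_of (topspace E) (sets (borel_of E)) (tail_mass k \<kappa> \<mu>)"

end

theory Submission
  imports Defs
begin

text \<open>
  Given the ground process, with \<open>N\<close> points, the marks are independent. Let \<open>q\<close> be the law of the
  rescaled mark \<open>T (inverse t) \<xi>\<close>, so that \<open>g t * q\<close> tends vaguely to \<open>\<mu>\<close>. A test function \<open>f\<close> for
  the configuration ideal vanishes unless at least \<open>k\<close> marks lie in a certain set \<open>B\<close> of the given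
  ideal. Each rescaled mark lies in \<open>B\<close> with probability at most of order \<open>1 / g t\<close>; hence,
  after multiplication by \<open>g t ^ k\<close>, only the events that exactly \<open>k\<close> marks lie in \<open>B\<close> matter. On such
  an event the other marks leave every set of the ideal, their points disappear in the vague
  topology, and \<open>f\<close> of the configuration approaches \<open>f\<close> of the \<open>k\<close> remaining points, whose marks
  are governed by the \<open>k\<close>-fold product of \<open>\<mu>\<close>. Summation over the \<open>k\<close>-element sets of indices gives
  \<open>1 / fact k\<close> times a sum over injective \<open>k\<close>-tuples of indices, and integration over the ground
  process turns that sum into an integral with respect to the factorial moment measure. The
  number of tuples is at most \<open>N ^ k\<close>, so the moment condition permits dominated convergence.

  The step that needs care is the limit for fixed locations, as \<open>f\<close> is merely continuous and the
  space of marks need not be locally compact. It is obtained from lower bounds only. A Fatou-type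
  inequality for product measures (\<open>product_lower_bound\<close>) is proved for Lipschitz functions, by
  integrating out one coordinate at a time. The functional of the marks is minorised by Lipschitz
  functions of the \<open>k\<close> selected marks, its lower envelopes over all positions of the remaining ones
  (\<open>marked_lower_bound\<close>). The matching upper bound comes from applying the same inequality to the
  difference between the functional and a multiple of a smoothed count of \<open>k\<close>-tuples, for which the
  limit is explicit (\<open>marked_limit\<close>). Dominated convergence over the ground process is
  \<open>config_expectation_limit\<close>.

  The vague topology enters through two facts. A configuration converges as soon as its points
  converge or leave every set of the ideal (\<open>limitin_config\<close>). An integral of a cutoff function
  above \<open>k - 1\<close> forces \<open>k\<close> points, whence the union of the configuration ideal is open
  (\<open>open_neighbourhood_in_config_ideal\<close>). Borel measurability of the map from points to
  configurations holds because that map is continuous on each of the finitely many pieces on which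
  the set of indices of retained points is constant (\<open>measurable_config\<close>).
\<close>

section \<open>Ideals with a countable open base\<close>

locale based_ideal =
  fixes S :: "'x::polish_space set set"
  assumes ideal: "set_ideal S"
    and consistent: "topologically_consistent S"
    and open_base: "countable_open_base S"
begin

lemma empty_mem: "{} \<in> S"
  using ideal unfolding set_ideal_def by blast

lemma Un_mem: "A \<in> S \<Longrightarrow> B \<in> S \<Longrightarrow> A \<union> B \<in> S"
  using ideal unfolding set_ideal_def by blast

lemma subset_mem: "A \<in> S \<Longrightarrow> B \<subseteq> A \<Longrightarrow> B \<in> S"
  using ideal unfolding set_ideal_def by blast

lemma finite_UN_mem: "finite I \<Longrightarrow> (\<And>i. i \<in> I \<Longrightarrow> A i \<in> S) \<Longrightarrow> (\<Union>i\<in>I. A i) \<in> S"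
  by (induction I rule: finite_induct) (auto simp: empty_mem Un_mem)

lemma closure_mem: "B \<in> S \<Longrightarrow> closure B \<in> S"
  using consistent unfolding topologically_consistent_def
  by (metis closure_minimal subset_mem)

lemma open_Union: "open (\<Union>S)"
proof -
  have "\<exists>G. open G \<and> x \<in> G \<and> G \<subseteq> \<Union>S" if "x \<in> \<Union>S" for x
    using consistent that unfolding topologically_consistent_def by blast
  then show ?thesis
    by (subst open_subopen) blast
qed

lemma singleton_mem: "x \<in> \<Union>S \<Longrightarrow> {x} \<in> S"
  by (elim UnionE) (auto intro: subset_mem)

lemma finite_subset_mem: "finite A \<Longrightarrow> A \<subseteq> \<Union>S \<Longrightarrow> A \<in> S"
  using finite_UN_mem[of A "\<lambda>x. {x}"] by (auto simp: subset_iff singleton_mem)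

text \<open>
  Finite unions of members of the base stay in the ideal, so the base may be taken increasing.
\<close>

lemma exhaustion:
  obtains G :: "nat \<Rightarrow> 'x set"
  where "\<And>s. open (G s)" "\<And>s. G s \<in> S" "incseq G" "\<And>B. B \<in> S \<Longrightarrow> \<exists>s. B \<subseteq> G s"
proof -
  obtain \<G> where \<G>: "countable \<G>" "\<forall>G\<in>\<G>. open G \<and> G \<in> S" "\<forall>B\<in>S. \<exists>G\<in>\<G>. B \<subseteq> G"
    using open_base unfolding countable_open_base_def by blast
  have "\<G> \<noteq> {}"
    using \<G>(3) empty_mem by auto
  define G where "G s = (\<Union>i\<le>s. from_nat_into \<G> i)" for s
  show ?thesis
  proof
    show "open (G s)" for s
      unfolding G_def using \<G> \<open>\<G> \<noteq> {}\<close> by (intro open_UN) (meson from_nat_into)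
    show "G s \<in> S" for s
      unfolding G_def using \<G> \<open>\<G> \<noteq> {}\<close> by (intro finite_UN_mem) (auto intro: from_nat_into)
    show "incseq G"
      unfolding G_def by (intro incseq_SucI) (auto intro: le_SucI)
    show "\<exists>s. B \<subseteq> G s" if B: "B \<in> S" for B
    proof -
      obtain H where "H \<in> \<G>" "B \<subseteq> H"
        using \<G>(3) B by blast
      obtain s where "from_nat_into \<G> s = H"
        using from_nat_into_surj[OF \<G>(1) \<open>H \<in> \<G>\<close>] by blast
      then have "H \<subseteq> G s"
        unfolding G_def by auto
      then show ?thesis
        using \<open>B \<subseteq> H\<close> by (intro exI[of _ s]) (rule subset_trans)
    qed
  qed
qed

text \<open>
  The support lies in the closure of \<open>G\<close>, which topological consistency keeps in the ideal.
\<close>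

lemma test_functions_euclideanI:
  assumes "continuous_on UNIV \<phi>" "\<And>x. \<bar>\<phi> x\<bar> \<le> c" "G \<in> S" "\<And>x. x \<notin> G \<Longrightarrow> \<phi> x = 0"
  shows "\<phi> \<in> test_functions euclidean S"
  unfolding test_functions_def mem_Collect_eq
proof (intro conjI allI impI)
  show "continuous_map (top_of_set (\<Union>S)) euclideanreal \<phi>"
    using assms(1) continuous_on_subset by fastforce
  show "bounded (\<phi> ` \<Union>S)"
    using assms(2) by (auto simp: bounded_iff)
  show "euclidean closure_of {x \<in> \<Union>S. \<phi> x \<noteq> 0} \<in> S"
  proof -
    have "closure {x \<in> \<Union>S. \<phi> x \<noteq> 0} \<subseteq> closure G"
      using assms(4) by (intro closure_mono) auto
    then show ?thesis
      using closure_mem[OF assms(3)] subset_mem by auto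
  qed
  show "\<phi> x = 0" if "x \<notin> \<Union>S" for x
    using that assms(3,4) by blast
qed

text \<open>
  Urysohn's lemma, applied to the closure of \<open>B\<close> and the complement of a base set that contains it.
  Such a base set exists because the closure is still a member of the ideal.
\<close>

lemma cutoff:
  assumes "B \<in> S"
  obtains \<psi> :: "'x \<Rightarrow> real" and G
  where "continuous_on UNIV \<psi>" "\<And>x. 0 \<le> \<psi> x" "\<And>x. \<psi> x \<le> 1" "\<And>x. x \<in> B \<Longrightarrow> \<psi> x = 1"
    "open G" "G \<in> S" "\<And>x. x \<notin> G \<Longrightarrow> \<psi> x = 0"
proof -
  obtain G where G: "open G" "G \<in> S" "closure B \<subseteq> G"
    using open_base closure_mem[OF assms] unfolding countable_open_base_def by blast
  have "normal_space (euclidean :: 'x topology)"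
    by (simp add: metrizable_imp_normal_space metrizable_space_euclidean)
  then obtain \<psi> where \<psi>: "continuous_map euclidean (top_of_set {0..1::real}) \<psi>"
      "\<psi> ` (- G) \<subseteq> {0}" "\<psi> ` closure B \<subseteq> {1}"
    using G by (elim Urysohn_lemma[of _ "- G" "closure B" 0 1]) (auto simp: disjnt_def)
  show ?thesis
  proof (rule that[of \<psi> G])
    show "continuous_on UNIV \<psi>"
      using \<psi>(1) by (simp add: continuous_map_in_subtopology)
    have "\<psi> x \<in> {0..1}" for x
      using \<psi>(1) by (auto simp: continuous_map_in_subtopology)
    then show "0 \<le> \<psi> x" "\<psi> x \<le> 1" for x
      by auto
    show "\<psi> x = 1" if "x \<in> B" for x
      using \<psi>(3) that closure_subset by blast
    show "\<psi> x = 0" if "x \<notin> G" for x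
      using \<psi>(2) that by blast
  qed (use G in auto)
qed

end

text \<open>
  The subsets of the cylinders over members of \<open>S\<close> already form an ideal, so the hull of the
  cylinders is no larger than this.
\<close>

lemma mark_ideal_iff:
  fixes A :: "('y \<times> 'x) set"
  assumes "set_ideal S"
  shows "A \<in> mark_ideal S \<longleftrightarrow> (\<exists>B\<in>S. A \<subseteq> UNIV \<times> B)"
proof
  define Z where "Z = {A :: ('y \<times> 'x) set. \<exists>B\<in>S. A \<subseteq> UNIV \<times> B}"
  have "set_ideal Z"
    unfolding set_ideal_def
  proof (intro conjI ballI allI impI)
    show "{} \<in> Z"
      using assms by (auto simp: Z_def set_ideal_def)
    fix A B assume "A \<in> Z" "B \<in> Z"
    then obtain A' B' where "A' \<in> S" "B' \<in> S" "A \<subseteq> UNIV \<times> A'" "B \<subseteq> UNIV \<times> B'"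
      by (auto simp: Z_def)
    moreover from this have "A' \<union> B' \<in> S"
      using assms by (auto simp: set_ideal_def)
    ultimately show "A \<union> B \<in> Z"
      unfolding Z_def by blast
  qed (auto simp: Z_def)
  moreover have "{UNIV \<times> B |B. B \<in> S} \<subseteq> Z"
    by (auto simp: Z_def)
  ultimately have "(mark_ideal S :: ('y \<times> 'x) set set) \<subseteq> Z"
    unfolding mark_ideal_def by (intro hull_minimal) auto
  then show "\<exists>B\<in>S. A \<subseteq> UNIV \<times> B" if "A \<in> mark_ideal S"
    using that by (auto simp: Z_def)
next
  assume "\<exists>B\<in>S. A \<subseteq> UNIV \<times> B"
  then obtain B where B: "B \<in> S" "A \<subseteq> UNIV \<times> B"
    by blast
  show "A \<in> mark_ideal S"
    unfolding mark_ideal_def hull_def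
  proof (rule InterI)
    fix Z :: "('y \<times> 'x) set set"
    assume "Z \<in> {t. set_ideal t \<and> {UNIV \<times> B |B. B \<in> S} \<subseteq> t}"
    then have "UNIV \<times> B \<in> Z" "set_ideal Z"
      using B(1) by auto
    then show "A \<in> Z"
      using B(2) by (simp add: set_ideal_def)
  qed
qed

lemma Union_mark_ideal:
  assumes "set_ideal S"
  shows "\<Union>(mark_ideal S) = UNIV \<times> \<Union>S"
proof (intro equalityI subsetI)
  fix z assume "z \<in> \<Union>(mark_ideal S)"
  then obtain A where "A \<in> mark_ideal S" "z \<in> A"
    by blast
  then obtain B where "B \<in> S" "z \<in> UNIV \<times> B"
    using mark_ideal_iff[OF assms, of A] by blast
  then show "z \<in> UNIV \<times> \<Union>S"
    by blast
next
  fix z assume "z \<in> UNIV \<times> \<Union>S"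
  then obtain B where "B \<in> S" "z \<in> UNIV \<times> B"
    by blast
  moreover have "UNIV \<times> B \<in> mark_ideal S"
    using mark_ideal_iff[OF assms, of "UNIV \<times> B"] \<open>B \<in> S\<close> by blast
  ultimately show "z \<in> \<Union>(mark_ideal S)"
    by blast
qed

context based_ideal
begin

lemma mem_Union_mark_ideal_iff: "z \<in> \<Union>(mark_ideal S) \<longleftrightarrow> snd z \<in> \<Union>S"
  unfolding Union_mark_ideal[OF ideal] by (auto simp: mem_Times_iff)

lemma open_Union_mark_ideal:
  "open (\<Union>(mark_ideal S) :: ('y::topological_space \<times> 'x) set)"
  unfolding Union_mark_ideal[OF ideal] by (intro open_Times open_Union) auto

lemma snd_test_function:
  assumes "continuous_on UNIV \<psi>" "\<And>x. \<bar>\<psi> x\<bar> \<le> c" "G \<in> S" "\<And>x. x \<notin> G \<Longrightarrow> \<psi> x = 0"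
  shows "(\<lambda>z :: 'y::topological_space \<times> 'x. \<psi> (snd z)) \<in> test_functions euclidean (mark_ideal S)"
  unfolding test_functions_def mem_Collect_eq
proof (intro conjI allI impI)
  show "continuous_map (top_of_set (\<Union>(mark_ideal S))) euclideanreal (\<lambda>z :: 'y \<times> 'x. \<psi> (snd z))"
    using continuous_on_compose2[OF assms(1) continuous_on_snd[OF continuous_on_id]] by simp
  show "bounded ((\<lambda>z :: 'y \<times> 'x. \<psi> (snd z)) ` \<Union>(mark_ideal S))"
    using assms(2) by (auto simp: bounded_iff)
  have "closure {z :: 'y \<times> 'x. z \<in> \<Union>(mark_ideal S) \<and> \<psi> (snd z) \<noteq> 0} \<subseteq> UNIV \<times> closure G"
  proof (rule closure_minimal)
    show "closed (UNIV \<times> closure G :: ('y \<times> 'x) set)"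
      by (intro closed_Times) auto
    show "{z :: 'y \<times> 'x. z \<in> \<Union>(mark_ideal S) \<and> \<psi> (snd z) \<noteq> 0} \<subseteq> UNIV \<times> closure G"
      using assms(4) closure_subset by (force simp: mem_Times_iff)
  qed
  then show "euclidean closure_of {z :: 'y \<times> 'x. z \<in> \<Union>(mark_ideal S) \<and> \<psi> (snd z) \<noteq> 0}
      \<in> mark_ideal S"
    unfolding mark_ideal_iff[OF ideal] using closure_mem[OF assms(3)] by auto
  show "\<psi> (snd z) = 0" if "z \<notin> \<Union>(mark_ideal S)" for z :: "'y \<times> 'x"
    using that assms(3,4) unfolding mem_Union_mark_ideal_iff by blast
qed

end

section \<open>Vague convergence of finite configurations\<close>

lemma zero_test_function: "{} \<in> S \<Longrightarrow> (\<lambda>_. 0) \<in> test_functions E S"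
  by (auto simp: test_functions_def image_constant_conv)

lemma topspace_vague:
  assumes "{} \<in> S"
  shows "topspace (vague_topology E S) = ideal_measures E S"
proof -
  have "ideal_measures E S \<in>
      {{\<mu> \<in> ideal_measures E S. (\<integral>x. f x \<partial>\<mu>) \<in> V} | f V. f \<in> test_functions E S \<and> open V}"
    using zero_test_function[OF assms] by (intro CollectI exI[of _ "\<lambda>_. 0"] exI[of _ UNIV]) auto
  then show ?thesis
    unfolding vague_topology_def topology_generated_by_topspace by blast
qed

lemma topspace_counting:
  assumes "{} \<in> S"
  shows "topspace (counting_topology E S) = counting_measures E S"
  unfolding counting_topology_def topspace_subtopology topspace_vague[OF assms]
  by (auto simp: counting_measures_def)

text \<open>
  Eventual membership passes from subbasic open sets to finite intersections and to unions, so
  convergence of the integrals of test functions is all that has to be checked.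
\<close>

lemma limitin_vague:
  assumes m: "m \<in> ideal_measures E S" and ms: "\<And>s. ms s \<in> ideal_measures E S"
    and conv: "\<And>f. f \<in> test_functions E S \<Longrightarrow> ((\<lambda>s. \<integral>x. f x \<partial>ms s) \<longlongrightarrow> (\<integral>x. f x \<partial>m)) F"
    and "{} \<in> S"
  shows "limitin (vague_topology E S) ms m F"
  unfolding limitin_def topspace_vague[OF assms(4)]
proof (intro conjI m allI impI)
  fix U assume U: "openin (vague_topology E S) U \<and> m \<in> U"
  then have "generate_topology_on
     {{\<mu> \<in> ideal_measures E S. (\<integral>x. f x \<partial>\<mu>) \<in> V} | f V. f \<in> test_functions E S \<and> open V} U"
    unfolding vague_topology_def by (auto dest: openin_topology_generated_by)
  then have "m \<in> U \<longrightarrow> (\<forall>\<^sub>F s in F. ms s \<in> U)"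
  proof induction
    case (Int a b)
    then show ?case by (auto simp: eventually_conj_iff)
  next
    case (UN K)
    show ?case
    proof
      assume "m \<in> \<Union>K"
      then obtain k where "k \<in> K" "m \<in> k" by blast
      with UN have "\<forall>\<^sub>F s in F. ms s \<in> k" by blast
      then show "\<forall>\<^sub>F s in F. ms s \<in> \<Union>K"
        by eventually_elim (use \<open>k \<in> K\<close> in blast)
    qed
  next
    case (Basis s)
    then obtain f V where f: "f \<in> test_functions E S" "open V"
      "s = {\<mu> \<in> ideal_measures E S. (\<integral>x. f x \<partial>\<mu>) \<in> V}"
      by blast
    show ?case
      using topological_tendstoD[OF conv[OF f(1)] f(2)] ms by (auto simp: f(3))
  qed auto
  then show "\<forall>\<^sub>F s in F. ms s \<in> U"
    using U by blast
qed

lemma limitin_counting: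
  assumes "m \<in> counting_measures E S" "\<And>s. ms s \<in> counting_measures E S"
    and "\<And>f. f \<in> test_functions E S \<Longrightarrow> ((\<lambda>s. \<integral>x. f x \<partial>ms s) \<longlongrightarrow> (\<integral>x. f x \<partial>m)) F"
    and "{} \<in> S"
  shows "limitin (counting_topology E S) ms m F"
  unfolding counting_topology_def limitin_subtopology
  using assms by (auto intro!: limitin_vague simp: counting_measures_def)

lemma sets_borel_of: "sets (borel_of E) = sigma_sets (topspace E) {U. openin E U}"
  and space_borel_of: "space (borel_of E) = topspace E"
  unfolding borel_of_def using openin_subset by (auto intro!: sets_measure_of space_measure_of)

lemma openin_borel_of: "openin E U \<Longrightarrow> U \<in> sets (borel_of E)"
  by (auto simp: sets_borel_of)

text \<open>
  The configuration of the first \<open>N\<close> points, restricted to \<open>U\<close>. Points off \<open>U\<close> have to be dropped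
  because a member of \<open>ideal_measures\<close> has no mass outside the union of the ideal, which is the set
  taken for \<open>U\<close> below.
\<close>

definition config ::
  "('y::topological_space \<times> 'x::topological_space) set \<Rightarrow> nat \<Rightarrow> (nat \<Rightarrow> 'y) \<Rightarrow> (nat \<Rightarrow> 'x) \<Rightarrow> ('y \<times> 'x) measure" where
  "config U N y x = dirac_sum {i \<in> {..<N}. (y i, x i) \<in> U} borel (\<lambda>i. (y i, x i))"

lemma sets_config [simp]: "sets (config U N y x) = sets borel"
  by (simp add: config_def dirac_sum_def)

lemma space_config [simp]: "space (config U N y x) = UNIV"
  by (simp add: config_def dirac_sum_def)

lemma emeasure_config:
  "A \<in> sets borel \<Longrightarrow>
    emeasure (config U N y x) A = of_nat (card {i. i < N \<and> (y i, x i) \<in> U \<and> (y i, x i) \<in> A})"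
proof -
  assume A: "A \<in> sets borel"
  have "emeasure (config U N y x) A = (\<Sum>i | i \<in> {..<N} \<and> (y i, x i) \<in> U. indicator A (y i, x i))"
    unfolding config_def using A by (intro emeasure_dirac_sum) auto
  also have "\<dots> = (\<Sum>i | i < N \<and> (y i, x i) \<in> U. if (y i, x i) \<in> A then 1 else 0)"
    by (intro sum.cong) (auto simp: indicator_def)
  also have "\<dots> = of_nat (card {i. i < N \<and> (y i, x i) \<in> U \<and> (y i, x i) \<in> A})"
    by (simp add: sum.If_cases Int_def conj_assoc)
  finally show ?thesis .
qed

lemma integral_config:
  fixes f :: "('y::topological_space \<times> 'x::topological_space) \<Rightarrow> real"
  assumes "f \<in> borel_measurable borel"
  shows "(\<integral>z. f z \<partial>config U N y x) = (\<Sum>i | i < N \<and> (y i, x i) \<in> U. f (y i, x i))"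
proof -
  have "(\<integral>z. f z \<partial>config U N y x) =
      (\<integral>i. f (y i, x i) \<partial>count_space {i \<in> {..<N}. (y i, x i) \<in> U})"
    unfolding config_def dirac_sum_def using assms by (subst integral_distr) auto
  then show ?thesis
    by (simp add: lebesgue_integral_count_space_finite)
qed

context based_ideal
begin

lemma test_function_borel:
  assumes "f \<in> test_functions euclidean (mark_ideal S)"
  shows "(f :: 'y::polish_space \<times> 'x \<Rightarrow> real) \<in> borel_measurable borel"
proof -
  let ?U = "\<Union>(mark_ideal S) :: ('y \<times> 'x) set"
  have "continuous_on ?U f" "\<And>x. x \<notin> ?U \<Longrightarrow> f x = 0"
    using assms by (auto simp: test_functions_def)
  then have "f = (\<lambda>x. indicator ?U x *\<^sub>R f x)"
    by (intro ext) (simp add: indicator_def del: Union_iff, blast)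
  moreover have "(\<lambda>x. indicator ?U x *\<^sub>R f x) \<in> borel_measurable borel"
    using \<open>continuous_on ?U f\<close> open_Union_mark_ideal
    by (intro borel_measurable_continuous_on_indicator borel_open)
  ultimately show ?thesis by simp
qed

lemma config_counting:
  "config (\<Union>(mark_ideal S)) N y x \<in>
    counting_measures (euclidean :: ('y::polish_space \<times> 'x) topology) (mark_ideal S)"
proof -
  let ?m = "config (\<Union>(mark_ideal S)) N y x"
  have *: "emeasure ?m A \<in> range ennreal_of_enat" if "A \<in> sets borel" for A
    unfolding emeasure_config[OF that] ennreal_of_enat_enat[symmetric] by (rule rangeI)
  have "emeasure ?m A < \<infinity>" if "A \<in> sets borel" for A
    unfolding emeasure_config[OF that] by (simp only: infinity_ennreal_def of_nat_less_top)
  moreover have "emeasure ?m A = 0" if "A \<in> sets borel" "A \<inter> \<Union>(mark_ideal S) = {}" for A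
  proof -
    have "{i. i < N \<and> (y i, x i) \<in> \<Union>(mark_ideal S) \<and> (y i, x i) \<in> A} = {}"
      using that(2) by blast
    then show ?thesis
      unfolding emeasure_config[OF that(1)] by simp
  qed
  ultimately show ?thesis
    using * by (simp add: counting_measures_def ideal_measures_def borel_of_euclidean)
qed

lemma integral_config_eq:
  assumes "f \<in> test_functions euclidean (mark_ideal S)"
  shows "(\<integral>z. f z \<partial>config (\<Union>(mark_ideal S)) N y x) =
    (\<Sum>i<N. f (y i :: 'y::polish_space, x i))"
proof -
  have "(\<Sum>i<N. f (y i, x i)) = (\<Sum>i | i < N \<and> (y i, x i) \<in> \<Union>(mark_ideal S). f (y i, x i))"
    using assms by (intro sum.mono_neutral_right) (auto simp: test_functions_def)
  then show ?thesis
    by (simp add: integral_config[OF test_function_borel[OF assms]])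
qed

text \<open>
  This is why only \<open>k\<close> points survive in the limit. A test function vanishes off the cylinder over
  some member of the ideal, so a point whose mark leaves every such member contributes nothing
  eventually; the other points converge to places where the test function is continuous. The filter
  is kept general since both sequences and neighbourhood filters are used later.
\<close>

lemma limitin_config:
  fixes ys :: "'i \<Rightarrow> nat \<Rightarrow> 'y::polish_space"
  assumes j: "inj_on j {..<k}" "j ` {..<k} \<subseteq> {..<N}"
    and lim_y: "\<And>l. l < k \<Longrightarrow> ((\<lambda>s. ys s (j l)) \<longlongrightarrow> v l) F"
    and lim_x: "\<And>l. l < k \<Longrightarrow> ((\<lambda>s. xs s (j l)) \<longlongrightarrow> u l) F"
    and u: "\<And>l. l < k \<Longrightarrow> u l \<in> \<Union>S"
    and escape: "\<And>i B. i < N \<Longrightarrow> i \<notin> j ` {..<k} \<Longrightarrow> B \<in> S \<Longrightarrow> \<forall>\<^sub>F s in F. xs s i \<notin> B"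
  shows "limitin (counting_topology euclidean (mark_ideal S))
    (\<lambda>s. config (\<Union>(mark_ideal S)) N (ys s) (xs s)) (config (\<Union>(mark_ideal S)) k v u) F"
proof (rule limitin_counting[rotated 2])
  show "{} \<in> mark_ideal S"
    using empty_mem mark_ideal_iff[OF ideal] by blast
  fix f :: "'y \<times> 'x \<Rightarrow> real"
  assume f: "f \<in> test_functions euclidean (mark_ideal S)"
  let ?U = "\<Union>(mark_ideal S) :: ('y \<times> 'x) set"
  have cont: "continuous_on ?U f" and zero: "\<And>z. z \<notin> ?U \<Longrightarrow> f z = 0"
    and supp: "closure {z \<in> ?U. f z \<noteq> 0} \<in> mark_ideal S"
    using f by (auto simp: test_functions_def)
  obtain B where B: "B \<in> S" "closure {z \<in> ?U. f z \<noteq> 0} \<subseteq> UNIV \<times> B"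
    using supp mark_ideal_iff[OF ideal] by blast
  have B': "f (y, x) = 0" if "x \<notin> B" for y x
    using that B(2) zero closure_subset[of "{z \<in> ?U. f z \<noteq> 0}"] by fastforce
  have near: "((\<lambda>s. f (ys s (j l), xs s (j l))) \<longlongrightarrow> f (v l, u l)) F" if "l < k" for l
  proof -
    have "(v l, u l) \<in> ?U"
      unfolding mem_Union_mark_ideal_iff snd_conv by (rule u[OF that])
    then have "isCont f (v l, u l)"
      using cont open_Union_mark_ideal continuous_on_eq_continuous_at by blast
    moreover have "((\<lambda>s. (ys s (j l), xs s (j l))) \<longlongrightarrow> (v l, u l)) F"
      using lim_y lim_x that by (intro tendsto_Pair)
    ultimately show ?thesis
      by (rule isCont_tendsto_compose)
  qed
  have far: "((\<lambda>s. f (ys s i, xs s i)) \<longlongrightarrow> 0) F" if "i \<in> {..<N} - j ` {..<k}" for i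
    using that escape[of i B] B(1) B'
    by (intro tendsto_eventually) (auto elim!: eventually_mono)
  have split: "(\<Sum>i<N. f (ys s i, xs s i)) = (\<Sum>l<k. f (ys s (j l), xs s (j l))) +
      (\<Sum>i\<in>{..<N} - j ` {..<k}. f (ys s i, xs s i))" for s
    using sum.subset_diff[OF j(2), of "\<lambda>i. f (ys s i, xs s i)"]
    by (simp add: sum.reindex[OF j(1)] add.commute)
  have "((\<lambda>s. \<Sum>i<N. f (ys s i, xs s i)) \<longlongrightarrow> (\<Sum>l<k. f (v l, u l)) + (\<Sum>i\<in>{..<N} - j ` {..<k}. 0)) F"
    unfolding split by (intro tendsto_add tendsto_sum near far) auto
  then show "((\<lambda>s. \<integral>z. f z \<partial>config ?U N (ys s) (xs s)) \<longlongrightarrow> (\<integral>z. f z \<partial>config ?U k v u)) F"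
    by (simp add: integral_config_eq[OF f])
qed (rule config_counting)+

end

section \<open>Products of vaguely converging sequences\<close>

locale measured_ideal = based_ideal S for S :: "'x::polish_space set set" +
  fixes \<mu> :: "'x measure"
  assumes ideal_\<mu>: "\<mu> \<in> ideal_measures euclidean S"
begin

abbreviation \<mu>_power :: "nat \<Rightarrow> (nat \<Rightarrow> 'x) measure" where
  "\<mu>_power k \<equiv> PiM {..<k} (\<lambda>_. \<mu>)"

end

text \<open>
  The countable base covers the union of the ideal by sets of finite mass, and the complement of
  that union is a null set.
\<close>

lemma (in based_ideal) ideal_measure_sigma_finite:
  assumes "\<mu> \<in> ideal_measures euclidean S"
  shows "sigma_finite_measure \<mu>"
proof -
  obtain G where G: "\<And>s. open (G s)" "\<And>s. G s \<in> S" "incseq G" "\<And>B. B \<in> S \<Longrightarrow> \<exists>s. B \<subseteq> G s"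
    by (rule exhaustion) blast
  have sets: "sets \<mu> = sets borel" and fin: "\<And>A. A \<in> sets \<mu> \<Longrightarrow> A \<in> S \<Longrightarrow> emeasure \<mu> A < \<infinity>"
    and null: "\<And>A. A \<in> sets \<mu> \<Longrightarrow> A \<inter> \<Union>S = {} \<Longrightarrow> emeasure \<mu> A = 0"
    using assms by (auto simp: ideal_measures_def borel_of_euclidean)
  have space: "space \<mu> = UNIV"
    using sets_eq_imp_space_eq[OF sets] by simp
  have cover: "\<Union>S \<subseteq> (\<Union>s. G s)"
    using G(4) by blast
  show ?thesis
  proof
    show "\<exists>A. countable A \<and> A \<subseteq> sets \<mu> \<and> \<Union>A = space \<mu> \<and> (\<forall>a\<in>A. emeasure \<mu> a \<noteq> \<infinity>)"
    proof (intro exI[of _ "insert (- (\<Union>S)) (range G)"] conjI ballI)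
      show "insert (- (\<Union>S)) (range G) \<subseteq> sets \<mu>"
        using G(1) open_Union unfolding sets by (auto simp del: UnionI Union_iff)
      show "\<Union>(insert (- (\<Union>S)) (range G)) = space \<mu>"
        using cover unfolding space by blast
      fix A assume A: "A \<in> insert (- (\<Union>S)) (range G)"
      show "emeasure \<mu> A \<noteq> \<infinity>"
      proof (cases "A = - (\<Union>S)")
        case True
        then have "A \<in> sets \<mu>" "A \<inter> \<Union>S = {}"
          using open_Union unfolding sets by (simp_all del: Union_iff)
        then show ?thesis
          using null by simp
      next
        case False
        then obtain s where "A = G s"
          using A by blast
        then show ?thesis
          using fin[of "G s"] G(1,2) by (simp add: sets less_top)
      qed
    qed simp
  qed
qed

text \<open>
  The space of a product over \<open>I\<close> consists of functions that are undefined off \<open>I\<close>. Viewing them as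
  elements of the whole function space makes its product topology available for proving
  measurability.
\<close>

lemma measurable_PiM_nat_borel:
  fixes M :: "nat \<Rightarrow> 'x::second_countable_topology measure"
  assumes "\<And>i. i \<in> I \<Longrightarrow> sets (M i) = sets borel"
  shows "(\<lambda>x. x) \<in> measurable (PiM I M) (borel :: (nat \<Rightarrow> 'x) measure)"
proof (rule measurable_coordinatewise_then_product)
  fix i
  show "(\<lambda>x. x i) \<in> borel_measurable (PiM I M)"
  proof (cases "i \<in> I")
    case True
    then show ?thesis
      using measurable_component_singleton[of i I M] measurable_cong_sets[OF refl assms[OF True]]
      by blast
  next
    case False
    then have "x i = undefined" if "x \<in> space (PiM I M)" for x
      using that by (auto simp: space_PiM PiE_def extensional_def)
    then have "(\<lambda>x. x i) \<in> borel_measurable (PiM I M) \<longleftrightarrow> (\<lambda>_. undefined :: 'x) \<in> borel_measurable (PiM I M)"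
      by (intro measurable_cong) simp
    then show ?thesis
      by simp
  qed
qed

lemma coordinate_lipschitz_continuous:
  fixes h :: "(nat \<Rightarrow> 'x::metric_space) \<Rightarrow> real"
  assumes "\<And>x x'. \<bar>h x - h x'\<bar> \<le> c * (\<Sum>i\<in>I. dist (x i) (x' i))"
  shows "continuous_on UNIV h"
proof (rule continuous_at_imp_continuous_on)
  show "\<forall>x\<in>UNIV. isCont h x"
  proof
    fix x :: "nat \<Rightarrow> 'x"
    have "((\<lambda>x' :: nat \<Rightarrow> 'x. x' i) \<longlongrightarrow> x i) (at x)" for i :: nat
      using continuous_on_product_coordinates[of i] by (auto simp: continuous_on_def)
    then have "((\<lambda>x'. c * (\<Sum>i\<in>I. dist (x' i) (x i))) \<longlongrightarrow> c * (\<Sum>i\<in>I. dist (x i) (x i))) (at x)"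
      by (intro tendsto_intros)
    then have "((\<lambda>x'. c * (\<Sum>i\<in>I. dist (x' i) (x i))) \<longlongrightarrow> 0) (at x)"
      by simp
    then have "((\<lambda>x'. h x' - h x) \<longlongrightarrow> 0) (at x)"
      by (rule Lim_null_comparison[rotated]) (use assms in \<open>auto intro!: always_eventually\<close>)
    then show "isCont h x"
      unfolding isCont_def by (simp add: LIM_zero_iff)
  qed
qed

context measured_ideal
begin

lemma sets_\<mu> [measurable_cong, simp]: "sets \<mu> = sets borel"
  and \<mu>_finite: "\<And>A. A \<in> sets borel \<Longrightarrow> A \<in> S \<Longrightarrow> emeasure \<mu> A < \<infinity>"
  and \<mu>_null: "\<And>A. A \<in> sets borel \<Longrightarrow> A \<inter> \<Union>S = {} \<Longrightarrow> emeasure \<mu> A = 0"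
  using ideal_\<mu> by (auto simp: ideal_measures_def borel_of_euclidean)

lemma sigma_finite_\<mu>: "sigma_finite_measure \<mu>"
  using ideal_measure_sigma_finite[OF ideal_\<mu>] .

lemma product_sigma_finite_\<mu>: "product_sigma_finite (\<lambda>_. \<mu>)"
  unfolding product_sigma_finite_def using sigma_finite_\<mu> by simp

lemma test_function_integrable:
  fixes \<phi> :: "'x \<Rightarrow> real"
  assumes "\<phi> \<in> borel_measurable borel" "\<And>x. \<bar>\<phi> x\<bar> \<le> c" "open G" "G \<in> S" "\<And>x. x \<notin> G \<Longrightarrow> \<phi> x = 0"
  shows "integrable \<mu> \<phi>"
proof (rule Bochner_Integration.integrable_bound)
  show "integrable \<mu> (\<lambda>x. c * indicator G x)"
    using assms(3) \<mu>_finite[of G] assms(4) by (intro integrable_mult_right) (simp add: integrable_indicator_iff)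
  show "\<phi> \<in> borel_measurable \<mu>"
    using assms(1) by (simp cong: measurable_cong_sets)
  show "AE x in \<mu>. norm (\<phi> x) \<le> norm (c * indicator G x)"
  proof (rule AE_I2)
    fix x
    show "norm (\<phi> x) \<le> norm (c * indicator G x)"
      using assms(2)[of x] assms(5)[of x] by (cases "x \<in> G") auto
  qed
qed

text \<open>
  Each coordinate avoids the complement of the union of the ideal, which is a null set.
\<close>

lemma AE_product_\<mu>:
  fixes k :: nat
  shows "AE u in \<mu>_power k. \<forall>l<k. u l \<in> \<Union>S"
proof -
  interpret product_sigma_finite "\<lambda>_. \<mu>" by (rule product_sigma_finite_\<mu>)
  have "AE u in \<mu>_power k. u l \<in> \<Union>S" if "l < k" for l
  proof (rule AE_I)
    let ?A = "\<lambda>i. if i = l then - \<Union>S else UNIV"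
    show "{u \<in> space (\<mu>_power k). u l \<notin> \<Union>S} \<subseteq> Pi\<^sub>E {..<k} ?A"
    proof
      fix u assume "u \<in> {u \<in> space (\<mu>_power k). u l \<notin> \<Union>S}"
      then have u: "u \<in> extensional {..<k}" "u l \<in> - \<Union>S"
        by (simp_all add: space_PiM PiE_def del: Union_iff)
      show "u \<in> Pi\<^sub>E {..<k} ?A"
        using u(2) extensional_arb[OF u(1)] by (intro PiE_I) (simp_all del: Union_iff)
    qed
    have A: "?A i \<in> sets \<mu>" for i
      using open_Union by (simp add: borel_closed)
    have "emeasure \<mu> (- \<Union>S) = 0"
      using open_Union by (intro \<mu>_null) auto
    then show "emeasure (\<mu>_power k) (Pi\<^sub>E {..<k} ?A) = 0"
      using that A by (subst emeasure_PiM) (auto intro!: prod_zero bexI[of _ l] finite_lessThan)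
    show "Pi\<^sub>E {..<k} ?A \<in> sets (\<mu>_power k)"
      using A by (intro sets_PiM_I_finite) auto
  qed
  then have "AE u in \<mu>_power k. \<forall>l\<in>{..<k}. u l \<in> \<Union>S"
    by (subst AE_finite_all) auto
  then show ?thesis
    by (auto elim!: eventually_mono)
qed

end

text \<open>
  Regular variation along a sequence \<open>t m\<close> tending to infinity: \<open>q m\<close> stands for the law of the mark
  rescaled by \<open>inverse (t m)\<close>, and \<open>a m\<close> for \<open>g (t m)\<close>.
\<close>

locale vague_sequence = measured_ideal S \<mu> for S :: "'x::polish_space set set" and \<mu> +
  fixes q :: "nat \<Rightarrow> 'x measure" and a :: "nat \<Rightarrow> real"
  assumes prob_q: "\<And>m. prob_space (q m)"
    and sets_q [measurable_cong, simp]: "\<And>m. sets (q m) = sets borel"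
    and a_nonneg: "\<And>m. 0 \<le> a m"
    and a_at_top: "filterlim a at_top sequentially"
    and vague: "\<And>\<phi>. \<phi> \<in> test_functions euclidean S \<Longrightarrow>
        (\<lambda>m. a m * (\<integral>x. \<phi> x \<partial>q m)) \<longlonglongrightarrow> (\<integral>x. \<phi> x \<partial>\<mu>)"
begin

abbreviation marks_law :: "nat \<Rightarrow> (nat \<Rightarrow> 'x) measure" where
  "marks_law m \<equiv> PiM UNIV (\<lambda>_. q m)"

lemma product_sigma_finite_q: "product_sigma_finite (\<lambda>_. q m)"
  unfolding product_sigma_finite_def
  using prob_space_imp_sigma_finite[OF prob_q] by simp

text \<open>
  A cutoff function dominates the indicator of \<open>B\<close>, and its scaled integrals converge.
\<close>

lemma mass_bounded:
  assumes "B \<in> S"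
  obtains K where "0 \<le> K" "\<And>m. a m * measure (q m) B \<le> K"
proof -
  obtain \<psi> G where \<psi>: "continuous_on UNIV \<psi>" "\<And>x. 0 \<le> \<psi> x" "\<And>x. \<psi> x \<le> (1::real)"
      "\<And>x. x \<in> B \<Longrightarrow> \<psi> x = 1" "open G" "G \<in> S" "\<And>x. x \<notin> G \<Longrightarrow> \<psi> x = 0"
    using cutoff[OF assms] by metis
  have "\<psi> \<in> test_functions euclidean S"
    using \<psi> by (intro test_functions_euclideanI[of \<psi> 1 G]) (auto simp: abs_le_iff intro: order_trans[of _ 0])
  then have "Bseq (\<lambda>m. a m * (\<integral>x. \<psi> x \<partial>q m))"
    using vague convergentI convergent_imp_Bseq by blast
  then obtain K where K: "0 < K" "\<And>m. norm (a m * (\<integral>x. \<psi> x \<partial>q m)) \<le> K"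
    unfolding Bseq_def by blast
  have "a m * measure (q m) B \<le> K" for m
  proof -
    interpret prob_space "q m" by (rule prob_q)
    have meas: "\<psi> \<in> borel_measurable (q m)"
      using borel_measurable_continuous_onI[OF \<psi>(1)] by (simp cong: measurable_cong_sets)
    have int: "integrable (q m) \<psi>"
      using \<psi>(2,3) meas by (intro integrable_const_bound[of _ 1]) auto
    have "measure (q m) B \<le> (\<integral>x. \<psi> x \<partial>q m)"
    proof (cases "B \<in> sets (q m)")
      case True
      have ind: "integrable (q m) (indicator B :: 'x \<Rightarrow> real)"
        using True by (intro integrable_real_indicator) (auto simp: less_top[symmetric])
      have "measure (q m) B = (\<integral>x. indicator B x \<partial>q m)"
        using True by simp
      also have "\<dots> \<le> (\<integral>x. \<psi> x \<partial>q m)"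
        using int ind \<psi>(2,4) by (intro integral_mono) (auto split: split_indicator)
      finally show ?thesis .
    next
      case False
      then show ?thesis
        using \<psi>(2) by (simp add: measure_notin_sets)
    qed
    then have "a m * measure (q m) B \<le> a m * (\<integral>x. \<psi> x \<partial>q m)"
      using a_nonneg by (intro mult_left_mono) auto
    then show ?thesis
      using K(2)[of m] by simp
  qed
  then show ?thesis
    using that[of K] K(1) by simp
qed

text \<open>
  A lower bound for product measures, by induction on the number of factors. Integrating out one
  coordinate of \<open>h\<close> with respect to \<open>a m\<close> times \<open>q m\<close> gives functions \<open>H m\<close> of the other coordinates
  that converge pointwise and share a Lipschitz constant. The infimum of all \<open>H m\<close> with \<open>m \<ge> s\<close> is
  therefore Lipschitz again and does not depend on \<open>m\<close>, so that the induction hypothesis applies to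
  it; as \<open>s\<close> grows it approaches the limit of the \<open>H m\<close>.
\<close>

lemma product_lower_bound:
  fixes h :: "(nat \<Rightarrow> 'x) \<Rightarrow> real"
  assumes "finite I" and G: "open G" "G \<in> S"
    and "\<And>x x'. \<bar>h x - h x'\<bar> \<le> c * (\<Sum>i\<in>I. dist (x i) (x' i))"
    and "0 \<le> c" "\<And>x. 0 \<le> h x" "\<And>x. h x \<le> M"
    and "\<And>x i. i \<in> I \<Longrightarrow> x i \<notin> G \<Longrightarrow> h x = 0"
  shows "(\<integral>\<^sup>+x. ennreal (h x) \<partial>PiM I (\<lambda>_. \<mu>)) \<le>
    liminf (\<lambda>m. ennreal (a m ^ card I) * (\<integral>\<^sup>+x. ennreal (h x) \<partial>PiM I (\<lambda>_. q m)))"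
  using assms(1,4-)
proof (induction I arbitrary: h c M rule: finite_induct)
  case empty
  then show ?case
    by (simp add: PiM_empty nn_integral_count_space_finite Liminf_const)
next
  case (insert i I)
  note lip = insert.prems(1) and c = insert.prems(2) and nonneg = insert.prems(3)
    and le = insert.prems(4) and supp = insert.prems(5)
  obtain K where K: "0 \<le> K" "\<And>m. a m * measure (q m) G \<le> K"
    using mass_bounded[OF G(2)] by blast
  have M: "0 \<le> M"
    using nonneg le by (meson order_trans)
  have borel_h: "h \<in> borel_measurable borel"
    using coordinate_lipschitz_continuous[OF lip] by (rule borel_measurable_continuous_onI)
  have slice_zero: "h (z(i := x)) = 0" if "x \<notin> G" for z x
    using that by (intro supp[of i]) auto
  have slice_lip: "\<bar>h (z(i := x)) - h (z(i := x'))\<bar> \<le> c * dist x x'" for z x x'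
  proof -
    have "(\<Sum>j\<in>insert i I. dist ((z(i := x)) j) ((z(i := x')) j)) = dist x x' + (\<Sum>j\<in>I. 0)"
      using insert.hyps by (simp add: sum.insert) (intro sum.neutral, auto)
    then show ?thesis
      using lip[of "z(i := x)" "z(i := x')"] by (simp del: fun_upd_apply)
  qed
  have slice_diff: "\<bar>h (z(i := x)) - h (z'(i := x))\<bar> \<le> c * (\<Sum>j\<in>I. dist (z j) (z' j)) * indicator G x" for z z' x
  proof (cases "x \<in> G")
    case True
    have "(\<Sum>j\<in>insert i I. dist ((z(i := x)) j) ((z'(i := x)) j)) = (\<Sum>j\<in>I. dist (z j) (z' j))"
      using insert.hyps by (simp add: sum.insert) (intro sum.cong, auto)
    then show ?thesis
      using lip[of "z(i := x)" "z'(i := x)"] True by (simp del: fun_upd_apply)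
  next
    case False
    then show ?thesis
      using slice_zero by simp
  qed
  have slice_cont: "continuous_on UNIV (\<lambda>x. h (z(i := x)))" for z
    using slice_lip c by (intro lipschitz_on_continuous_on[of c] lipschitz_onI) (auto simp: dist_real_def)
  have slice_borel: "(\<lambda>x. h (z(i := x))) \<in> borel_measurable borel" for z
    using slice_cont by (rule borel_measurable_continuous_onI)
  have slice_test: "(\<lambda>x. h (z(i := x))) \<in> test_functions euclidean S" for z
    using slice_cont le nonneg slice_zero G(2)
    by (intro test_functions_euclideanI[of _ M G]) (auto simp: abs_le_iff intro: order_trans[of _ 0])
  have slice_\<mu>: "integrable \<mu> (\<lambda>x. h (z(i := x)))" for z
    using slice_borel le nonneg slice_zero G
    by (intro test_function_integrable[of _ M G]) (auto simp: abs_le_iff intro: order_trans[of _ 0])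
  have slice_q: "integrable (q m) (\<lambda>x. h (z(i := x)))" for z m
  proof -
    interpret prob_space "q m" by (rule prob_q)
    show ?thesis
      using slice_borel nonneg le by (intro integrable_const_bound[of _ M]) (auto cong: measurable_cong_sets)
  qed
  define H where "H m z = a m * (\<integral>x. h (z(i := x)) \<partial>q m)" for m z
  define Hlim where "Hlim z = (\<integral>x. h (z(i := x)) \<partial>\<mu>)" for z
  define Hinf where "Hinf s z = (INF m\<in>{s..}. H m z)" for s z
  have H_lim: "(\<lambda>m. H m z) \<longlonglongrightarrow> Hlim z" for z
    unfolding H_def Hlim_def by (rule vague[OF slice_test])
  have H_nonneg: "0 \<le> H m z" for m z
    unfolding H_def using a_nonneg nonneg by (intro mult_nonneg_nonneg integral_nonneg) auto
  have ind_q: "integrable (q m) (\<lambda>x. r * indicator G x)" for m and r :: real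
  proof -
    interpret prob_space "q m" by (rule prob_q)
    show ?thesis
      using G(1) by (intro integrable_mult_right) (simp add: integrable_indicator_iff less_top[symmetric])
  qed
  have ind_q_int: "a m * (\<integral>x. r * indicator G x \<partial>q m) \<le> r * K" if "0 \<le> r" for m and r :: real
    using K(2)[of m] that G(1) mult_left_mono[OF K(2)[of m] that] by (simp add: mult_ac)
  have H_le: "H m z \<le> M * K" for m z
  proof -
    have "(\<integral>x. h (z(i := x)) \<partial>q m) \<le> (\<integral>x. M * indicator G x \<partial>q m)"
      using le slice_zero M by (intro integral_mono slice_q ind_q) (auto simp: indicator_def)
    then show ?thesis
      unfolding H_def using ind_q_int[OF M, of m] a_nonneg[of m] mult_left_mono by (meson order_trans)
  qed
  \<comment> \<open>The Lipschitz constant does not depend on \<open>m\<close>, because two slices differ only on \<open>G\<close>, whose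
    scaled mass is at most \<open>K\<close>.\<close>
  have H_lip: "H m z - H m z' \<le> c * K * (\<Sum>j\<in>I. dist (z j) (z' j))" for m z z'
  proof -
    let ?r = "c * (\<Sum>j\<in>I. dist (z j) (z' j))"
    have r: "0 \<le> ?r"
      using c by (intro mult_nonneg_nonneg sum_nonneg) auto
    have "H m z - H m z' = a m * (\<integral>x. h (z(i := x)) - h (z'(i := x)) \<partial>q m)"
      unfolding H_def using slice_q by (simp add: right_diff_distrib)
    also have "\<dots> \<le> a m * (\<integral>x. ?r * indicator G x \<partial>q m)"
    proof (intro mult_left_mono integral_mono)
      show "h (z(i := x)) - h (z'(i := x)) \<le> ?r * indicator G x" for x
        using slice_diff[of z x z'] by linarith
    qed (use slice_q ind_q a_nonneg in auto)
    also have "\<dots> \<le> ?r * K"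
      by (rule ind_q_int[OF r])
    finally show ?thesis
      by (simp add: mult_ac)
  qed
  have bdd: "bdd_below ((\<lambda>m. H m z) ` {s..})" for s z
    using H_nonneg by (intro bdd_belowI2[of _ 0])
  have Hinf_le: "Hinf s z \<le> H m z" if "s \<le> m" for s m z
    unfolding Hinf_def using that bdd by (intro cINF_lower) auto
  have Hinf_ge: "r \<le> Hinf s z" if "\<And>m. s \<le> m \<Longrightarrow> r \<le> H m z" for r s z
    unfolding Hinf_def using that by (intro cINF_greatest) auto
  have Hinf_nonneg: "0 \<le> Hinf s z" for s z
    using H_nonneg by (intro Hinf_ge)
  have Hinf_lip1: "Hinf s z - Hinf s z' \<le> c * K * (\<Sum>j\<in>I. dist (z j) (z' j))" for s z z'
  proof -
    have "Hinf s z - c * K * (\<Sum>j\<in>I. dist (z j) (z' j)) \<le> Hinf s z'"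
    proof (rule Hinf_ge)
      fix m assume "s \<le> m"
      then show "Hinf s z - c * K * (\<Sum>j\<in>I. dist (z j) (z' j)) \<le> H m z'"
        using Hinf_le[of s m z] H_lip[of m z z'] by linarith
    qed
    then show ?thesis by linarith
  qed
  have Hinf_lip: "\<bar>Hinf s z - Hinf s z'\<bar> \<le> c * K * (\<Sum>j\<in>I. dist (z j) (z' j))" for s z z'
    using Hinf_lip1[of s z z'] Hinf_lip1[of s z' z] by (simp add: abs_le_iff dist_commute)
  have Hinf_lim: "(\<lambda>s. Hinf s z) \<longlonglongrightarrow> Hlim z" for z
  proof (rule LIMSEQ_I)
    fix e :: real assume "0 < e"
    then obtain s0 where s0: "\<And>m. s0 \<le> m \<Longrightarrow> norm (H m z - Hlim z) < e / 2"
      using LIMSEQ_D[OF H_lim[of z], of "e / 2"] by auto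
    have "norm (Hinf s z - Hlim z) < e" if "s0 \<le> s" for s
    proof -
      have "Hlim z - e / 2 \<le> Hinf s z"
      proof (rule Hinf_ge)
        fix m assume "s \<le> m"
        then show "Hlim z - e / 2 \<le> H m z"
          using s0[of m] that unfolding real_norm_def by linarith
      qed
      then show ?thesis
        using Hinf_le[of s s z] s0[OF that] \<open>0 < e\<close> unfolding real_norm_def by linarith
    qed
    then show "\<exists>s0. \<forall>s\<ge>s0. norm (Hinf s z - Hlim z) < e"
      by blast
  qed
  have Hinf_borel: "(\<lambda>z. Hinf s z) \<in> borel_measurable borel" for s
    using coordinate_lipschitz_continuous[OF Hinf_lip] by (rule borel_measurable_continuous_onI)
  have Hinf_meas: "(\<lambda>z. ennreal (Hinf s z)) \<in> borel_measurable (PiM I (\<lambda>_. \<mu>))" for s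
    using measurable_compose[OF measurable_PiM_nat_borel Hinf_borel] by simp
  have h_meas: "(\<lambda>x. ennreal (h x)) \<in> borel_measurable (PiM J (\<lambda>_. M'))"
    if "sets M' = sets borel" for J and M' :: "'x measure"
    using measurable_compose[OF measurable_PiM_nat_borel borel_h, of J "\<lambda>_. M'"] that by simp
  interpret \<mu>: product_sigma_finite "\<lambda>_. \<mu>" by (rule product_sigma_finite_\<mu>)
  let ?A = "\<lambda>m. ennreal (a m ^ card (insert i I)) * (\<integral>\<^sup>+x. ennreal (h x) \<partial>PiM (insert i I) (\<lambda>_. q m))"
  have A: "?A m = ennreal (a m ^ card I) * (\<integral>\<^sup>+z. ennreal (H m z) \<partial>PiM I (\<lambda>_. q m))" for m
  proof -
    interpret q: product_sigma_finite "\<lambda>_. q m" by (rule product_sigma_finite_q)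
    have meas: "(\<lambda>z. \<integral>\<^sup>+x. ennreal (h (z(i := x))) \<partial>q m) \<in> borel_measurable (PiM I (\<lambda>_. q m))"
    proof -
      have "(\<lambda>(z, x). ennreal (h (z(i := x)))) \<in> borel_measurable (PiM I (\<lambda>_. q m) \<Otimes>\<^sub>M q m)"
        using measurable_compose[OF measurable_add_dim h_meas[OF sets_q, of "insert i I" m], of ]
        by (simp add: case_prod_unfold)
      then show ?thesis
        using sigma_finite_measure.borel_measurable_nn_integral[OF prob_space_imp_sigma_finite[OF prob_q]]
        by simp
    qed
    have eq: "ennreal (H m z) = ennreal (a m) * (\<integral>\<^sup>+x. ennreal (h (z(i := x))) \<partial>q m)" for z
      unfolding H_def using slice_q nonneg a_nonneg
      by (subst nn_integral_eq_integral) (auto simp: ennreal_mult)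
    have "(\<integral>\<^sup>+z. ennreal (H m z) \<partial>PiM I (\<lambda>_. q m)) =
        ennreal (a m) * (\<integral>\<^sup>+z. \<integral>\<^sup>+x. ennreal (h (z(i := x))) \<partial>q m \<partial>PiM I (\<lambda>_. q m))"
      unfolding eq using meas by (rule nn_integral_cmult)
    also have "(\<integral>\<^sup>+z. \<integral>\<^sup>+x. ennreal (h (z(i := x))) \<partial>q m \<partial>PiM I (\<lambda>_. q m)) =
        (\<integral>\<^sup>+x. ennreal (h x) \<partial>PiM (insert i I) (\<lambda>_. q m))"
      using insert.hyps h_meas by (intro q.product_nn_integral_insert[symmetric]) auto
    finally show ?thesis
      using insert.hyps a_nonneg by (simp add: ennreal_mult mult_ac)
  qed
  have "(\<integral>\<^sup>+x. ennreal (h x) \<partial>PiM (insert i I) (\<lambda>_. \<mu>)) =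
      (\<integral>\<^sup>+z. \<integral>\<^sup>+x. ennreal (h (z(i := x))) \<partial>\<mu> \<partial>PiM I (\<lambda>_. \<mu>))"
    using insert.hyps h_meas by (intro \<mu>.product_nn_integral_insert) auto
  also have "\<dots> = (\<integral>\<^sup>+z. ennreal (Hlim z) \<partial>PiM I (\<lambda>_. \<mu>))"
    unfolding Hlim_def using slice_\<mu> nonneg by (subst nn_integral_eq_integral) auto
  also have "\<dots> = (\<integral>\<^sup>+z. liminf (\<lambda>s. ennreal (Hinf s z)) \<partial>PiM I (\<lambda>_. \<mu>))"
    using lim_imp_Liminf[OF _ tendsto_ennrealI[OF Hinf_lim]] by simp
  also have "\<dots> \<le> liminf (\<lambda>s. \<integral>\<^sup>+z. ennreal (Hinf s z) \<partial>PiM I (\<lambda>_. \<mu>))"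
    using Hinf_meas by (rule nn_integral_liminf)
  also have "\<dots> \<le> limsup (\<lambda>s. \<integral>\<^sup>+z. ennreal (Hinf s z) \<partial>PiM I (\<lambda>_. \<mu>))"
    by (rule Liminf_le_Limsup) simp
  also have "\<dots> \<le> liminf ?A"
  proof (rule Limsup_bounded, rule always_eventually, rule allI)
    fix s
    have "(\<integral>\<^sup>+z. ennreal (Hinf s z) \<partial>PiM I (\<lambda>_. \<mu>)) \<le>
        liminf (\<lambda>m. ennreal (a m ^ card I) * (\<integral>\<^sup>+z. ennreal (Hinf s z) \<partial>PiM I (\<lambda>_. q m)))"
    proof (rule insert.IH[OF Hinf_lip])
      show "0 \<le> c * K"
        using c K by simp
      show "Hinf s z \<le> M * K" for z
        using Hinf_le[of s s z] H_le[of s z] by linarith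
      show "Hinf s z = 0" if "j \<in> I" "z j \<notin> G" for z j
      proof -
        have "h (z(i := x)) = 0" for x
          using that insert.hyps by (intro supp[of j]) auto
        then have "H s z = 0"
          by (simp add: H_def)
        then show ?thesis
          using Hinf_le[of s s z] Hinf_nonneg[of s z] by simp
      qed
    qed (rule Hinf_nonneg)
    also have "\<dots> \<le> liminf ?A"
      unfolding A
    proof (rule Liminf_mono)
      show "\<forall>\<^sub>F m in sequentially. ennreal (a m ^ card I) * (\<integral>\<^sup>+z. ennreal (Hinf s z) \<partial>PiM I (\<lambda>_. q m))
          \<le> ennreal (a m ^ card I) * (\<integral>\<^sup>+z. ennreal (H m z) \<partial>PiM I (\<lambda>_. q m))"
        using eventually_ge_at_top[of s]
        by eventually_elim (auto intro!: mult_left_mono nn_integral_mono ennreal_leI Hinf_le)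
    qed
    finally show "(\<integral>\<^sup>+z. ennreal (Hinf s z) \<partial>PiM I (\<lambda>_. \<mu>)) \<le> liminf ?A" .
  qed
  finally show ?case .
qed

end

section \<open>Limits inferior in the extended nonnegative reals\<close>

text \<open>
  Fatou's lemma for the counting measure on \<open>J\<close>.
\<close>

lemma sum_liminf_le:
  fixes X :: "'j \<Rightarrow> nat \<Rightarrow> ennreal"
  assumes "finite J"
  shows "(\<Sum>j\<in>J. liminf (X j)) \<le> liminf (\<lambda>m. \<Sum>j\<in>J. X j m)"
  using nn_integral_liminf[of "\<lambda>m j. X j m" "count_space J"] assms
  by (simp add: nn_integral_count_space_finite)

lemma liminf_add_null_le:
  fixes X e :: "nat \<Rightarrow> ennreal"
  assumes "e \<longlonglongrightarrow> 0"
  shows "liminf (\<lambda>m. X m + e m) \<le> liminf X"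
proof -
  obtain r where r: "strict_mono r" "(X \<circ> r) \<longlonglongrightarrow> liminf X"
    using liminf_subseq_lim[of X] by blast
  have "(\<lambda>m. X (r m) + e (r m)) \<longlonglongrightarrow> liminf X + 0"
    using r(2) LIMSEQ_subseq_LIMSEQ[OF assms r(1)] by (intro tendsto_add) (auto simp: o_def)
  then have "liminf ((\<lambda>m. X m + e m) \<circ> r) = liminf X"
    using lim_imp_Liminf[of sequentially "(\<lambda>m. X m + e m) \<circ> r"] by (simp add: o_def)
  then show ?thesis
    using liminf_subseq_mono[OF r(1), of "\<lambda>m. X m + e m"] by simp
qed

text \<open>
  If the upper limit of \<open>X\<close> exceeded \<open>b\<close>, the convergence of the sum would push the lower limit of
  \<open>Y\<close> below \<open>c\<close> along a subsequence. This turns lower bounds for a function and for its difference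
  to a function with known limit into a limit.
\<close>

lemma tendsto_of_complementary_bounds:
  fixes X Y :: "nat \<Rightarrow> ennreal"
  assumes "(\<lambda>m. X m + Y m) \<longlonglongrightarrow> b + c" "b + c < \<infinity>" "b \<le> liminf X" "c \<le> liminf Y"
  shows "X \<longlonglongrightarrow> b"
proof -
  have "limsup X \<le> b"
  proof -
    obtain r where r: "strict_mono r" "(X \<circ> r) \<longlonglongrightarrow> limsup X"
      using limsup_subseq_lim[of X] by blast
    obtain t where t: "strict_mono t" "(Y \<circ> r \<circ> t) \<longlonglongrightarrow> liminf (Y \<circ> r)"
      using liminf_subseq_lim[of "Y \<circ> r"] by blast
    have "(\<lambda>m. X (r (t m)) + Y (r (t m))) \<longlonglongrightarrow> limsup X + liminf (Y \<circ> r)"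
      using LIMSEQ_subseq_LIMSEQ[OF r(2) t(1)] t(2) by (intro tendsto_add) (auto simp: o_def)
    moreover have "(\<lambda>m. X (r (t m)) + Y (r (t m))) \<longlonglongrightarrow> b + c"
      using LIMSEQ_subseq_LIMSEQ[OF LIMSEQ_subseq_LIMSEQ[OF assms(1) r(1)] t(1)] by (simp add: o_def)
    ultimately have "limsup X + liminf (Y \<circ> r) = b + c"
      using LIMSEQ_unique by blast
    moreover have "c \<le> liminf (Y \<circ> r)"
      using assms(4) liminf_subseq_mono[OF r(1), of Y] by simp
    ultimately have "c + limsup X \<le> c + b"
      by (metis add.commute add_left_mono)
    moreover have "c \<noteq> \<infinity>"
      using assms(2) by auto
    ultimately show ?thesis
      by (simp add: ennreal_add_left_cancel_le)
  qed
  then show ?thesis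
    using assms(3) Liminf_le_Limsup[of sequentially X] tendsto_iff_Liminf_eq_Limsup[of sequentially X b]
    by (metis order.antisym order.trans sequentially_bot)
qed

section \<open>Injective index tuples\<close>

abbreviation injections :: "nat \<Rightarrow> nat \<Rightarrow> (nat \<Rightarrow> nat) set" where
  "injections k N \<equiv> {j \<in> {..<k} \<rightarrow>\<^sub>E {..<N}. inj_on j {..<k}}"

lemma finite_injections: "finite (injections k N)"
  by (intro finite_subset[OF _ finite_PiE[of "{..<k}" "\<lambda>_. {..<N}"]]) auto

lemma card_injections_le: "card (injections k N) \<le> N ^ k"
proof -
  have "card (injections k N) \<le> card ({..<k} \<rightarrow>\<^sub>E {..<N})"
    by (intro card_mono finite_PiE) auto
  then show ?thesis
    by (simp add: card_PiE)
qed

lemma injections_range: "j \<in> injections k N \<Longrightarrow> j ` {..<k} \<subseteq> {..<N}"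
  by auto

text \<open>
  An injection into a set with exactly \<open>k\<close> elements is onto, so the tuples in question are the
  orderings of \<open>R\<close>.
\<close>

lemma card_injections_onto:
  assumes "R \<subseteq> {..<N}"
  shows "card {j \<in> injections k N. j ` {..<k} = R} = (if card R = k then fact k else 0)"
proof (cases "card R = k")
  case True
  have fin: "finite R"
    using assms finite_subset by blast
  have "{j \<in> injections k N. j ` {..<k} = R} = {j \<in> {..<k} \<rightarrow>\<^sub>E R. inj_on j {..<k}}"
  proof (intro equalityI subsetI)
    fix j assume "j \<in> {j \<in> {..<k} \<rightarrow>\<^sub>E R. inj_on j {..<k}}"
    then have j: "j \<in> {..<k} \<rightarrow>\<^sub>E R" "inj_on j {..<k}"
      by auto
    then have "j ` {..<k} \<subseteq> R" "card (j ` {..<k}) = card R"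
      using card_image[OF j(2)] True by auto
    then have "j ` {..<k} = R"
      using card_subset_eq[OF fin] by blast
    then show "j \<in> {j \<in> injections k N. j ` {..<k} = R}"
      using j assms by (auto simp: PiE_iff)
  qed (auto simp: PiE_iff)
  then show ?thesis
    using card_inj_on_subset_funcset[of "{..<k}" R "{..<k}"] fin True by (simp add: fact_prod_rev)
next
  case False
  have "{j \<in> injections k N. j ` {..<k} = R} = {}"
    using False card_image by fastforce
  then show ?thesis
    using False by (simp only: card.empty if_False)
qed

lemma exists_injection_into:
  assumes "k \<le> card R" "R \<subseteq> {..<N}"
  shows "\<exists>j\<in>injections k N. j ` {..<k} \<subseteq> R"
proof -
  obtain R' where R': "R' \<subseteq> R" "card R' = k" "finite R'"
    using obtain_subset_with_card_n[OF assms(1)] by blast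
  have "card {j \<in> injections k N. j ` {..<k} = R'} = fact k"
    using R' assms(2) by (subst card_injections_onto) auto
  then have "{j \<in> injections k N. j ` {..<k} = R'} \<noteq> {}"
    by (metis card.empty fact_nonzero)
  then show ?thesis
    using R'(1) by blast
qed

lemma sets_PiM_UNIV_eq_borel:
  fixes Q :: "'x::second_countable_topology measure"
  assumes "sets Q = sets borel"
  shows "sets (PiM UNIV (\<lambda>_ :: nat. Q)) = sets borel"
proof -
  have "sets (PiM UNIV (\<lambda>_ :: nat. Q)) = sets (PiM UNIV (\<lambda>_ :: nat. borel))"
    using assms by (intro sets_PiM_cong) auto
  then show ?thesis
    by (simp only: sets_PiM_equal_borel)
qed

text \<open>
  Distinct coordinates of an independent and identically distributed sequence form such a family again.
\<close>

lemma nn_integral_PiM_reindex: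
  assumes "prob_space Q" "inj_on j {..<k}" "f \<in> borel_measurable (PiM {..<k} (\<lambda>_. Q))"
  shows "(\<integral>\<^sup>+x. f (\<lambda>l\<in>{..<k}. x (j l)) \<partial>PiM (UNIV :: nat set) (\<lambda>_. Q)) = (\<integral>\<^sup>+u. f u \<partial>PiM {..<k} (\<lambda>_. Q))"
proof -
  have "(\<lambda>x. \<lambda>l\<in>{..<k}. x (j l)) \<in> measurable (PiM (UNIV :: nat set) (\<lambda>_. Q)) (PiM {..<k} (\<lambda>_. Q))"
    by (intro measurable_restrict measurable_component_singleton) auto
  then have "(\<integral>\<^sup>+x. f (\<lambda>l\<in>{..<k}. x (j l)) \<partial>PiM (UNIV :: nat set) (\<lambda>_. Q)) =
      (\<integral>\<^sup>+u. f u \<partial>distr (PiM UNIV (\<lambda>_. Q)) (PiM {..<k} (\<lambda>_. Q)) (\<lambda>x. \<lambda>l\<in>{..<k}. x (j l)))"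
    using assms(3) by (simp add: nn_integral_distr)
  then show ?thesis
    using distr_PiM_reindex[of UNIV "\<lambda>_. Q" j "{..<k}"] assms(1,2) by simp
qed

lemma nn_integral_PiM_prod:
  assumes Q: "prob_space Q" and j: "inj_on j {..<k}" and f: "f \<in> borel_measurable Q"
  shows "(\<integral>\<^sup>+x. (\<Prod>l<k. f (x (j l))) \<partial>PiM (UNIV :: nat set) (\<lambda>_. Q)) = (\<integral>\<^sup>+x. f x \<partial>Q) ^ k"
proof -
  interpret product_sigma_finite "\<lambda>_ :: nat. Q"
    unfolding product_sigma_finite_def using prob_space_imp_sigma_finite[OF Q] by simp
  have "(\<integral>\<^sup>+x. (\<Prod>l<k. f (x (j l))) \<partial>PiM (UNIV :: nat set) (\<lambda>_. Q)) =
      (\<integral>\<^sup>+u. (\<Prod>l<k. f (u l)) \<partial>PiM {..<k} (\<lambda>_. Q))"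
    using f by (subst nn_integral_PiM_reindex[OF Q j, symmetric]) (auto intro!: nn_integral_cong prod.cong)
  also have "\<dots> = (\<integral>\<^sup>+x. f x \<partial>Q) ^ k"
    using f by (subst product_nn_integral_prod) auto
  finally show ?thesis .
qed

section \<open>Independent marks at fixed locations\<close>

context vague_sequence
begin

lemma q_null:
  assumes "B \<in> S"
  shows "(\<lambda>m. measure (q m) B) \<longlonglongrightarrow> 0"
proof -
  obtain K where K: "0 \<le> K" "\<And>m. a m * measure (q m) B \<le> K"
    using mass_bounded[OF assms] by blast
  have "(\<lambda>m. K / a m) \<longlonglongrightarrow> 0"
    by (rule tendsto_divide_0[OF tendsto_const filterlim_at_top_imp_at_infinity[OF a_at_top]])
  moreover have "\<forall>\<^sub>F m in sequentially. norm (measure (q m) B) \<le> K / a m"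
    using filterlim_at_top_dense[THEN iffD1, OF a_at_top, rule_format, of 0]
  proof eventually_elim
    case (elim m)
    then show ?case
      using K(2)[of m] by (simp add: field_simps)
  qed
  ultimately show ?thesis
    by (rule Lim_null_comparison[rotated])
qed

text \<open>
  The probability that \<open>k + 1\<close> independent marks lie in \<open>B\<close> is of smaller order than \<open>1 / a m ^ k\<close>.
\<close>

lemma error_null:
  assumes "B \<in> S"
  shows "(\<lambda>m. a m ^ k * measure (q m) B ^ Suc k) \<longlonglongrightarrow> 0"
proof -
  obtain K where K: "0 \<le> K" "\<And>m. a m * measure (q m) B \<le> K"
    using mass_bounded[OF assms] by blast
  have "(\<lambda>m. K ^ k * measure (q m) B) \<longlonglongrightarrow> 0"
    using tendsto_mult[OF tendsto_const q_null[OF assms]] by simp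
  moreover have "\<forall>\<^sub>F m in sequentially. norm (a m ^ k * measure (q m) B ^ Suc k) \<le> K ^ k * measure (q m) B"
  proof (intro always_eventually allI)
    fix m
    have "(a m * measure (q m) B) ^ k * measure (q m) B \<le> K ^ k * measure (q m) B"
      using K a_nonneg by (intro mult_right_mono power_mono) auto
    then show "norm (a m ^ k * measure (q m) B ^ Suc k) \<le> K ^ k * measure (q m) B"
      using a_nonneg by (simp add: power_mult_distrib mult_ac)
  qed
  ultimately show ?thesis
    by (rule Lim_null_comparison[rotated])
qed

text \<open>
  Here \<open>h\<close> is a functional of the marks at \<open>N\<close> fixed locations, the tuple \<open>j\<close> selects \<open>k\<close> of them, and
  \<open>hl j\<close> is what \<open>h\<close> becomes when the unselected marks leave every member of the ideal. Let \<open>G s\<close>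
  exhaust the ideal. The events that exactly the marks selected by \<open>j\<close> lie in \<open>G s\<close> are disjoint for
  different ranges of \<open>j\<close>, and each range belongs to \<open>fact k\<close> tuples; this accounts for the factor on
  the right. On such an event \<open>h\<close> coincides with \<open>v s j\<close>, which is at least \<open>\<Lambda> s j\<close>, the largest
  function of the selected marks with Lipschitz constant \<open>s\<close> that stays below \<open>v s j\<close> everywhere.
  By \<open>product_lower_bound\<close> the scaled integrals of \<open>\<Lambda> s j\<close> are asymptotically at least those with
  respect to the powers of \<open>\<mu>\<close>. Finally \<open>\<Lambda> s j\<close> rises to at least \<open>hl j\<close> when \<open>s\<close> tends to infinity.
\<close>

lemma marked_lower_bound:
  fixes h :: "(nat \<Rightarrow> 'x) \<Rightarrow> real"
  assumes h_meas: "h \<in> borel_measurable borel"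
    and h_nonneg: "\<And>x. 0 \<le> h x" and h_le: "\<And>x. h x \<le> M" and hl_le: "\<And>j u. hl j u \<le> M"
    and lim: "\<And>j xs u. j \<in> injections k N \<Longrightarrow> (\<And>l. l < k \<Longrightarrow> (\<lambda>s. xs s (j l)) \<longlonglongrightarrow> u l) \<Longrightarrow>
        (\<And>l. l < k \<Longrightarrow> u l \<in> \<Union>S) \<Longrightarrow>
        (\<And>i B. i < N \<Longrightarrow> i \<notin> j ` {..<k} \<Longrightarrow> B \<in> S \<Longrightarrow> \<forall>\<^sub>F s in sequentially. xs s i \<notin> B) \<Longrightarrow>
        (\<lambda>s. h (xs s)) \<longlonglongrightarrow> hl j u"
  shows "(\<Sum>j\<in>injections k N. \<integral>\<^sup>+u. ennreal (hl j u) \<partial>\<mu>_power k) \<le>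
    liminf (\<lambda>m. fact k * (ennreal (a m ^ k) * (\<integral>\<^sup>+x. ennreal (h x) \<partial>marks_law m)))"
proof -
  obtain G where G: "\<And>s. open (G s)" "\<And>s. G s \<in> S" "incseq G" "\<And>B. B \<in> S \<Longrightarrow> \<exists>s. B \<subseteq> G s"
    by (rule exhaustion) blast
  have G_mono: "G s \<subseteq> G t" if "s \<le> t" for s t
    using G(3) that by (simp add: incseq_def)
  have M: "0 \<le> M"
    using h_nonneg h_le by (meson order_trans)
  \<comment> \<open>On positions with an unselected mark in \<open>G s\<close> the largest possible value \<open>M\<close> imposes no
    constraint on the envelope and keeps \<open>v\<close> increasing in \<open>s\<close>. The price is an error on the
    event that more than \<open>k\<close> marks lie in \<open>G s\<close>.\<close>
  define v where "v s j x = (if \<exists>l<k. x (j l) \<notin> G s then 0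
      else if \<exists>i<N. i \<notin> j ` {..<k} \<and> x i \<in> G s then M else h x)" for s j x
  define V where "V s j u x = v s j x + real s * (\<Sum>l<k. dist (u l) (x (j l)))" for s j u x
  define \<Lambda> where "\<Lambda> s j u = (INF x. V s j u x)" for s j u
  have v_nonneg: "0 \<le> v s j x" for s j x
    unfolding v_def using M h_nonneg by auto
  have v_le: "v s j x \<le> M" for s j x
    unfolding v_def using M h_le by auto
  have v_mono: "v s j x \<le> v t j x" if "s \<le> t" for s t j x
    unfolding v_def using G_mono[OF that] M h_nonneg h_le by (auto simp: subset_iff)
  have V_nonneg: "0 \<le> V s j u x" for s j u x
    unfolding V_def using v_nonneg by (intro add_nonneg_nonneg mult_nonneg_nonneg sum_nonneg) auto
  have bdd: "bdd_below (range (V s j u))" for s j u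
    using V_nonneg by (intro bdd_belowI2[of _ 0])
  have \<Lambda>_le: "\<Lambda> s j u \<le> V s j u x" for s j u x
    unfolding \<Lambda>_def using bdd by (intro cINF_lower) auto
  have \<Lambda>_ge: "r \<le> \<Lambda> s j u" if "\<And>x. r \<le> V s j u x" for r s j u
    unfolding \<Lambda>_def using that by (intro cINF_greatest) auto
  have \<Lambda>_nonneg: "0 \<le> \<Lambda> s j u" for s j u
    using V_nonneg by (intro \<Lambda>_ge)
  have \<Lambda>_le_v: "\<Lambda> s j u \<le> v s j x" if "\<And>l. l < k \<Longrightarrow> x (j l) = u l" for s j u x
    using \<Lambda>_le[of s j u x] that by (simp add: V_def)
  have extend: "\<exists>x. \<forall>l<k. x (j l) = u l" if "inj_on j {..<k}" for j and u :: "nat \<Rightarrow> 'x"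
    using that by (intro exI[of _ "\<lambda>i. u (the_inv_into {..<k} j i)"]) (auto simp: the_inv_into_f_f)
  have \<Lambda>_le_M: "\<Lambda> s j u \<le> M" if "inj_on j {..<k}" for s j u
    using extend[OF that, of u] \<Lambda>_le_v v_le by (meson order_trans)
  have \<Lambda>_supp: "\<Lambda> s j u = 0" if inj: "inj_on j {..<k}" and l: "l < k" "u l \<notin> G s" for s j u l
  proof -
    obtain x where x: "\<And>l. l < k \<Longrightarrow> x (j l) = u l"
      using extend[OF inj] by blast
    then have "v s j x = 0"
      using l by (auto simp: v_def)
    then show ?thesis
      using \<Lambda>_le_v[where x=x and j=j and u=u and s=s] x \<Lambda>_nonneg[of s j u] by simp
  qed
  have \<Lambda>_mono: "\<Lambda> s j u \<le> \<Lambda> t j u" if "s \<le> t" for s t j u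
  proof (rule \<Lambda>_ge)
    fix x
    have "V s j u x \<le> V t j u x"
      unfolding V_def using v_mono[OF that] that by (intro add_mono mult_right_mono sum_nonneg) auto
    then show "\<Lambda> s j u \<le> V t j u x"
      using \<Lambda>_le[of s j u x] by simp
  qed
  have \<Lambda>_lip1: "\<Lambda> s j u - real s * (\<Sum>l<k. dist (u l) (u' l)) \<le> \<Lambda> s j u'" for s j u u'
  proof (rule \<Lambda>_ge)
    fix x
    have "(\<Sum>l<k. dist (u l) (x (j l))) \<le> (\<Sum>l<k. dist (u l) (u' l)) + (\<Sum>l<k. dist (u' l) (x (j l)))"
      unfolding sum.distrib[symmetric] by (intro sum_mono dist_triangle)
    then have "real s * (\<Sum>l<k. dist (u l) (x (j l))) \<le>
        real s * (\<Sum>l<k. dist (u l) (u' l)) + real s * (\<Sum>l<k. dist (u' l) (x (j l)))"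
      unfolding distrib_left[symmetric] by (intro mult_left_mono) auto
    then show "\<Lambda> s j u - real s * (\<Sum>l<k. dist (u l) (u' l)) \<le> V s j u' x"
      using \<Lambda>_le[of s j u x] unfolding V_def by linarith
  qed
  have \<Lambda>_lip: "\<bar>\<Lambda> s j u - \<Lambda> s j u'\<bar> \<le> real s * (\<Sum>l<k. dist (u l) (u' l))" for s j u u'
    using \<Lambda>_lip1[of s j u u'] \<Lambda>_lip1[of s j u' u] by (simp add: abs_le_iff dist_commute)
  have \<Lambda>_meas: "(\<lambda>u. ennreal (\<Lambda> s j u)) \<in> borel_measurable (PiM {..<k} (\<lambda>_. Q))"
    if "sets Q = sets borel" for s j and Q :: "'x measure"
  proof -
    have "\<Lambda> s j \<in> borel_measurable borel"
      using coordinate_lipschitz_continuous[OF \<Lambda>_lip] by (rule borel_measurable_continuous_onI)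
    then show ?thesis
      using measurable_compose[OF measurable_PiM_nat_borel \<open>\<Lambda> s j \<in> _\<close>, of "{..<k}" "\<lambda>_. Q"] that
      by simp
  qed
  \<comment> \<open>Suppose the limit \<open>L\<close> of the envelopes were smaller than \<open>hl j u\<close>. Positions that nearly attain
    the infimum have selected marks tending to \<open>u\<close>, because of the penalty, and unselected marks
    outside \<open>G s\<close>, because \<open>v\<close> would be \<open>M\<close> otherwise. Along them \<open>h\<close> tends to \<open>hl j u\<close>, which
    contradicts their values being close to \<open>L\<close>.\<close>
  have \<Lambda>_lim: "ennreal (hl j u) \<le> liminf (\<lambda>s. ennreal (\<Lambda> s j u))"
    if j: "j \<in> injections k N" and u: "\<forall>l<k. u l \<in> \<Union>S" for j u
  proof -
    have inj: "inj_on j {..<k}"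
      using j by simp
    obtain L where L: "(\<lambda>s. \<Lambda> s j u) \<longlonglongrightarrow> L" "\<And>s. \<Lambda> s j u \<le> L"
      using incseq_convergent[of "\<lambda>s. \<Lambda> s j u" M] \<Lambda>_mono \<Lambda>_le_M[OF inj]
      by (auto simp: incseq_def)
    have "hl j u \<le> L"
    proof (rule ccontr)
      assume "\<not> hl j u \<le> L"
      then have less: "L < hl j u" by simp
      have "\<exists>x. V s j u x < L + 1 / real (Suc s)" for s
      proof (rule ccontr)
        assume "\<nexists>x. V s j u x < L + 1 / real (Suc s)"
        then have "L + 1 / real (Suc s) \<le> \<Lambda> s j u"
          by (intro \<Lambda>_ge) (simp add: not_less)
        moreover have "0 < 1 / real (Suc s)" by simp
        ultimately show False
          using L(2)[of s] by linarith
      qed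
      then obtain xs where xs: "\<And>s. V s j u (xs s) < L + 1 / real (Suc s)"
        by metis
      have L0: "0 \<le> L"
        using L(2)[of 0] \<Lambda>_nonneg[of 0 j u] by linarith
      have v_xs: "v s j (xs s) < L + 1 / real (Suc s)" for s
      proof -
        have "0 \<le> real s * (\<Sum>l<k. dist (u l) (xs s (j l)))"
          by (intro mult_nonneg_nonneg sum_nonneg) auto
        then show ?thesis
          using xs[of s] unfolding V_def by linarith
      qed
      have near: "(\<lambda>s. xs s (j l)) \<longlonglongrightarrow> u l" if l: "l < k" for l
      proof (rule metric_tendsto_imp_tendsto)
        show "(\<lambda>s. (L + 1) / real s) \<longlonglongrightarrow> 0"
          by (rule lim_const_over_n)
        show "\<forall>\<^sub>F s in sequentially. dist (xs s (j l)) (u l) \<le> dist ((L + 1) / real s) 0"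
          using eventually_gt_at_top[of 0]
        proof eventually_elim
          case (elim s)
          have "dist (u l) (xs s (j l)) \<le> (\<Sum>l<k. dist (u l) (xs s (j l)))"
            using l by (intro member_le_sum) auto
          then have "real s * dist (u l) (xs s (j l)) \<le> real s * (\<Sum>l<k. dist (u l) (xs s (j l)))"
            by (intro mult_left_mono) auto
          also have "\<dots> \<le> V s j u (xs s)"
            unfolding V_def using v_nonneg by simp
          also have "\<dots> \<le> L + 1"
            using less_imp_le[OF xs[of s]] by (rule order_trans) simp
          finally show ?case
            using elim L0 by (simp add: field_simps dist_commute)
        qed
      qed
      obtain s0 where s0: "u ` {..<k} \<subseteq> G s0"
        using G(4)[OF finite_subset_mem, of "u ` {..<k}"] u by auto
      have "\<forall>\<^sub>F s in sequentially. \<forall>l\<in>{..<k}. xs s (j l) \<in> G s0"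
        using near s0 G(1) topological_tendstoD by (subst eventually_ball_finite_distrib) (auto, blast)
      moreover have "\<forall>\<^sub>F s in sequentially. L + 1 / real (Suc s) < hl j u"
      proof -
        have "(\<lambda>s. L + 1 / real (Suc s)) \<longlonglongrightarrow> L + 0"
          using LIMSEQ_inverse_real_of_nat by (intro tendsto_add tendsto_const) (simp add: inverse_eq_divide)
        then show ?thesis
          using less order_tendstoD(2) by simp
      qed
      ultimately have ev: "\<forall>\<^sub>F s in sequentially.
          h (xs s) < L + 1 / real (Suc s) \<and> (\<forall>i<N. i \<notin> j ` {..<k} \<longrightarrow> xs s i \<notin> G s)"
        using eventually_ge_at_top[of s0]
      proof eventually_elim
        case (elim s)
        have "\<not> (\<exists>l<k. xs s (j l) \<notin> G s)"
          using elim(1,3) G_mono by blast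
        moreover have "\<not> (\<exists>i<N. i \<notin> j ` {..<k} \<and> xs s i \<in> G s)"
        proof
          assume "\<exists>i<N. i \<notin> j ` {..<k} \<and> xs s i \<in> G s"
          then have "v s j (xs s) = M"
            unfolding v_def if_not_P[OF \<open>\<not> (\<exists>l<k. xs s (j l) \<notin> G s)\<close>] by (rule if_P)
          then show False
            using v_xs[of s] elim(2) hl_le[of j u] by linarith
        qed
        moreover from this have "v s j (xs s) = h (xs s)"
          unfolding v_def if_not_P[OF \<open>\<not> (\<exists>l<k. xs s (j l) \<notin> G s)\<close>] by (rule if_not_P)
        ultimately show ?case
          using v_xs[of s] by (simp del: not_ex) blast
      qed
      have h_lim: "(\<lambda>s. h (xs s)) \<longlonglongrightarrow> hl j u"
      proof (rule lim[where j=j and xs=xs and u=u])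
        show "j \<in> injections k N"
          by (rule j)
        show "(\<lambda>s. xs s (j l)) \<longlonglongrightarrow> u l" if "l < k" for l
          by (rule near[OF that])
        show "u l \<in> \<Union>S" if "l < k" for l
          using u that by blast
        fix i B assume i: "i < N" "i \<notin> j ` {..<k}" and "B \<in> S"
        then obtain s1 where s1: "B \<subseteq> G s1"
          using G(4) by blast
        show "\<forall>\<^sub>F s in sequentially. xs s i \<notin> B"
          using ev eventually_ge_at_top[of s1]
        proof eventually_elim
          case (elim s)
          then show ?case
            using i s1 G_mono[of s1 s] by blast
        qed
      qed
      have bound_lim: "(\<lambda>s. L + 1 / real (Suc s)) \<longlonglongrightarrow> L + 0"
        using LIMSEQ_inverse_real_of_nat by (intro tendsto_add tendsto_const) (simp add: inverse_eq_divide)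
      have "\<forall>\<^sub>F s in sequentially. h (xs s) \<le> L + 1 / real (Suc s)"
        using ev by eventually_elim simp
      then have "hl j u \<le> L + 0"
        by (rule tendsto_le[OF sequentially_bot bound_lim h_lim])
      then show False
        using less by simp
    qed
    then have "ennreal (hl j u) \<le> ennreal L"
      by (rule ennreal_leI)
    also have "\<dots> = liminf (\<lambda>s. ennreal (\<Lambda> s j u))"
      using lim_imp_Liminf[OF sequentially_bot tendsto_ennrealI[OF L(1)]] by simp
    finally show ?thesis .
  qed
  let ?J = "injections k N"
  let ?P = "\<lambda>m. marks_law m"
  let ?A = "\<lambda>m. fact k * (ennreal (a m ^ k) * (\<integral>\<^sup>+x. ennreal (h x) \<partial>?P m))"
  have fixed_s: "(\<Sum>j\<in>?J. \<integral>\<^sup>+u. ennreal (\<Lambda> s j u) \<partial>\<mu>_power k) \<le> liminf ?A" for s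
  proof -
    let ?O = "\<lambda>j. {..<N} - j ` {..<k}"
    \<comment> \<open>The error term: \<open>j(k := i)\<close> lists the selected indices and one further index \<open>i\<close>, and
      \<open>?X j\<close> vanishes unless all these \<open>k + 1\<close> marks lie in \<open>G s\<close> for some such \<open>i\<close>.\<close>
    let ?X = "\<lambda>j x. ennreal M * (\<Sum>i\<in>?O j. \<Prod>l<Suc k. indicator (G s) (x ((j(k := i)) l))) :: ennreal"
    let ?e = "\<lambda>m. (\<Sum>j\<in>?J. ennreal (M * real (card (?O j)) * (a m ^ k * measure (q m) (G s) ^ Suc k)))"
    have pointwise: "(\<Sum>j\<in>?J. ennreal (\<Lambda> s j (\<lambda>l\<in>{..<k}. x (j l)))) \<le>
        fact k * ennreal (h x) + (\<Sum>j\<in>?J. ?X j x)" for x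
    proof -
      let ?R = "{i \<in> {..<N}. x i \<in> G s}"
      have one: "ennreal (\<Lambda> s j (\<lambda>l\<in>{..<k}. x (j l))) \<le>
          (if j ` {..<k} = ?R then ennreal (h x) else 0) + ?X j x" if j: "j \<in> ?J" for j
      proof -
        have le: "\<Lambda> s j (\<lambda>l\<in>{..<k}. x (j l)) \<le> v s j x"
          by (intro \<Lambda>_le_v) auto
        show ?thesis
        proof (cases "\<exists>l<k. x (j l) \<notin> G s")
          case True
          then have "v s j x = 0"
            by (simp add: v_def)
          then show ?thesis
            using le by (simp add: ennreal_neg)
        next
          case in_G: False
          show ?thesis
          proof (cases "\<exists>i<N. i \<notin> j ` {..<k} \<and> x i \<in> G s")
            case True
            then obtain i where i: "i \<in> ?O j" "x i \<in> G s"
              by auto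
            have "(1::ennreal) = (\<Prod>l<Suc k. indicator (G s) (x ((j(k := i)) l)))"
              using in_G i(2) by (simp add: lessThan_Suc prod.neutral)
            also have "\<dots> \<le> (\<Sum>i\<in>?O j. \<Prod>l<Suc k. indicator (G s) (x ((j(k := i)) l)))"
              using i(1) by (intro member_le_sum) auto
            finally have "ennreal M * 1 \<le> ?X j x"
              by (intro mult_left_mono) auto
            moreover have "ennreal (\<Lambda> s j (\<lambda>l\<in>{..<k}. x (j l))) \<le> ennreal M"
              using le v_le[of s j x] by (intro ennreal_leI) linarith
            ultimately have "ennreal (\<Lambda> s j (\<lambda>l\<in>{..<k}. x (j l))) \<le> ?X j x"
              unfolding mult_1_right by (rule order_trans[rotated])
            then show ?thesis
              by (intro add_increasing zero_le)
          next
            case False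
            have "j ` {..<k} = ?R"
              using in_G False injections_range[OF j] by auto
            moreover have "v s j x = h x"
              unfolding v_def if_not_P[OF in_G] by (rule if_not_P[OF False])
            ultimately have "ennreal (\<Lambda> s j (\<lambda>l\<in>{..<k}. x (j l))) \<le>
                (if j ` {..<k} = ?R then ennreal (h x) else 0)"
              using le by (simp only: if_True simp_thms ennreal_leI)
            then show ?thesis
              by (intro add_increasing2 zero_le)
          qed
        qed
      qed
      have "(\<Sum>j\<in>?J. ennreal (\<Lambda> s j (\<lambda>l\<in>{..<k}. x (j l)))) \<le>
          (\<Sum>j\<in>?J. (if j ` {..<k} = ?R then ennreal (h x) else 0)) + (\<Sum>j\<in>?J. ?X j x)"
        unfolding sum.distrib[symmetric] by (intro sum_mono one)
      moreover have "(\<Sum>j\<in>?J. (if j ` {..<k} = ?R then ennreal (h x) else 0)) \<le> fact k * ennreal (h x)"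
      proof -
        have "card {j \<in> ?J. j ` {..<k} = ?R} \<le> fact k"
          by (subst card_injections_onto) auto
        then have "of_nat (card {j \<in> ?J. j ` {..<k} = ?R}) \<le> (of_nat (fact k) :: ennreal)"
          by (rule of_nat_mono)
        then have "of_nat (card {j \<in> ?J. j ` {..<k} = ?R}) * ennreal (h x) \<le> fact k * ennreal (h x)"
          unfolding of_nat_fact by (rule mult_right_mono) simp
        moreover have "(\<Sum>j\<in>?J. (if j ` {..<k} = ?R then ennreal (h x) else 0)) =
            of_nat (card {j \<in> ?J. j ` {..<k} = ?R}) * ennreal (h x)"
          using finite_injections[of k N] by (simp add: sum.If_cases Int_def)
        ultimately show ?thesis
          by (simp only:)
      qed
      ultimately show ?thesis
        by (rule order_trans[OF _ add_right_mono])
    qed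
    have bound: "(\<Sum>j\<in>?J. ennreal (a m ^ k) * (\<integral>\<^sup>+u. ennreal (\<Lambda> s j u) \<partial>PiM {..<k} (\<lambda>_. q m))) \<le> ?A m + ?e m" for m
    proof -
      have sets_P: "sets (?P m) = sets borel"
        by (rule sets_PiM_UNIV_eq_borel) simp
      have comp: "(\<lambda>x. x i) \<in> measurable (?P m) (q m)" for i
        by (intro measurable_component_singleton) simp
      have h_P: "(\<lambda>x. ennreal (h x)) \<in> borel_measurable (?P m)"
        using h_meas by (subst measurable_cong_sets[OF sets_P refl]) measurable
      have restr: "(\<lambda>x. \<lambda>l\<in>{..<k}. x (j l)) \<in> measurable (?P m) (PiM {..<k} (\<lambda>_. q m))" for j
        by (intro measurable_restrict comp)
      have \<Lambda>_P: "(\<lambda>x. ennreal (\<Lambda> s j (\<lambda>l\<in>{..<k}. x (j l)))) \<in> borel_measurable (?P m)" for j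
        by (rule measurable_compose[OF restr \<Lambda>_meas]) simp
      have ind: "(\<lambda>x. indicator (G s) (x i) :: ennreal) \<in> borel_measurable (?P m)" for i
        using G(1) by (intro measurable_compose[OF comp]) (simp add: borel_measurable_indicator)
      have prod_P: "(\<lambda>x. \<Prod>l<Suc k. indicator (G s) (x (j l)) :: ennreal) \<in> borel_measurable (?P m)" for j
        by (intro borel_measurable_prod_ennreal ind)
      have X_P: "(\<lambda>x. ?X j x) \<in> borel_measurable (?P m)" for j
        by (intro borel_measurable_times_ennreal borel_measurable_const borel_measurable_sum prod_P)
      have int_X: "ennreal (a m ^ k) * (\<integral>\<^sup>+x. ?X j x \<partial>?P m) =
          ennreal (M * real (card (?O j)) * (a m ^ k * measure (q m) (G s) ^ Suc k))" if j: "j \<in> ?J" for j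
      proof -
        interpret Q: prob_space "q m" by (rule prob_q)
        have inj: "inj_on (j(k := i)) {..<Suc k}" if "i \<in> ?O j" for i
          using j that by (auto simp: inj_on_def lessThan_Suc)
        have "(\<integral>\<^sup>+x. ?X j x \<partial>?P m) = ennreal M * (\<Sum>i\<in>?O j.
            \<integral>\<^sup>+x. (\<Prod>l<Suc k. indicator (G s) (x ((j(k := i)) l))) \<partial>?P m)"
          using prod_P by (subst nn_integral_cmult) (auto simp: nn_integral_sum simp del: prod.lessThan_Suc)
        also have "(\<Sum>i\<in>?O j. \<integral>\<^sup>+x. (\<Prod>l<Suc k. indicator (G s) (x ((j(k := i)) l))) \<partial>?P m) =
            (\<Sum>i\<in>?O j. emeasure (q m) (G s) ^ Suc k)"
        proof (rule sum.cong[OF refl])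
          fix i assume "i \<in> ?O j"
          then show "(\<integral>\<^sup>+x. (\<Prod>l<Suc k. indicator (G s) (x ((j(k := i)) l))) \<partial>?P m) = emeasure (q m) (G s) ^ Suc k"
            using G(1) by (subst nn_integral_PiM_prod[OF prob_q inj])
              (auto intro!: borel_measurable_indicator)
        qed
        finally show ?thesis
          using a_nonneg M
          by (simp add: Q.emeasure_eq_measure ennreal_power ennreal_mult ennreal_of_nat_eq_real_of_nat mult_ac
              del: power_Suc)
      qed
      have "(\<Sum>j\<in>?J. \<integral>\<^sup>+u. ennreal (\<Lambda> s j u) \<partial>PiM {..<k} (\<lambda>_. q m)) =
          (\<Sum>j\<in>?J. \<integral>\<^sup>+x. ennreal (\<Lambda> s j (\<lambda>l\<in>{..<k}. x (j l))) \<partial>?P m)"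
        by (intro sum.cong refl nn_integral_PiM_reindex[symmetric] prob_q \<Lambda>_meas sets_q) auto
      also have "\<dots> = (\<integral>\<^sup>+x. (\<Sum>j\<in>?J. ennreal (\<Lambda> s j (\<lambda>l\<in>{..<k}. x (j l)))) \<partial>?P m)"
        by (intro nn_integral_sum[symmetric] \<Lambda>_P)
      also have "\<dots> \<le> (\<integral>\<^sup>+x. fact k * ennreal (h x) + (\<Sum>j\<in>?J. ?X j x) \<partial>?P m)"
        by (intro nn_integral_mono pointwise)
      also have "\<dots> = fact k * (\<integral>\<^sup>+x. ennreal (h x) \<partial>?P m) + (\<Sum>j\<in>?J. \<integral>\<^sup>+x. ?X j x \<partial>?P m)"
        using h_P X_P
        by (subst nn_integral_add) (auto simp: nn_integral_cmult nn_integral_sum intro!: borel_measurable_sum simp del: prod.lessThan_Suc)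
      finally have "ennreal (a m ^ k) * (\<Sum>j\<in>?J. \<integral>\<^sup>+u. ennreal (\<Lambda> s j u) \<partial>PiM {..<k} (\<lambda>_. q m)) \<le>
          ennreal (a m ^ k) * (fact k * (\<integral>\<^sup>+x. ennreal (h x) \<partial>?P m) + (\<Sum>j\<in>?J. \<integral>\<^sup>+x. ?X j x \<partial>?P m))"
        by (rule mult_left_mono) simp
      also have "\<dots> = ?A m + (\<Sum>j\<in>?J. ennreal (a m ^ k) * (\<integral>\<^sup>+x. ?X j x \<partial>?P m))"
        by (simp only: distrib_left sum_distrib_left mult_ac)
      also have "(\<Sum>j\<in>?J. ennreal (a m ^ k) * (\<integral>\<^sup>+x. ?X j x \<partial>?P m)) = ?e m"
        by (intro sum.cong refl int_X)
      finally show ?thesis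
        by (simp only: sum_distrib_left)
    qed
    have e_null: "?e \<longlonglongrightarrow> 0"
    proof -
      have "(\<lambda>m. M * real (card (?O j)) * (a m ^ k * measure (q m) (G s) ^ Suc k)) \<longlonglongrightarrow> M * real (card (?O j)) * 0" for j
        by (intro tendsto_mult tendsto_const error_null G(2))
      then have "?e \<longlonglongrightarrow> (\<Sum>j\<in>?J. ennreal (M * real (card (?O j)) * 0))"
        by (intro tendsto_sum tendsto_ennrealI)
      then show ?thesis
        by simp
    qed
    have "(\<Sum>j\<in>?J. \<integral>\<^sup>+u. ennreal (\<Lambda> s j u) \<partial>\<mu>_power k) \<le>
        (\<Sum>j\<in>?J. liminf (\<lambda>m. ennreal (a m ^ k) * (\<integral>\<^sup>+u. ennreal (\<Lambda> s j u) \<partial>PiM {..<k} (\<lambda>_. q m))))"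
    proof (rule sum_mono)
      fix j assume "j \<in> ?J"
      then have inj: "inj_on j {..<k}" by simp
      show "(\<integral>\<^sup>+u. ennreal (\<Lambda> s j u) \<partial>\<mu>_power k) \<le>
          liminf (\<lambda>m. ennreal (a m ^ k) * (\<integral>\<^sup>+u. ennreal (\<Lambda> s j u) \<partial>PiM {..<k} (\<lambda>_. q m)))"
        using product_lower_bound[of "{..<k}" "G s" "\<Lambda> s j" "real s" M] G \<Lambda>_lip \<Lambda>_nonneg
          \<Lambda>_le_M[OF inj] \<Lambda>_supp[OF inj] by simp
    qed
    also have "\<dots> \<le> liminf (\<lambda>m. \<Sum>j\<in>?J. ennreal (a m ^ k) * (\<integral>\<^sup>+u. ennreal (\<Lambda> s j u) \<partial>PiM {..<k} (\<lambda>_. q m)))"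
      by (rule sum_liminf_le[OF finite_injections])
    also have "\<dots> \<le> liminf (\<lambda>m. ?A m + ?e m)"
      using bound by (intro Liminf_mono always_eventually) simp
    also have "\<dots> \<le> liminf ?A"
      by (rule liminf_add_null_le[OF e_null])
    finally show ?thesis .
  qed
  have "(\<Sum>j\<in>?J. \<integral>\<^sup>+u. ennreal (hl j u) \<partial>\<mu>_power k) \<le>
      (\<Sum>j\<in>?J. \<integral>\<^sup>+u. liminf (\<lambda>s. ennreal (\<Lambda> s j u)) \<partial>\<mu>_power k)"
  proof (intro sum_mono nn_integral_mono_AE)
    fix j assume "j \<in> ?J"
    then show "AE u in \<mu>_power k. ennreal (hl j u) \<le> liminf (\<lambda>s. ennreal (\<Lambda> s j u))"
      using AE_product_\<mu>[of k] by (auto elim!: eventually_mono intro!: \<Lambda>_lim)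
  qed
  also have "\<dots> \<le> (\<Sum>j\<in>?J. liminf (\<lambda>s. \<integral>\<^sup>+u. ennreal (\<Lambda> s j u) \<partial>\<mu>_power k))"
    by (intro sum_mono nn_integral_liminf \<Lambda>_meas sets_\<mu>)
  also have "\<dots> \<le> liminf (\<lambda>s. \<Sum>j\<in>?J. \<integral>\<^sup>+u. ennreal (\<Lambda> s j u) \<partial>\<mu>_power k)"
    by (rule sum_liminf_le[OF finite_injections])
  also have "\<dots> \<le> limsup (\<lambda>s. \<Sum>j\<in>?J. \<integral>\<^sup>+u. ennreal (\<Lambda> s j u) \<partial>\<mu>_power k)"
    by (rule Liminf_le_Limsup) simp
  also have "\<dots> \<le> liminf ?A"
    using fixed_s by (intro Limsup_bounded always_eventually) simp
  finally show ?thesis .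
qed

lemma borel_measurable_PiM_UNIV:
  fixes h :: "(nat \<Rightarrow> 'x) \<Rightarrow> real"
  assumes "h \<in> borel_measurable borel"
  shows "(\<lambda>x. ennreal (h x)) \<in> borel_measurable (marks_law m)"
  using assms by (subst measurable_cong_sets[OF sets_PiM_UNIV_eq_borel[OF sets_q] refl]) measurable

text \<open>
  If at least \<open>k\<close> marks lie in \<open>B\<close>, some injective tuple of indices selects \<open>k\<close> of them. The union bound
  over at most \<open>N ^ k\<close> tuples provides the dominating function for the integration over the ground
  process.
\<close>

lemma marked_bound:
  fixes h :: "(nat \<Rightarrow> 'x) \<Rightarrow> real"
  assumes h_le: "\<And>x. h x \<le> M" and M: "0 \<le> M"
    and B: "B \<in> sets borel" and K: "a m * measure (q m) B \<le> K"
    and supp: "\<And>x. h x \<noteq> 0 \<Longrightarrow> k \<le> card {i. i < N \<and> x i \<in> B}"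
  shows "ennreal (a m ^ k) * (\<integral>\<^sup>+x. ennreal (h x) \<partial>marks_law m) \<le> ennreal (M * K ^ k * real N ^ k)"
proof -
  let ?P = "marks_law m"
  interpret Q: prob_space "q m" by (rule prob_q)
  have comp: "(\<lambda>x. x i) \<in> measurable ?P (q m)" for i
    by (intro measurable_component_singleton) simp
  have ind: "(\<lambda>x. indicator B (x i) :: ennreal) \<in> borel_measurable ?P" for i
    using B by (intro measurable_compose[OF comp]) (simp add: borel_measurable_indicator)
  have prod: "(\<lambda>x. \<Prod>l<k. indicator B (x (j l)) :: ennreal) \<in> borel_measurable ?P" for j
    by (intro borel_measurable_prod_ennreal ind)
  have pointwise: "ennreal (h x) \<le> ennreal M * (\<Sum>j\<in>injections k N. \<Prod>l<k. indicator B (x (j l)))" for x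
  proof (cases "h x = 0")
    case False
    obtain j where j: "j \<in> injections k N" "j ` {..<k} \<subseteq> {i. i < N \<and> x i \<in> B}"
      using exists_injection_into[OF supp[OF False], of N] by auto
    have "(1 :: ennreal) = (\<Prod>l<k. indicator B (x (j l)))"
      using j(2) by (intro prod.neutral[symmetric]) (auto simp: image_subset_iff)
    also have "\<dots> \<le> (\<Sum>j\<in>injections k N. \<Prod>l<k. indicator B (x (j l)))"
      using j(1) finite_injections by (intro member_le_sum) auto
    finally have "ennreal M * 1 \<le> ennreal M * (\<Sum>j\<in>injections k N. \<Prod>l<k. indicator B (x (j l)))"
      by (rule mult_left_mono) simp
    moreover have "ennreal (h x) \<le> ennreal M"
      by (intro ennreal_leI h_le)
    ultimately show ?thesis
      unfolding mult_1_right by (rule order_trans[rotated])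
  qed simp
  have "(\<integral>\<^sup>+x. ennreal (h x) \<partial>?P) \<le>
      (\<integral>\<^sup>+x. ennreal M * (\<Sum>j\<in>injections k N. \<Prod>l<k. indicator B (x (j l))) \<partial>?P)"
    by (intro nn_integral_mono pointwise)
  also have "\<dots> = ennreal M * (\<Sum>j\<in>injections k N. \<integral>\<^sup>+x. (\<Prod>l<k. indicator B (x (j l))) \<partial>?P)"
    using prod by (subst nn_integral_cmult) (auto simp: nn_integral_sum)
  also have "(\<Sum>j\<in>injections k N. \<integral>\<^sup>+x. (\<Prod>l<k. indicator B (x (j l))) \<partial>?P) =
      (\<Sum>j\<in>injections k N. emeasure (q m) B ^ k)"
    using B by (intro sum.cong refl, subst nn_integral_PiM_prod[OF prob_q])
      (auto intro!: borel_measurable_indicator)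
  also have "\<dots> = ennreal (real (card (injections k N)) * measure (q m) B ^ k)"
    by (simp add: Q.emeasure_eq_measure ennreal_power ennreal_mult ennreal_of_nat_eq_real_of_nat)
  finally have "ennreal (a m ^ k) * (\<integral>\<^sup>+x. ennreal (h x) \<partial>?P) \<le>
      ennreal (a m ^ k) * (ennreal M * ennreal (real (card (injections k N)) * measure (q m) B ^ k))"
    by (rule mult_left_mono) simp
  also have "\<dots> = ennreal (M * (a m * measure (q m) B) ^ k * real (card (injections k N)))"
    using a_nonneg M by (simp add: ennreal_mult[symmetric] power_mult_distrib mult_ac)
  also have "\<dots> \<le> ennreal (M * K ^ k * real N ^ k)"
  proof (intro ennreal_leI mult_mono mult_left_mono power_mono)
    show "real (card (injections k N)) \<le> real N ^ k"
      using card_injections_le[of k N] of_nat_le_iff[where 'a=real] by (metis of_nat_power)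
    have "0 \<le> K"
      using K a_nonneg[of m] by (meson measure_nonneg mult_nonneg_nonneg order_trans)
    then show "0 \<le> M * K ^ k"
      using M by simp
  qed (use K M a_nonneg in auto)
  finally show ?thesis .
qed

text \<open>
  The function \<open>\<Psi>\<close> counts the \<open>k\<close>-element sets of indices, weighted with a cutoff function of the
  marks, so that \<open>M * \<Psi>\<close> dominates \<open>h\<close>; its scaled integrals converge since the marks of a tuple are
  independent. Both \<open>h\<close> and \<open>M * \<Psi> - h\<close> satisfy the hypotheses of \<open>marked_lower_bound\<close>, and their two
  lower bounds add up to the limit for \<open>M * \<Psi>\<close>. Hence each lower bound is the limit.
\<close>

lemma marked_limit:
  fixes h :: "(nat \<Rightarrow> 'x) \<Rightarrow> real"
  assumes h_meas: "h \<in> borel_measurable borel"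
    and h_nonneg: "\<And>x. 0 \<le> h x" and h_le: "\<And>x. h x \<le> M"
    and hl_meas: "\<And>j. hl j \<in> borel_measurable borel"
    and hl_nonneg: "\<And>j u. 0 \<le> hl j u" and hl_le: "\<And>j u. hl j u \<le> M"
    and B: "B \<in> S"
    and supp: "\<And>x. h x \<noteq> 0 \<Longrightarrow> k \<le> card {i. i < N \<and> x i \<in> B}"
    and hl_supp: "\<And>j u l. hl j u \<noteq> 0 \<Longrightarrow> l < k \<Longrightarrow> u l \<in> B"
    and lim: "\<And>j xs u. j \<in> injections k N \<Longrightarrow> (\<And>l. l < k \<Longrightarrow> (\<lambda>s. xs s (j l)) \<longlonglongrightarrow> u l) \<Longrightarrow>
        (\<And>l. l < k \<Longrightarrow> u l \<in> \<Union>S) \<Longrightarrow>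
        (\<And>i B. i < N \<Longrightarrow> i \<notin> j ` {..<k} \<Longrightarrow> B \<in> S \<Longrightarrow> \<forall>\<^sub>F s in sequentially. xs s i \<notin> B) \<Longrightarrow>
        (\<lambda>s. h (xs s)) \<longlonglongrightarrow> hl j u"
  shows "(\<lambda>m. fact k * (ennreal (a m ^ k) * (\<integral>\<^sup>+x. ennreal (h x) \<partial>marks_law m))) \<longlonglongrightarrow>
    (\<Sum>j\<in>injections k N. \<integral>\<^sup>+u. ennreal (hl j u) \<partial>\<mu>_power k)"
proof -
  let ?J = "injections k N"
  let ?P = "\<lambda>m. marks_law m"
  obtain \<psi> G where \<psi>: "continuous_on UNIV \<psi>" "\<And>x. 0 \<le> \<psi> x" "\<And>x. \<psi> x \<le> (1::real)"
      "\<And>x. x \<in> B \<Longrightarrow> \<psi> x = 1" "open G" "G \<in> S" "\<And>x. x \<notin> G \<Longrightarrow> \<psi> x = 0"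
    using cutoff[OF B] by metis
  have M: "0 \<le> M"
    using h_nonneg h_le by (meson order_trans)
  have \<psi>_borel: "\<psi> \<in> borel_measurable borel"
    by (rule borel_measurable_continuous_onI[OF \<psi>(1)])
  have \<psi>_abs: "\<bar>\<psi> x\<bar> \<le> 1" for x
    using \<psi>(2,3)[of x] by simp
  have \<psi>_test: "\<psi> \<in> test_functions euclidean S"
    by (rule test_functions_euclideanI[OF \<psi>(1) \<psi>_abs \<psi>(6,7)])
  define F where "F x = (\<Prod>l<k. \<psi> (x l))" for x :: "nat \<Rightarrow> 'x"
  define \<Psi> where "\<Psi> x = (\<Sum>j\<in>?J. \<Prod>l<k. \<psi> (x (j l))) / fact k" for x :: "nat \<Rightarrow> 'x"
  have tuple_nonneg: "0 \<le> (\<Prod>l<k. \<psi> (x (j l)))" for x :: "nat \<Rightarrow> 'x" and j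
    using \<psi>(2) by (intro prod_nonneg) auto
  have prod_le: "(\<Prod>l<k. \<psi> (x (j l))) \<le> 1" for x :: "nat \<Rightarrow> 'x" and j
    using \<psi>(2,3) by (intro prod_le_1) auto
  have F_bounds: "0 \<le> F u" "F u \<le> 1" for u
    unfolding F_def using \<psi>(2,3) by (auto intro!: prod_nonneg prod_le_1)
  have \<Psi>_nonneg: "0 \<le> \<Psi> x" for x
    unfolding \<Psi>_def using tuple_nonneg by (intro divide_nonneg_nonneg sum_nonneg) auto
  have \<Psi>_le: "\<Psi> x \<le> real (card ?J)" for x
  proof -
    have "(\<Sum>j\<in>?J. \<Prod>l<k. \<psi> (x (j l))) \<le> (\<Sum>j\<in>?J. 1)"
      by (intro sum_mono prod_le)
    moreover have "(\<Sum>j\<in>?J. \<Prod>l<k. \<psi> (x (j l))) / fact k \<le> (\<Sum>j\<in>?J. \<Prod>l<k. \<psi> (x (j l)))"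
      using mult_right_mono[OF fact_ge_1[where 'a=real and n=k], of "\<Sum>j\<in>?J. \<Prod>l<k. \<psi> (x (j l))"] tuple_nonneg
      by (simp add: field_simps sum_nonneg)
    ultimately show ?thesis
      unfolding \<Psi>_def by simp
  qed
  have h_\<Psi>: "h x \<le> M * \<Psi> x" for x
  proof (cases "h x = 0")
    case True
    then show ?thesis
      using M \<Psi>_nonneg[of x] by simp
  next
    case False
    obtain R where R: "R \<subseteq> {i. i < N \<and> x i \<in> B}" "card R = k"
      using obtain_subset_with_card_n[OF supp[OF False]] by blast
    let ?JR = "{j \<in> ?J. j ` {..<k} = R}"
    have "card ?JR = fact k"
      using R by (subst card_injections_onto) auto
    then have "fact k = (\<Sum>j\<in>?JR. 1 :: real)"
      by simp
    also have "\<dots> = (\<Sum>j\<in>?JR. \<Prod>l<k. \<psi> (x (j l)))"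
    proof (intro sum.cong refl prod.neutral[symmetric] ballI)
      fix j l assume "j \<in> ?JR" "l \<in> {..<k}"
      then have "x (j l) \<in> B"
        using R(1) by auto
      then show "\<psi> (x (j l)) = 1"
        by (rule \<psi>(4))
    qed
    also have "\<dots> \<le> (\<Sum>j\<in>?J. \<Prod>l<k. \<psi> (x (j l)))"
      using finite_injections tuple_nonneg by (intro sum_mono2) auto
    finally have "1 \<le> \<Psi> x"
      unfolding \<Psi>_def by (simp add: field_simps)
    then have "M * 1 \<le> M * \<Psi> x"
      using M by (intro mult_left_mono)
    then show ?thesis
      using h_le[of x] by simp
  qed
  have hl_F: "hl j u \<le> M * F u" for j u
  proof (cases "hl j u = 0")
    case True
    then show ?thesis
      using M F_bounds(1)[of u] by simp
  next
    case False
    then have "F u = 1"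
      unfolding F_def using hl_supp[OF False] \<psi>(4) by (intro prod.neutral) auto
    then show ?thesis
      using hl_le[of j u] by simp
  qed
  have \<psi>_comp: "(\<lambda>x. \<psi> (x i)) \<in> borel_measurable (borel :: (nat \<Rightarrow> 'x) measure)" for i
    by (intro measurable_compose[OF _ \<psi>_borel] borel_measurable_continuous_onI continuous_on_product_coordinates)
  have \<Psi>_meas: "\<Psi> \<in> borel_measurable borel"
    unfolding \<Psi>_def by (intro borel_measurable_divide borel_measurable_sum borel_measurable_prod \<psi>_comp borel_measurable_const)
  have F_meas: "F \<in> borel_measurable borel"
    unfolding F_def by (intro borel_measurable_prod \<psi>_comp)
  \<comment> \<open>In the limit only the tuples with the same range as \<open>j\<close> contribute; there are \<open>fact k\<close> of them.\<close>
  have \<Psi>_lim: "(\<lambda>s. \<Psi> (xs s)) \<longlonglongrightarrow> F u"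
    if j: "j \<in> ?J" and near: "\<And>l. l < k \<Longrightarrow> (\<lambda>s. xs s (j l)) \<longlonglongrightarrow> u l"
      and far: "\<And>i B. i < N \<Longrightarrow> i \<notin> j ` {..<k} \<Longrightarrow> B \<in> S \<Longrightarrow> \<forall>\<^sub>F s in sequentially. xs s i \<notin> B"
    for j xs u
  proof -
    have inj: "inj_on j {..<k}" and range: "j ` {..<k} \<subseteq> {..<N}"
      using j injections_range[OF j] by auto
    define w where "w i = (if i \<in> j ` {..<k} then \<psi> (u (the_inv_into {..<k} j i)) else 0)" for i
    have w_j: "w (j l) = \<psi> (u l)" if "l < k" for l
      unfolding w_def using that inj by (simp add: the_inv_into_f_f)
    have \<psi>_lim: "(\<lambda>s. \<psi> (xs s i)) \<longlonglongrightarrow> w i" if i: "i < N" for i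
    proof (cases "i \<in> j ` {..<k}")
      case True
      then obtain l where l: "l < k" "i = j l"
        by auto
      have "isCont \<psi> (u l)"
        using \<psi>(1) continuous_on_eq_continuous_at[OF open_UNIV] by blast
      then show ?thesis
        unfolding l(2) w_j[OF l(1)] by (rule isCont_tendsto_compose[OF _ near[OF l(1)]])
    next
      case False
      have "\<forall>\<^sub>F s in sequentially. \<psi> (xs s i) = 0"
        using far[OF i False \<psi>(6)] by eventually_elim (rule \<psi>(7))
      then show ?thesis
        unfolding w_def using False by (simp add: tendsto_eventually)
    qed
    have "(\<lambda>s. \<Sum>j'\<in>?J. \<Prod>l<k. \<psi> (xs s (j' l))) \<longlonglongrightarrow> (\<Sum>j'\<in>?J. \<Prod>l<k. w (j' l))"
      by (intro tendsto_sum tendsto_prod \<psi>_lim) (use injections_range in blast)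
    moreover have "(\<Sum>j'\<in>?J. \<Prod>l<k. w (j' l)) = fact k * F u"
    proof -
      let ?JR = "{j' \<in> ?J. j' ` {..<k} = j ` {..<k}}"
      have "(\<Sum>j'\<in>?J. \<Prod>l<k. w (j' l)) = (\<Sum>j'\<in>?JR. \<Prod>l<k. w (j' l))"
      proof (rule sum.mono_neutral_right[OF finite_injections])
        show "\<forall>j'\<in>?J - ?JR. (\<Prod>l<k. w (j' l)) = 0"
        proof
          fix j' assume j': "j' \<in> ?J - ?JR"
          have "\<not> j' ` {..<k} \<subseteq> j ` {..<k}"
          proof
            assume "j' ` {..<k} \<subseteq> j ` {..<k}"
            moreover have "card (j' ` {..<k}) = card (j ` {..<k})"
              using j' inj by (simp add: card_image)
            ultimately have "j' ` {..<k} = j ` {..<k}"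
              by (intro card_subset_eq) auto
            then show False
              using j' by blast
          qed
          then obtain l where "l < k" "j' l \<notin> j ` {..<k}"
            by auto
          then show "(\<Prod>l<k. w (j' l)) = 0"
            by (intro prod_zero) (auto simp: w_def intro!: bexI[of _ l])
        qed
      qed auto
      also have "\<dots> = (\<Sum>j'\<in>?JR. F u)"
      proof (rule sum.cong[OF refl])
        fix j' assume j': "j' \<in> ?JR"
        have "(\<Prod>l<k. w (j' l)) = (\<Prod>i\<in>j' ` {..<k}. w i)"
        proof -
          have "inj_on j' {..<k}"
            using j' by simp
          then show ?thesis
            by (simp only: prod.reindex o_def)
        qed
        also have "\<dots> = (\<Prod>i\<in>j ` {..<k}. w i)"
          using j' by simp
        also have "\<dots> = (\<Prod>l<k. w (j l))"
          using inj by (simp add: prod.reindex)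
        also have "\<dots> = F u"
          unfolding F_def using w_j by simp
        finally show "(\<Prod>l<k. w (j' l)) = F u" .
      qed
      also have "\<dots> = fact k * F u"
        using card_injections_onto[OF range, of k] inj by (simp add: card_image)
      finally show ?thesis .
    qed
    ultimately have "(\<lambda>s. (\<Sum>j'\<in>?J. \<Prod>l<k. \<psi> (xs s (j' l))) / fact k) \<longlonglongrightarrow> fact k * F u / fact k"
      by (intro tendsto_divide tendsto_const) auto
    then show ?thesis
      unfolding \<Psi>_def by simp
  qed
  let ?X = "\<lambda>m. fact k * (ennreal (a m ^ k) * (\<integral>\<^sup>+x. ennreal (h x) \<partial>?P m))"
  let ?Y = "\<lambda>m. fact k * (ennreal (a m ^ k) * (\<integral>\<^sup>+x. ennreal (M * \<Psi> x - h x) \<partial>?P m))"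
  let ?b = "\<Sum>j\<in>?J. \<integral>\<^sup>+u. ennreal (hl j u) \<partial>\<mu>_power k"
  let ?c = "\<Sum>j\<in>?J. \<integral>\<^sup>+u. ennreal (M * F u - hl j u) \<partial>\<mu>_power k"
  have diff_meas: "(\<lambda>x. M * \<Psi> x - h x) \<in> borel_measurable borel"
    using \<Psi>_meas h_meas by measurable
  have lower_X: "?b \<le> liminf ?X"
    by (rule marked_lower_bound[OF h_meas h_nonneg h_le hl_le lim])
  have lower_Y: "?c \<le> liminf ?Y"
  proof (rule marked_lower_bound[where M = "M * real (card ?J) + M"])
    show "(\<lambda>x. M * \<Psi> x - h x) \<in> borel_measurable borel"
      by (rule diff_meas)
    show "0 \<le> M * \<Psi> x - h x" for x
      using h_\<Psi>[of x] by simp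
    show "M * \<Psi> x - h x \<le> M * real (card ?J) + M" for x
      using mult_left_mono[OF \<Psi>_le[of x] M] h_nonneg[of x] M by linarith
    show "M * F u - hl j u \<le> M * real (card ?J) + M" for j u
    proof -
      have "M * F u \<le> M * 1" "0 \<le> M * real (card ?J)"
        using M F_bounds(2)[of u] by (intro mult_left_mono mult_nonneg_nonneg; simp)+
      then show ?thesis
        using hl_nonneg[of j u] by linarith
    qed
    fix j xs u
    assume A: "j \<in> ?J" "\<And>l. l < k \<Longrightarrow> (\<lambda>s. xs s (j l)) \<longlonglongrightarrow> u l" "\<And>l. l < k \<Longrightarrow> u l \<in> \<Union>S"
      "\<And>i B. i < N \<Longrightarrow> i \<notin> j ` {..<k} \<Longrightarrow> B \<in> S \<Longrightarrow> \<forall>\<^sub>F s in sequentially. xs s i \<notin> B"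
    show "(\<lambda>s. M * \<Psi> (xs s) - h (xs s)) \<longlonglongrightarrow> M * F u - hl j u"
      by (intro tendsto_intros \<Psi>_lim[where j=j] lim[where j=j] A)
  qed
  have PiM_\<mu>_meas: "(\<lambda>u. ennreal (f u)) \<in> borel_measurable (\<mu>_power k)"
    if "f \<in> borel_measurable borel" for f :: "(nat \<Rightarrow> 'x) \<Rightarrow> real"
    using measurable_compose[OF measurable_PiM_nat_borel that, of "{..<k}" "\<lambda>_. \<mu>"] by simp
  have \<psi>_\<mu>: "integrable \<mu> \<psi>"
    by (rule test_function_integrable[OF \<psi>_borel \<psi>_abs \<psi>(5,6,7)])
  have bc: "?b + ?c = ennreal (M * real (card ?J) * (\<integral>x. \<psi> x \<partial>\<mu>) ^ k)"
  proof -
    interpret product_sigma_finite "\<lambda>_. \<mu>" by (rule product_sigma_finite_\<mu>)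
    have "(\<integral>\<^sup>+u. ennreal (hl j u) \<partial>\<mu>_power k) + (\<integral>\<^sup>+u. ennreal (M * F u - hl j u) \<partial>\<mu>_power k) =
        ennreal (M * (\<integral>x. \<psi> x \<partial>\<mu>) ^ k)" for j
    proof -
      have "(\<integral>\<^sup>+u. ennreal (hl j u) \<partial>\<mu>_power k) + (\<integral>\<^sup>+u. ennreal (M * F u - hl j u) \<partial>\<mu>_power k) =
          (\<integral>\<^sup>+u. ennreal (hl j u) + ennreal (M * F u - hl j u) \<partial>\<mu>_power k)"
        using hl_meas[of j] F_meas by (intro nn_integral_add[symmetric] PiM_\<mu>_meas) auto
      also have "\<dots> = (\<integral>\<^sup>+u. ennreal M * (\<Prod>l<k. ennreal (\<psi> (u l))) \<partial>\<mu>_power k)"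
      proof (rule nn_integral_cong)
        fix u
        have "ennreal (hl j u) + ennreal (M * F u - hl j u) = ennreal (M * F u)"
          using hl_F[of j u] hl_nonneg[of j u] by (subst ennreal_plus[symmetric]) auto
        then show "ennreal (hl j u) + ennreal (M * F u - hl j u) = ennreal M * (\<Prod>l<k. ennreal (\<psi> (u l)))"
          unfolding F_def using M \<psi>(2) by (simp add: ennreal_mult prod_ennreal prod_nonneg)
      qed
      also have "\<dots> = ennreal M * (\<integral>\<^sup>+u. (\<Prod>l<k. ennreal (\<psi> (u l))) \<partial>\<mu>_power k)"
      proof (rule nn_integral_cmult)
        have "(\<lambda>u. ennreal (\<psi> (u l))) \<in> borel_measurable (\<mu>_power k)" if "l \<in> {..<k}" for l
          using \<psi>_borel by (intro measurable_compose[OF measurable_component_singleton[OF that]]) simp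
        then show "(\<lambda>u. \<Prod>l<k. ennreal (\<psi> (u l))) \<in> borel_measurable (\<mu>_power k)"
          by (rule borel_measurable_prod_ennreal)
      qed
      also have "(\<integral>\<^sup>+u. (\<Prod>l<k. ennreal (\<psi> (u l))) \<partial>\<mu>_power k) = (\<integral>\<^sup>+x. ennreal (\<psi> x) \<partial>\<mu>) ^ k"
        using \<psi>_borel by (subst product_nn_integral_prod) auto
      also have "(\<integral>\<^sup>+x. ennreal (\<psi> x) \<partial>\<mu>) = ennreal (\<integral>x. \<psi> x \<partial>\<mu>)"
        using \<psi>_\<mu> \<psi>(2) by (intro nn_integral_eq_integral) auto
      finally show ?thesis
        using M \<psi>(2) by (simp add: ennreal_mult ennreal_power integral_nonneg)
    qed
    then have "?b + ?c = (\<Sum>j\<in>?J. ennreal (M * (\<integral>x. \<psi> x \<partial>\<mu>) ^ k))"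
      by (simp add: sum.distrib[symmetric])
    then show ?thesis
      using M \<psi>(2) by (simp add: ennreal_of_nat_eq_real_of_nat ennreal_mult[symmetric] integral_nonneg mult_ac)
  qed
  have XY: "?X m + ?Y m = ennreal (M * real (card ?J) * (a m * (\<integral>x. \<psi> x \<partial>q m)) ^ k)" for m
  proof -
    interpret Q: prob_space "q m" by (rule prob_q)
    have \<psi>_q: "\<psi> \<in> borel_measurable (q m)"
      using \<psi>_borel by (simp cong: measurable_cong_sets)
    have int_q: "integrable (q m) \<psi>"
      using \<psi>_q \<psi>_abs by (intro Q.integrable_const_bound[of _ 1]) auto
    have comp: "(\<lambda>x. x i) \<in> measurable (?P m) (q m)" for i
      by (intro measurable_component_singleton) simp
    have \<psi>_P: "(\<lambda>x. ennreal (\<psi> (x i))) \<in> borel_measurable (?P m)" for i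
      using \<psi>_q by (intro measurable_compose[OF comp]) simp
    have prod_P: "(\<lambda>x. \<Prod>l<k. ennreal (\<psi> (x (j l)))) \<in> borel_measurable (?P m)" for j
      by (intro borel_measurable_prod_ennreal \<psi>_P)
    have eq: "fact k * (ennreal (h x) + ennreal (M * \<Psi> x - h x)) =
        ennreal M * (\<Sum>j\<in>?J. \<Prod>l<k. ennreal (\<psi> (x (j l))))" for x
    proof -
      have "ennreal (h x) + ennreal (M * \<Psi> x - h x) = ennreal (M * \<Psi> x)"
        using h_\<Psi>[of x] h_nonneg[of x] by (subst ennreal_plus[symmetric]) auto
      moreover have "(fact k :: ennreal) = ennreal (fact k)"
        by (metis ennreal_of_nat_eq_real_of_nat of_nat_fact)
      moreover have sum_eq: "fact k * (M * \<Psi> x) = M * (\<Sum>j\<in>?J. \<Prod>l<k. \<psi> (x (j l)))"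
        unfolding \<Psi>_def by simp
      moreover have "ennreal (fact k) * ennreal (M * \<Psi> x) = ennreal (fact k * (M * \<Psi> x))"
        using M \<Psi>_nonneg[of x] by (intro ennreal_mult[symmetric]) auto
      ultimately have "fact k * (ennreal (h x) + ennreal (M * \<Psi> x - h x)) =
          ennreal (M * (\<Sum>j\<in>?J. \<Prod>l<k. \<psi> (x (j l))))"
        by (simp only:)
      then show ?thesis
        using M \<psi>(2) tuple_nonneg by (simp add: ennreal_mult prod_ennreal sum_ennreal sum_nonneg)
    qed
    have "?X m + ?Y m = ennreal (a m ^ k) * (fact k * ((\<integral>\<^sup>+x. ennreal (h x) \<partial>?P m) +
        (\<integral>\<^sup>+x. ennreal (M * \<Psi> x - h x) \<partial>?P m)))"
      by (simp only: distrib_left mult_ac)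
    also have "(\<integral>\<^sup>+x. ennreal (h x) \<partial>?P m) + (\<integral>\<^sup>+x. ennreal (M * \<Psi> x - h x) \<partial>?P m) =
        (\<integral>\<^sup>+x. ennreal (h x) + ennreal (M * \<Psi> x - h x) \<partial>?P m)"
      by (intro nn_integral_add[symmetric] borel_measurable_PiM_UNIV h_meas diff_meas)
    also have "fact k * \<dots> = (\<integral>\<^sup>+x. fact k * (ennreal (h x) + ennreal (M * \<Psi> x - h x)) \<partial>?P m)"
      by (intro nn_integral_cmult[symmetric] borel_measurable_add borel_measurable_PiM_UNIV h_meas diff_meas)
    also have "\<dots> = ennreal M * (\<Sum>j\<in>?J. \<integral>\<^sup>+x. (\<Prod>l<k. ennreal (\<psi> (x (j l)))) \<partial>?P m)"
      unfolding eq using prod_P by (subst nn_integral_cmult) (auto simp: nn_integral_sum)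
    also have "(\<Sum>j\<in>?J. \<integral>\<^sup>+x. (\<Prod>l<k. ennreal (\<psi> (x (j l)))) \<partial>?P m) =
        (\<Sum>j\<in>?J. (\<integral>\<^sup>+x. ennreal (\<psi> x) \<partial>q m) ^ k)"
      using \<psi>_q by (intro sum.cong refl nn_integral_PiM_prod[OF prob_q]) auto
    also have "(\<integral>\<^sup>+x. ennreal (\<psi> x) \<partial>q m) = ennreal (\<integral>x. \<psi> x \<partial>q m)"
      using int_q \<psi>(2) by (intro nn_integral_eq_integral) auto
    finally show ?thesis
      using M \<psi>(2) a_nonneg
      by (simp add: ennreal_of_nat_eq_real_of_nat ennreal_power ennreal_mult[symmetric] integral_nonneg
          power_mult_distrib mult_ac)
  qed
  have "(\<lambda>m. ?X m + ?Y m) \<longlonglongrightarrow> ?b + ?c"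
    unfolding XY bc using vague[OF \<psi>_test] by (intro tendsto_intros)
  then show ?thesis
    by (rule tendsto_of_complementary_bounds[OF _ _ lower_X lower_Y]) (simp add: bc)
qed

end

section \<open>The space of configurations\<close>

context based_ideal
begin

abbreviation marks :: "('y::polish_space \<times> 'x) set" where
  "marks \<equiv> \<Union>(mark_ideal S)"

abbreviation configurations :: "('y::polish_space \<times> 'x) measure set" where
  "configurations \<equiv> counting_measures euclidean (mark_ideal S)"

abbreviation config_space :: "('y::polish_space \<times> 'x) measure topology" where
  "config_space \<equiv> counting_topology euclidean (mark_ideal S)"

abbreviation config_ideal :: "nat \<Rightarrow> ('y::polish_space \<times> 'x) measure set set" where
  "config_ideal k \<equiv> counting_ideal k euclidean (mark_ideal S)"

lemma empty_mem_mark_ideal: "{} \<in> mark_ideal S"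
  using empty_mem mark_ideal_iff[OF ideal] by blast

lemma topspace_config_space: "topspace config_space = configurations"
  by (rule topspace_counting[OF empty_mem_mark_ideal])

lemma cylinder_borel:
  "B \<in> sets borel \<Longrightarrow> (UNIV \<times> B :: ('y::polish_space \<times> 'x) set) \<in> sets borel"
  unfolding borel_prod[symmetric] by (intro pair_measureI) auto

lemma configurationsD:
  assumes "m \<in> configurations"
  shows "sets m = sets borel" "space m = UNIV"
    "\<And>B. B \<in> sets borel \<Longrightarrow> B \<in> S \<Longrightarrow> \<exists>n. emeasure m (UNIV \<times> B) = of_nat n"
    "\<And>A. A \<in> sets borel \<Longrightarrow> A \<inter> marks = {} \<Longrightarrow> emeasure m A = 0"
proof -
  have m: "m \<in> ideal_measures euclidean (mark_ideal S)"
    "\<And>A. A \<in> sets m \<Longrightarrow> emeasure m A \<in> range ennreal_of_enat"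
    using assms by (auto simp: counting_measures_def)
  show sets: "sets m = sets borel"
    using m(1) by (simp add: ideal_measures_def borel_of_euclidean)
  then show "space m = UNIV"
    using sets_eq_imp_space_eq by fastforce
  show "emeasure m A = 0" if "A \<in> sets borel" "A \<inter> marks = {}" for A
    using m(1) that sets by (simp add: ideal_measures_def)
  show "\<exists>n. emeasure m (UNIV \<times> B) = of_nat n" if B: "B \<in> sets borel" "B \<in> S" for B
  proof -
    have meas: "UNIV \<times> B \<in> sets m"
      unfolding sets by (rule cylinder_borel[OF B(1)])
    have "UNIV \<times> B \<in> mark_ideal S"
      using mark_ideal_iff[OF ideal, of "UNIV \<times> B"] B(2) by blast
    then have fin: "emeasure m (UNIV \<times> B) < \<infinity>"
      using m(1) meas unfolding ideal_measures_def by blast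
    obtain n where n: "emeasure m (UNIV \<times> B) = ennreal_of_enat n"
      using m(2)[OF meas] by blast
    then show ?thesis
      using fin by (cases n) auto
  qed
qed

text \<open>
  The Borel set that witnesses membership lies in a cylinder over a member of \<open>S\<close>, which may be
  enlarged to the cylinder over its closure.
\<close>

lemma config_ideal_iff:
  fixes D :: "('y::polish_space \<times> 'x) measure set"
  shows "D \<in> config_ideal k \<longleftrightarrow> D \<subseteq> configurations \<and>
    (\<exists>B\<in>S. closed B \<and> (\<forall>m\<in>D. of_nat k \<le> emeasure m (UNIV \<times> B)))"
proof
  assume D: "D \<in> config_ideal k"
  then obtain A where A: "D \<subseteq> configurations" "A \<in> sets borel" "A \<in> mark_ideal S"
      "\<forall>m\<in>D. of_nat k \<le> emeasure m A"
    by (auto simp: counting_ideal_def borel_of_euclidean)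
  obtain B where B: "B \<in> S" "A \<subseteq> UNIV \<times> B"
    using A(3) mark_ideal_iff[OF ideal] by blast
  have "of_nat k \<le> emeasure m (UNIV \<times> closure B)" if "m \<in> D" for m
  proof -
    have m: "m \<in> configurations"
      using that A(1) by blast
    have "emeasure m A \<le> emeasure m (UNIV \<times> closure B)"
    proof (rule emeasure_mono)
      show "A \<subseteq> UNIV \<times> closure B"
        using B(2) closure_subset by blast
      show "UNIV \<times> closure B \<in> sets m"
        unfolding configurationsD(1)[OF m] by (intro cylinder_borel) simp
    qed
    then show ?thesis
      using A(4) that order_trans by blast
  qed
  then show "D \<subseteq> configurations \<and> (\<exists>B\<in>S. closed B \<and> (\<forall>m\<in>D. of_nat k \<le> emeasure m (UNIV \<times> B)))"
    using A(1) closure_mem[OF B(1)] by blast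
next
  assume D: "D \<subseteq> configurations \<and> (\<exists>B\<in>S. closed B \<and> (\<forall>m\<in>D. of_nat k \<le> emeasure m (UNIV \<times> B)))"
  then obtain B where B: "B \<in> S" "closed B" "\<forall>m\<in>D. of_nat k \<le> emeasure m (UNIV \<times> B)"
    by blast
  have "UNIV \<times> B \<in> mark_ideal S"
    using mark_ideal_iff[OF ideal, of "UNIV \<times> B"] B(1) by blast
  moreover have "UNIV \<times> B \<in> sets (borel :: ('y \<times> 'x) measure)"
    using B(2) by (intro cylinder_borel) simp
  ultimately show "D \<in> config_ideal k"
    using D B(3) unfolding counting_ideal_def borel_of_euclidean by blast
qed

lemma mem_Union_config_ideal_iff:
  "m \<in> \<Union>(config_ideal k) \<longleftrightarrow>
    m \<in> configurations \<and> (\<exists>B\<in>S. closed B \<and> of_nat k \<le> emeasure m (UNIV \<times> B))"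
proof
  assume "m \<in> \<Union>(config_ideal k)"
  then obtain D where "D \<in> config_ideal k" "m \<in> D"
    by blast
  then show "m \<in> configurations \<and> (\<exists>B\<in>S. closed B \<and> of_nat k \<le> emeasure m (UNIV \<times> B))"
    unfolding config_ideal_iff by blast
next
  assume "m \<in> configurations \<and> (\<exists>B\<in>S. closed B \<and> of_nat k \<le> emeasure m (UNIV \<times> B))"
  then have "{m} \<in> config_ideal k"
    unfolding config_ideal_iff by blast
  then show "m \<in> \<Union>(config_ideal k)"
    by blast
qed

lemma openin_config_space:
  fixes f :: "'y::polish_space \<times> 'x \<Rightarrow> real"
  assumes "f \<in> test_functions euclidean (mark_ideal S)" "open V"
  shows "openin config_space {m \<in> configurations. (\<integral>z. f z \<partial>m) \<in> V}"
proof -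
  let ?D = "{m \<in> ideal_measures euclidean (mark_ideal S). (\<integral>z. f z \<partial>m) \<in> V}"
  have "openin (vague_topology euclidean (mark_ideal S)) ?D"
    unfolding vague_topology_def using assms by (intro topology_generated_by_Basis) blast
  moreover have "{m \<in> configurations. (\<integral>z. f z \<partial>m) \<in> V} = ?D \<inter> configurations"
    by (auto simp: counting_measures_def)
  ultimately show ?thesis
    unfolding counting_topology_def openin_subtopology by blast
qed

text \<open>
  The points over \<open>B\<close> are counted by a cutoff function \<open>\<psi>\<close> of the mark. Since a configuration has
  integer mass, an integral of \<open>\<psi>\<close> above \<open>k - 1\<close> forces \<open>k\<close> points over the set off which \<open>\<psi>\<close>
  vanishes, and this condition on the integral is open.
\<close>

lemma open_neighbourhood_in_config_ideal:
  assumes B: "B \<in> S" "closed B"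
  obtains D where "openin (config_space :: ('y::polish_space \<times> 'x) measure topology) D" "D \<in> config_ideal k"
    "\<And>m. m \<in> configurations \<Longrightarrow> of_nat k \<le> emeasure m (UNIV \<times> B) \<Longrightarrow> m \<in> D"
proof -
  obtain \<psi> G where \<psi>: "continuous_on UNIV \<psi>" "\<And>x. 0 \<le> \<psi> x" "\<And>x. \<psi> x \<le> (1::real)"
      "\<And>x. x \<in> B \<Longrightarrow> \<psi> x = 1" "open G" "G \<in> S" "\<And>x. x \<notin> G \<Longrightarrow> \<psi> x = 0"
    using cutoff[OF B(1)] by metis
  have abs: "\<bar>\<psi> x\<bar> \<le> 1" for x
    using \<psi>(2,3)[of x] by simp
  let ?\<phi> = "\<lambda>z :: 'y \<times> 'x. \<psi> (snd z)"
  have test: "?\<phi> \<in> test_functions euclidean (mark_ideal S)"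
    by (rule snd_test_function[OF \<psi>(1) abs \<psi>(6,7)])
  have le_ind: "?\<phi> z \<le> indicator (UNIV \<times> G) z" for z
    using \<psi>(3,7)[of "snd z"] by (cases "snd z \<in> G") (simp_all add: indicator_def mem_Times_iff)
  have ind_le: "indicator (UNIV \<times> B) z \<le> ?\<phi> z" for z
    using \<psi>(2,4)[of "snd z"] by (cases "snd z \<in> B") (simp_all add: indicator_def mem_Times_iff)
  have G: "G \<in> sets borel" and B': "B \<in> sets borel"
    using \<psi>(5) B(2) by auto
  have facts: "integrable m ?\<phi>" "integrable m (indicator (UNIV \<times> G) :: _ \<Rightarrow> real)"
    "integrable m (indicator (UNIV \<times> B) :: _ \<Rightarrow> real)"
    if m: "m \<in> configurations" for m :: "('y \<times> 'x) measure"
  proof -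
    have ind: "integrable m (indicator (UNIV \<times> C) :: _ \<Rightarrow> real)" if C: "C \<in> sets borel" "C \<in> S" for C
    proof -
      obtain n where "emeasure m (UNIV \<times> C) = of_nat n"
        using configurationsD(3)[OF m C] by blast
      then show ?thesis
        using cylinder_borel[OF C(1)] configurationsD(1)[OF m]
        by (intro integrable_real_indicator) (auto simp: of_nat_less_top)
    qed
    show "integrable m (indicator (UNIV \<times> G) :: _ \<Rightarrow> real)" "integrable m (indicator (UNIV \<times> B) :: _ \<Rightarrow> real)"
      by (intro ind G B' \<psi>(6) B(1))+
    show "integrable m ?\<phi>"
    proof (rule Bochner_Integration.integrable_bound[OF ind[OF G \<psi>(6)]])
      show "?\<phi> \<in> borel_measurable m"
        using test_function_borel[OF test] configurationsD(1)[OF m] by (simp cong: measurable_cong_sets)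
      show "AE z in m. norm (?\<phi> z) \<le> norm (indicator (UNIV \<times> G) z :: real)"
      proof (rule AE_I2)
        fix z
        show "norm (?\<phi> z) \<le> norm (indicator (UNIV \<times> G) z :: real)"
          using \<psi>(2,3,7)[of "snd z"] by (cases "snd z \<in> G") (simp_all add: mem_Times_iff)
      qed
    qed
  qed
  have upper: "(\<integral>z. ?\<phi> z \<partial>m) \<le> measure m (UNIV \<times> G)" if m: "m \<in> configurations" for m
  proof -
    have "(\<integral>z. ?\<phi> z \<partial>m) \<le> (\<integral>z. indicator (UNIV \<times> G) z \<partial>m)"
      by (intro integral_mono facts m le_ind)
    then show ?thesis
      using cylinder_borel[OF G] configurationsD(1,2)[OF m] by simp
  qed
  have lower: "measure m (UNIV \<times> B) \<le> (\<integral>z. ?\<phi> z \<partial>m)" if m: "m \<in> configurations" for m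
  proof -
    have "(\<integral>z. indicator (UNIV \<times> B) z \<partial>m) \<le> (\<integral>z. ?\<phi> z \<partial>m)"
      by (intro integral_mono facts m ind_le)
    then show ?thesis
      using cylinder_borel[OF B'] configurationsD(1,2)[OF m] by simp
  qed
  let ?D = "{m \<in> configurations. (\<integral>z. ?\<phi> z \<partial>m) \<in> {real k - 1<..}}"
  show ?thesis
  proof (rule that[of ?D])
    show "openin config_space ?D"
      by (rule openin_config_space[OF test]) simp
    have "of_nat k \<le> emeasure m (UNIV \<times> closure G)" if "m \<in> ?D" for m
    proof -
      have m: "m \<in> configurations" and less: "real k - 1 < (\<integral>z. ?\<phi> z \<partial>m)"
        using that by auto
      obtain n where n: "emeasure m (UNIV \<times> G) = of_nat n"
        using configurationsD(3)[OF m G \<psi>(6)] by blast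
      then have "measure m (UNIV \<times> G) = real n"
        by (simp add: measure_def)
      then have "k \<le> n"
        using upper[OF m] less by linarith
      then have "of_nat k \<le> emeasure m (UNIV \<times> G)"
        unfolding n by simp
      also have "\<dots> \<le> emeasure m (UNIV \<times> closure G)"
      proof (rule emeasure_mono)
        show "UNIV \<times> closure G \<in> sets m"
          unfolding configurationsD(1)[OF m] by (intro cylinder_borel) simp
      qed (use closure_subset in blast)
      finally show ?thesis .
    qed
    then show "?D \<in> config_ideal k"
      unfolding config_ideal_iff using closure_mem[OF \<psi>(6)] by blast
    show "m \<in> ?D" if m: "m \<in> configurations" and k: "of_nat k \<le> emeasure m (UNIV \<times> B)" for m
    proof -
      obtain n where n: "emeasure m (UNIV \<times> B) = of_nat n"
        using configurationsD(3)[OF m B' B(1)] by blast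
      have "k \<le> n"
        using k unfolding n by simp
      moreover have "measure m (UNIV \<times> B) = real n"
        using n by (simp add: measure_def)
      ultimately show ?thesis
        using lower[OF m] m by simp
    qed
  qed
qed

lemma openin_Union_config_ideal:
  "openin (config_space :: ('y::polish_space \<times> 'x) measure topology) (\<Union>(config_ideal k))"
proof (subst openin_subopen, rule ballI)
  fix m :: "('y \<times> 'x) measure"
  assume "m \<in> \<Union>(config_ideal k)"
  then obtain B where B: "m \<in> configurations" "B \<in> S" "closed B" "of_nat k \<le> emeasure m (UNIV \<times> B)"
    unfolding mem_Union_config_ideal_iff by blast
  obtain D where "openin (config_space :: ('y \<times> 'x) measure topology) D" "D \<in> config_ideal k"
    "\<And>m. m \<in> configurations \<Longrightarrow> of_nat k \<le> emeasure m (UNIV \<times> B) \<Longrightarrow> m \<in> D"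
    using open_neighbourhood_in_config_ideal[OF B(2,3)] by blast
  then show "\<exists>D. openin config_space D \<and> m \<in> D \<and> D \<subseteq> \<Union>(config_ideal k)"
    using B(1,4) by blast
qed

lemma test_functionE:
  fixes f :: "('y::polish_space \<times> 'x) measure \<Rightarrow> real"
  assumes "f \<in> test_functions config_space (config_ideal k)"
  obtains B c where "B \<in> S" "closed B" "0 \<le> c" "\<And>m. \<bar>f m\<bar> \<le> c"
    "\<And>m. f m \<noteq> 0 \<Longrightarrow> m \<in> configurations \<and> of_nat k \<le> emeasure m (UNIV \<times> B)"
proof -
  let ?W = "\<Union>(config_ideal k) :: ('y \<times> 'x) measure set"
  let ?F = "{m \<in> ?W. f m \<noteq> 0}"
  have bdd: "bounded (f ` ?W)" and supp: "config_space closure_of ?F \<in> config_ideal k"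
    and zero: "\<And>m. m \<notin> ?W \<Longrightarrow> f m = 0"
    using assms unfolding test_functions_def mem_Collect_eq by blast+
  obtain c where c: "\<And>m. m \<in> ?W \<Longrightarrow> \<bar>f m\<bar> \<le> c"
    using bdd unfolding bounded_iff by auto
  obtain B where B: "B \<in> S" "closed B"
      "\<And>m. m \<in> config_space closure_of ?F \<Longrightarrow> of_nat k \<le> emeasure m (UNIV \<times> B)"
    using supp unfolding config_ideal_iff by blast
  have "?W \<subseteq> topspace config_space"
    by (rule openin_subset[OF openin_Union_config_ideal])
  then have F: "?F \<subseteq> config_space closure_of ?F" "?F \<subseteq> configurations"
    unfolding topspace_config_space by (auto intro!: closure_of_subset simp: topspace_config_space simp del: Union_iff)
  show ?thesis
  proof (rule that[OF B(1,2)])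
    show "0 \<le> max c 0" by simp
    show "\<bar>f m\<bar> \<le> max c 0" for m
      using c[of m] zero[of m] by (cases "m \<in> ?W") auto
    show "m \<in> configurations \<and> of_nat k \<le> emeasure m (UNIV \<times> B)" if "f m \<noteq> 0" for m
    proof -
      have "m \<in> ?F"
        using that zero by blast
      then show ?thesis
        using F B(3) by blast
    qed
  qed
qed

text \<open>
  A test function is continuous on the union of the ideal, which is an open set, and zero elsewhere.
\<close>

lemma test_function_borel_config:
  fixes f :: "('y::polish_space \<times> 'x) measure \<Rightarrow> real"
  assumes "f \<in> test_functions config_space (config_ideal k)"
  shows "f \<in> borel_measurable (borel_of config_space)"
proof (rule borel_measurableI)
  fix V :: "real set"
  assume V: "open V"
  let ?W = "\<Union>(config_ideal k) :: ('y \<times> 'x) measure set"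
  have cont: "continuous_map (subtopology config_space ?W) euclideanreal f"
    and zero: "\<And>m. m \<notin> ?W \<Longrightarrow> f m = 0"
    using assms unfolding test_functions_def mem_Collect_eq by blast+
  have W: "openin config_space ?W"
    by (rule openin_Union_config_ideal)
  have "openin (subtopology config_space ?W) {m \<in> topspace (subtopology config_space ?W). f m \<in> V}"
    by (rule openin_continuous_map_preimage[OF cont]) (use V in simp)
  then have "openin config_space {m \<in> topspace (subtopology config_space ?W). f m \<in> V}"
    by (rule openin_trans_full[OF _ W])
  moreover have "topspace (subtopology config_space ?W) = ?W"
    using openin_subset[OF W] by (simp only: topspace_subtopology Int_absorb1)
  ultimately have *: "{m \<in> ?W. f m \<in> V} \<in> sets (borel_of config_space)"
    by (intro openin_borel_of) (simp only:)
  have **: "space (borel_of config_space) - ?W \<in> sets (borel_of config_space)"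
    by (intro sets.compl_sets openin_borel_of W)
  have "f -` V \<inter> space (borel_of config_space) =
      {m \<in> ?W. f m \<in> V} \<union> (if 0 \<in> V then space (borel_of config_space) - ?W else {})"
  proof (intro set_eqI iffI)
    fix m assume "m \<in> f -` V \<inter> space (borel_of config_space)"
    then show "m \<in> {m \<in> ?W. f m \<in> V} \<union> (if 0 \<in> V then space (borel_of config_space) - ?W else {})"
      using zero[of m] by (cases "m \<in> ?W") (simp_all del: Union_iff)
  next
    have sub: "?W \<subseteq> space (borel_of config_space)"
      unfolding space_borel_of by (rule openin_subset[OF W])
    fix m assume "m \<in> {m \<in> ?W. f m \<in> V} \<union> (if 0 \<in> V then space (borel_of config_space) - ?W else {})"
    then show "m \<in> f -` V \<inter> space (borel_of config_space)"
      using zero[of m] sub by (cases "m \<in> ?W") (auto split: if_splits simp del: Union_iff)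
  qed
  then show "f -` V \<inter> space (borel_of config_space) \<in> sets (borel_of config_space)"
    using * ** by simp
qed

lemma emeasure_config_cylinder:
  assumes "B \<in> S" "B \<in> sets borel"
  shows "emeasure (config marks N y x) (UNIV \<times> B) = of_nat (card {i. i < N \<and> x i \<in> B})"
proof -
  have "{i. i < N \<and> (y i, x i) \<in> marks \<and> (y i, x i) \<in> UNIV \<times> B} = {i. i < N \<and> x i \<in> B}"
    unfolding mem_Union_mark_ideal_iff using assms(1) by auto
  then show ?thesis
    by (simp only: emeasure_config[OF cylinder_borel[OF assms(2)]])
qed

lemma config_reindex:
  assumes "inj_on j {..<k}" "j ` {..<k} = {i. i < N \<and> x i \<in> \<Union>S}"
  shows "config marks N y x = config marks k (\<lambda>l. y (j l)) (\<lambda>l. x (j l))"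
proof (rule measure_eqI)
  fix A assume "A \<in> sets (config marks N y x)"
  then have A: "A \<in> sets borel" by simp
  have "bij_betw j {l. l < k \<and> (y (j l), x (j l)) \<in> marks \<and> (y (j l), x (j l)) \<in> A}
      {i. i < N \<and> (y i, x i) \<in> marks \<and> (y i, x i) \<in> A}"
    unfolding mem_Union_mark_ideal_iff snd_conv bij_betw_def
  proof
    show "inj_on j {l. l < k \<and> x (j l) \<in> \<Union>S \<and> (y (j l), x (j l)) \<in> A}"
      by (rule inj_on_subset[OF assms(1)]) auto
    show "j ` {l. l < k \<and> x (j l) \<in> \<Union>S \<and> (y (j l), x (j l)) \<in> A} =
        {i. i < N \<and> x i \<in> \<Union>S \<and> (y i, x i) \<in> A}"
    proof (intro equalityI subsetI)
      fix i assume "i \<in> j ` {l. l < k \<and> x (j l) \<in> \<Union>S \<and> (y (j l), x (j l)) \<in> A}"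
      then obtain l where l: "i = j l" "l < k" "x (j l) \<in> \<Union>S" "(y (j l), x (j l)) \<in> A"
        by blast
      then have "i \<in> j ` {..<k}"
        by simp
      then have "i < N"
        unfolding assms(2) by blast
      then show "i \<in> {i. i < N \<and> x i \<in> \<Union>S \<and> (y i, x i) \<in> A}"
        using l by blast
    next
      fix i assume i: "i \<in> {i. i < N \<and> x i \<in> \<Union>S \<and> (y i, x i) \<in> A}"
      then have "i \<in> j ` {..<k}"
        unfolding assms(2) by blast
      then show "i \<in> j ` {l. l < k \<and> x (j l) \<in> \<Union>S \<and> (y (j l), x (j l)) \<in> A}"
        using i by blast
    qed
  qed
  from bij_betw_same_card[OF this]
  show "emeasure (config marks N y x) A = emeasure (config marks k (\<lambda>l. y (j l)) (\<lambda>l. x (j l))) A"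
    unfolding emeasure_config[OF A] by (simp only:)
qed simp

text \<open>
  As long as all marks stay in the open set \<open>\<Union>S\<close>, no point is dropped and the configuration depends
  continuously on its points.
\<close>

lemma open_config_preimage:
  assumes "openin (config_space :: ('y::polish_space \<times> 'x) measure topology) D"
  shows "open {p :: (nat \<Rightarrow> 'y) \<times> (nat \<Rightarrow> 'x). (\<forall>l<k. snd p l \<in> \<Union>S) \<and> config marks k (fst p) (snd p) \<in> D}"
proof -
  have "\<forall>\<^sub>F p in nhds p0. (\<forall>l<k. snd p l \<in> \<Union>S) \<and> config marks k (fst p) (snd p) \<in> D"
    if p0: "\<forall>l<k. snd p0 l \<in> \<Union>S" "config marks k (fst p0) (snd p0) \<in> D" for p0 :: "(nat \<Rightarrow> 'y) \<times> (nat \<Rightarrow> 'x)"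
  proof (rule eventually_conj)
    have y: "((\<lambda>p. fst p l) \<longlongrightarrow> fst p0 l) (nhds p0)" for l
    proof -
      have "isCont (\<lambda>p :: (nat \<Rightarrow> 'y) \<times> (nat \<Rightarrow> 'x). fst p l) p0"
        using continuous_on_product_then_coordinatewise[OF continuous_on_fst[OF continuous_on_id], of UNIV l]
          continuous_on_eq_continuous_at[OF open_UNIV] by fastforce
      then show ?thesis
        using filterlim_def tendsto_at_iff_tendsto_nhds isCont_def by metis
    qed
    have x: "((\<lambda>p. snd p l) \<longlongrightarrow> snd p0 l) (nhds p0)" for l
    proof -
      have "isCont (\<lambda>p :: (nat \<Rightarrow> 'y) \<times> (nat \<Rightarrow> 'x). snd p l) p0"
        using continuous_on_product_then_coordinatewise[OF continuous_on_snd[OF continuous_on_id], of UNIV l]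
          continuous_on_eq_continuous_at[OF open_UNIV] by fastforce
      then show ?thesis
        using filterlim_def tendsto_at_iff_tendsto_nhds isCont_def by metis
    qed
    show "\<forall>\<^sub>F p in nhds p0. \<forall>l<k. snd p l \<in> \<Union>S"
    proof -
      have "\<forall>\<^sub>F p in nhds p0. snd p l \<in> \<Union>S" if "l < k" for l
        using topological_tendstoD[OF x open_Union] p0(1) that by blast
      then have "\<forall>\<^sub>F p in nhds p0. \<forall>l\<in>{..<k}. snd p l \<in> \<Union>S"
        by (intro eventually_ball_finite) auto
      then show ?thesis
        by (rule eventually_mono) (simp del: Union_iff)
    qed
    have "limitin config_space (\<lambda>p. config marks k (fst p) (snd p)) (config marks k (fst p0) (snd p0)) (nhds p0)"
    proof (rule limitin_config[where j = id])
      show "((\<lambda>p. fst p (id l)) \<longlongrightarrow> fst p0 l) (nhds p0)" "((\<lambda>p. snd p (id l)) \<longlongrightarrow> snd p0 l) (nhds p0)" for l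
        using y[of l] x[of l] by simp_all
      show "snd p0 l \<in> \<Union>S" if "l < k" for l
        using p0(1) that by blast
    qed auto
    then show "\<forall>\<^sub>F p in nhds p0. config marks k (fst p) (snd p) \<in> D"
      using assms p0(2) by (rule limitinD)
  qed
  note nbhd = this[unfolded eventually_nhds]
  show ?thesis
  proof (subst open_subopen, rule ballI)
    fix p0 :: "(nat \<Rightarrow> 'y) \<times> (nat \<Rightarrow> 'x)"
    assume "p0 \<in> {p. (\<forall>l<k. snd p l \<in> \<Union>S) \<and> config marks k (fst p) (snd p) \<in> D}"
    then have p0: "\<forall>l<k. snd p0 l \<in> \<Union>S" "config marks k (fst p0) (snd p0) \<in> D"
      by blast+
    from nbhd[OF this] show "\<exists>C. open C \<and> p0 \<in> C \<and>
        C \<subseteq> {p. (\<forall>l<k. snd p l \<in> \<Union>S) \<and> config marks k (fst p) (snd p) \<in> D}"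
      by (elim exE conjE) (intro exI conjI subsetI CollectI; assumption | blast)
  qed
qed

text \<open>
  The set \<open>I\<close> of indices whose marks lie in \<open>\<Union>S\<close> takes finitely many values. On the piece \<open>R I\<close> the
  configuration is determined by the points with index in \<open>I\<close>, and depends continuously on them.
\<close>

lemma measurable_config:
  "(\<lambda>p. config marks N (fst p) (snd p)) \<in> measurable
    (borel :: ((nat \<Rightarrow> 'y::polish_space) \<times> (nat \<Rightarrow> 'x)) measure) (borel_of config_space)"
  unfolding borel_of_def
proof (rule measurable_measure_of)
  show "{U. openin config_space U} \<subseteq> Pow (topspace (config_space :: ('y \<times> 'x) measure topology))"
    using openin_subset by blast
  show "(\<lambda>p. config marks N (fst p) (snd p)) \<in> space (borel :: ((nat \<Rightarrow> 'y) \<times> (nat \<Rightarrow> 'x)) measure) \<rightarrow> topspace config_space"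
    unfolding topspace_config_space using config_counting by blast
  fix D :: "('y \<times> 'x) measure set"
  assume "D \<in> {U. openin config_space U}"
  then have D: "openin config_space D" by blast
  let ?pre = "(\<lambda>p :: (nat \<Rightarrow> 'y) \<times> (nat \<Rightarrow> 'x). config marks N (fst p) (snd p)) -` D \<inter> space borel"
  have x: "(\<lambda>p :: (nat \<Rightarrow> 'y) \<times> (nat \<Rightarrow> 'x). snd p i) \<in> borel_measurable borel" for i
    by (intro borel_measurable_continuous_onI continuous_on_product_then_coordinatewise[OF continuous_on_snd[OF continuous_on_id]])
  have y: "(\<lambda>p :: (nat \<Rightarrow> 'y) \<times> (nat \<Rightarrow> 'x). fst p i) \<in> borel_measurable borel" for i
    by (intro borel_measurable_continuous_onI continuous_on_product_then_coordinatewise[OF continuous_on_fst[OF continuous_on_id]])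
  define R where "R I = {p :: (nat \<Rightarrow> 'y) \<times> (nat \<Rightarrow> 'x). \<forall>i<N. snd p i \<in> \<Union>S \<longleftrightarrow> i \<in> I}" for I
  have R_borel: "R I \<in> sets borel" for I
  proof -
    have U: "\<Union>S \<in> sets borel"
      using open_Union by (rule borel_open)
    have "{p :: (nat \<Rightarrow> 'y) \<times> (nat \<Rightarrow> 'x). snd p i \<in> \<Union>S \<longleftrightarrow> i \<in> I} \<in> sets borel" for i
    proof -
      have "{p :: (nat \<Rightarrow> 'y) \<times> (nat \<Rightarrow> 'x). snd p i \<in> \<Union>S \<longleftrightarrow> i \<in> I} =
          (\<lambda>p. snd p i) -` (if i \<in> I then \<Union>S else - \<Union>S) \<inter> space borel"
        by auto
      also have "\<dots> \<in> sets borel"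
        using U by (intro measurable_sets[OF x]) auto
      finally show ?thesis .
    qed
    then have "(\<Inter>i\<in>{..<N}. {p :: (nat \<Rightarrow> 'y) \<times> (nat \<Rightarrow> 'x). snd p i \<in> \<Union>S \<longleftrightarrow> i \<in> I}) \<inter> UNIV \<in> sets borel"
      by (cases "N = 0") (auto intro!: sets.finite_INT simp del: Union_iff)
    moreover have "(\<Inter>i\<in>{..<N}. {p :: (nat \<Rightarrow> 'y) \<times> (nat \<Rightarrow> 'x). snd p i \<in> \<Union>S \<longleftrightarrow> i \<in> I}) \<inter> UNIV = R I"
      unfolding R_def by (auto simp del: Union_iff)
    ultimately show ?thesis
      by (simp only:)
  qed
  have piece: "R I \<inter> ?pre \<in> sets borel" if I: "I \<subseteq> {..<N}" for I
  proof -
    have "finite I"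
      using I finite_subset by blast
    then obtain j where "bij_betw j {..<card I} I"
      using ex_bij_betw_nat_finite atLeast0LessThan by metis
    then have j: "inj_on j {..<card I}" "j ` {..<card I} = I"
      by (auto simp: bij_betw_def)
    let ?Q = "{p :: (nat \<Rightarrow> 'y) \<times> (nat \<Rightarrow> 'x). (\<forall>l<card I. snd p l \<in> \<Union>S) \<and> config marks (card I) (fst p) (snd p) \<in> D}"
    let ?r = "\<lambda>p :: (nat \<Rightarrow> 'y) \<times> (nat \<Rightarrow> 'x). ((\<lambda>l. fst p (j l)), (\<lambda>l. snd p (j l)))"
    have "continuous_on UNIV ?r"
      by (intro continuous_on_Pair continuous_on_coordinatewise_then_product
          continuous_on_product_then_coordinatewise[OF continuous_on_fst[OF continuous_on_id]]
          continuous_on_product_then_coordinatewise[OF continuous_on_snd[OF continuous_on_id]])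
    then have "?r \<in> borel_measurable borel"
      by (rule borel_measurable_continuous_onI)
    then have "?r -` ?Q \<inter> space borel \<in> sets borel"
      by (rule measurable_sets[OF _ borel_open[OF open_config_preimage[OF D]]])
    moreover have "R I \<inter> ?pre = R I \<inter> (?r -` ?Q \<inter> space borel)"
    proof (intro set_eqI)
      fix p :: "(nat \<Rightarrow> 'y) \<times> (nat \<Rightarrow> 'x)"
      show "p \<in> R I \<inter> ?pre \<longleftrightarrow> p \<in> R I \<inter> (?r -` ?Q \<inter> space borel)"
      proof (cases "p \<in> R I")
        case True
        then have set: "j ` {..<card I} = {i. i < N \<and> snd p i \<in> \<Union>S}"
          unfolding j(2) R_def using I by (auto simp del: Union_iff)
        have "snd p (j l) \<in> \<Union>S" if "l < card I" for l
        proof -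
          have "j l \<in> j ` {..<card I}"
            using that by simp
          then show ?thesis
            unfolding set by blast
        qed
        then show ?thesis
          using True config_reindex[OF j(1) set, of "fst p"] by (simp del: Union_iff)
      qed simp
    qed
    ultimately show ?thesis
      using R_borel by (simp only: sets.Int)
  qed
  have "?pre = (\<Union>I\<in>Pow {..<N}. R I \<inter> ?pre)"
  proof (intro equalityI subsetI)
    fix p assume p: "p \<in> ?pre"
    have "p \<in> R {i\<in>{..<N}. snd p i \<in> \<Union>S}"
      unfolding R_def by (simp del: Union_iff)
    then have "p \<in> R {i\<in>{..<N}. snd p i \<in> \<Union>S} \<inter> ?pre"
      using p by (rule IntI)
    then show "p \<in> (\<Union>I\<in>Pow {..<N}. R I \<inter> ?pre)"
      by (rule UN_I[rotated]) (rule PowI, rule Collect_restrict)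
  next
    fix p assume "p \<in> (\<Union>I\<in>Pow {..<N}. R I \<inter> ?pre)"
    then show "p \<in> ?pre"
      by (elim UN_E IntD2)
  qed
  moreover have "(\<Union>I\<in>Pow {..<N}. R I \<inter> ?pre) \<in> sets borel"
    by (intro sets.finite_UN piece) auto
  ultimately show "?pre \<in> sets borel"
    by (simp only:)
qed

text \<open>
  The limiting configuration belongs to the union of the ideal, where \<open>f\<close> is continuous, since its
  \<open>k\<close> marks form a finite and thus closed member of \<open>S\<close>.
\<close>

lemma test_function_config_lim:
  fixes f :: "('y::polish_space \<times> 'x) measure \<Rightarrow> real"
  assumes f: "f \<in> test_functions config_space (config_ideal k)"
    and j: "j \<in> injections k N"
    and near: "\<And>l. l < k \<Longrightarrow> (\<lambda>s. xs s (j l)) \<longlonglongrightarrow> u l" and u: "\<And>l. l < k \<Longrightarrow> u l \<in> \<Union>S"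
    and far: "\<And>i B. i < N \<Longrightarrow> i \<notin> j ` {..<k} \<Longrightarrow> B \<in> S \<Longrightarrow> \<forall>\<^sub>F s in sequentially. xs s i \<notin> B"
  shows "(\<lambda>s. f (config marks N y (xs s))) \<longlonglongrightarrow> f (config marks k (\<lambda>l. y (j l)) u)"
proof -
  let ?W = "\<Union>(config_ideal k) :: ('y \<times> 'x) measure set"
  let ?m = "config marks k (\<lambda>l. y (j l)) u"
  have lim: "limitin config_space (\<lambda>s. config marks N y (xs s)) ?m sequentially"
    by (rule limitin_config[where j=j and ys="\<lambda>_. y" and xs=xs]) (use j near u far in \<open>auto simp del: Union_iff\<close>)
  have "?m \<in> ?W"
    unfolding mem_Union_config_ideal_iff
  proof (intro conjI config_counting bexI)
    let ?B = "u ` {..<k}"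
    show B: "?B \<in> S"
      using u by (intro finite_subset_mem) auto
    show cl: "closed ?B"
      by (intro finite_imp_closed) simp
    have "{i. i < k \<and> u i \<in> ?B} = {..<k}"
      by auto
    then show "of_nat k \<le> emeasure ?m (UNIV \<times> ?B)"
      using cl by (subst emeasure_config_cylinder[OF B]) (simp_all add: borel_closed)
  qed
  then have "limitin (subtopology config_space ?W) (\<lambda>s. config marks N y (xs s)) ?m sequentially"
    unfolding limitin_subtopology using lim limitinD[OF lim openin_Union_config_ideal] by blast
  moreover have "continuous_map (subtopology config_space ?W) euclideanreal f"
    using f by (simp only: test_functions_def mem_Collect_eq)
  ultimately have "limitin euclideanreal (f \<circ> (\<lambda>s. config marks N y (xs s))) (f ?m) sequentially"
    by (rule continuous_map_limit[rotated])
  then show ?thesis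
    by (simp add: o_def)
qed

end

section \<open>Factorial moment measures and independence\<close>

text \<open>
  The intensity is the image of a measure on pairs of an index tuple and a sample point, restricted to
  the tuples that are admissible at that sample point. This shows that it is a measure, and reduces
  integrals against it to Tonelli's theorem.
\<close>

lemma factorial_moment_measure_eq_distr:
  fixes y :: "nat \<Rightarrow> 'w \<Rightarrow> 'y::polish_space"
  assumes P: "prob_space P" and n: "n \<in> measurable P (count_space UNIV)"
    and y: "\<And>i. y i \<in> measurable P borel"
  shows sets_factorial_moment_measure:
      "sets (factorial_moment_measure P k n y) = sets (PiM {..<k} (\<lambda>_. borel))" (is "?sets")
    and nn_integral_factorial_moment_measure:
      "h \<in> borel_measurable (PiM {..<k} (\<lambda>_. borel)) \<Longrightarrow>
        (\<integral>\<^sup>+v. h v \<partial>factorial_moment_measure P k n y) =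
        (\<integral>\<^sup>+\<omega>. (\<Sum>j\<in>injections k (n \<omega>). h (\<lambda>l\<in>{..<k}. y (j l) \<omega>)) \<partial>P)" (is "_ \<Longrightarrow> ?integral h")
proof -
  interpret prob_space P by (rule P)
  let ?B = "PiM {..<k} (\<lambda>_. borel) :: (nat \<Rightarrow> 'y) measure"
  define J where "J = {..<k} \<rightarrow>\<^sub>E (UNIV :: nat set)"
  have "countable J"
    unfolding J_def by (intro countable_PiE) auto
  define t where "t p = (\<lambda>l\<in>{..<k}. y (fst p l) (snd p))" for p :: "(nat \<Rightarrow> nat) \<times> 'w"
  define R where "R = {p \<in> space (count_space J \<Otimes>\<^sub>M P). fst p \<in> injections k (n (snd p))}"
  have t: "t \<in> measurable (count_space J \<Otimes>\<^sub>M P) ?B"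
    using \<open>countable J\<close>
  proof (rule measurable_pair_measure_countable1)
    show "(\<lambda>\<omega>. t (j, \<omega>)) \<in> measurable P ?B" for j
      unfolding t_def by (simp, intro measurable_restrict y)
  qed
  have "(\<lambda>p. fst p \<in> injections k (n (snd p))) \<in> measurable (count_space J \<Otimes>\<^sub>M P) (count_space UNIV)"
    using \<open>countable J\<close>
  proof (rule measurable_pair_measure_countable1)
    show "(\<lambda>\<omega>. fst (j, \<omega>) \<in> injections k (n (snd (j, \<omega>)))) \<in> measurable P (count_space UNIV)" for j
      using measurable_compose[OF n, of "\<lambda>N. j \<in> injections k N" "count_space UNIV"] by simp
  qed
  then have R: "R \<in> sets (count_space J \<Otimes>\<^sub>M P)"
    unfolding R_def by (simp add: pred_def)
  define K where "K = distr (density (count_space J \<Otimes>\<^sub>M P) (indicator R)) ?B t"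
  have K: "(\<integral>\<^sup>+v. h v \<partial>K) = (\<integral>\<^sup>+\<omega>. (\<Sum>j\<in>injections k (n \<omega>). h (\<lambda>l\<in>{..<k}. y (j l) \<omega>)) \<partial>P)"
    if h: "h \<in> borel_measurable ?B" for h
  proof -
    interpret J: sigma_finite_measure "count_space J"
      by (rule sigma_finite_measure_count_space_countable[OF \<open>countable J\<close>])
    interpret pair_sigma_finite "count_space J" P ..
    have ht: "(\<lambda>p. h (t p)) \<in> borel_measurable (count_space J \<Otimes>\<^sub>M P)"
      by (rule measurable_compose[OF t h])
    have "(\<integral>\<^sup>+v. h v \<partial>K) = (\<integral>\<^sup>+p. indicator R p * h (t p) \<partial>(count_space J \<Otimes>\<^sub>M P))"
      unfolding K_def using t h ht R by (simp add: nn_integral_distr nn_integral_density)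
    also have "\<dots> = (\<integral>\<^sup>+\<omega>. \<integral>\<^sup>+j. indicator R (j, \<omega>) * h (t (j, \<omega>)) \<partial>count_space J \<partial>P)"
      using ht R by (intro nn_integral_snd[symmetric]) auto
    also have "\<dots> = (\<integral>\<^sup>+\<omega>. (\<Sum>j\<in>injections k (n \<omega>). h (\<lambda>l\<in>{..<k}. y (j l) \<omega>)) \<partial>P)"
    proof (rule nn_integral_cong)
      fix \<omega> assume \<omega>: "\<omega> \<in> space P"
      have mem: "(j, \<omega>) \<in> R \<longleftrightarrow> j \<in> injections k (n \<omega>)" if "j \<in> J" for j
        using that \<omega> unfolding R_def by (simp add: space_pair_measure)
      have sub: "injections k (n \<omega>) \<subseteq> J"
        unfolding J_def by (auto simp: PiE_def)
      have "(\<integral>\<^sup>+j. indicator R (j, \<omega>) * h (t (j, \<omega>)) \<partial>count_space J) =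
          (\<Sum>j\<in>injections k (n \<omega>). indicator R (j, \<omega>) * h (t (j, \<omega>)))"
        using mem by (intro nn_integral_count_space' finite_injections sub) (auto simp: indicator_def)
      also have "\<dots> = (\<Sum>j\<in>injections k (n \<omega>). h (\<lambda>l\<in>{..<k}. y (j l) \<omega>))"
      proof (rule sum.cong[OF refl])
        fix j assume j: "j \<in> injections k (n \<omega>)"
        then have "(j, \<omega>) \<in> R"
          using mem sub by blast
        then show "indicator R (j, \<omega>) * h (t (j, \<omega>)) = h (\<lambda>l\<in>{..<k}. y (j l) \<omega>)"
          by (simp add: t_def)
      qed
      finally show "(\<integral>\<^sup>+j. indicator R (j, \<omega>) * h (t (j, \<omega>)) \<partial>count_space J) =
          (\<Sum>j\<in>injections k (n \<omega>). h (\<lambda>l\<in>{..<k}. y (j l) \<omega>))" .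
    qed
    finally show ?thesis .
  qed
  have "(\<integral>\<^sup>+\<omega>. emeasure (dirac_sum (injections k (n \<omega>)) ?B (\<lambda>j. \<lambda>l\<in>{..<k}. y (j l) \<omega>)) A \<partial>P) = emeasure K A"
    if A: "A \<in> sets ?B" for A
  proof -
    have "emeasure K A = (\<integral>\<^sup>+v. indicator A v \<partial>K)"
      using A by (simp add: K_def)
    also have "\<dots> = (\<integral>\<^sup>+\<omega>. (\<Sum>j\<in>injections k (n \<omega>). indicator A (\<lambda>l\<in>{..<k}. y (j l) \<omega>)) \<partial>P)"
      using A by (intro K borel_measurable_indicator)
    also have "\<dots> = (\<integral>\<^sup>+\<omega>. emeasure (dirac_sum (injections k (n \<omega>)) ?B (\<lambda>j. \<lambda>l\<in>{..<k}. y (j l) \<omega>)) A \<partial>P)"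
      using A by (intro nn_integral_cong emeasure_dirac_sum[symmetric] finite_injections) (auto simp: space_PiM)
    finally show ?thesis ..
  qed
  then have "factorial_moment_measure P k n y = measure_of (space ?B) (sets ?B) (emeasure K)"
    unfolding factorial_moment_measure_def intensity_measure_def
    by (intro measure_of_eq) (auto simp: sets.sigma_sets_eq sets.space_closed)
  also have "\<dots> = measure_of (space K) (sets K) (emeasure K)"
    by (simp add: K_def)
  also have "\<dots> = K"
    by (rule measure_of_of_measure)
  finally have eq: "factorial_moment_measure P k n y = K" .
  show ?sets
    unfolding eq by (simp add: K_def)
  show "?integral h" if "h \<in> borel_measurable ?B"
    unfolding eq by (rule K[OF that])
qed

lemma distr_independent_pair:
  assumes P: "prob_space P" and ind: "independent_rvs P M U N V"
  shows "distr P (M \<Otimes>\<^sub>M N) (\<lambda>\<omega>. (U \<omega>, V \<omega>)) = distr P M U \<Otimes>\<^sub>M distr P N V"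
proof -
  interpret prob_space P by (rule P)
  have U: "U \<in> measurable P M" and V: "V \<in> measurable P N"
    and set: "indep_set {U -` A \<inter> space P | A. A \<in> sets M} {V -` A \<inter> space P | A. A \<in> sets N}"
    using ind by (auto simp: independent_rvs_def)
  show ?thesis
  proof (rule pair_measure_eqI[symmetric])
    show "sigma_finite_measure (distr P M U)" "sigma_finite_measure (distr P N V)"
      by (intro prob_space_imp_sigma_finite prob_space_distr U V)+
    fix A B assume "A \<in> sets (distr P M U)" "B \<in> sets (distr P N V)"
    then have A: "A \<in> sets M" and B: "B \<in> sets N" by simp_all
    have "prob ((U -` A \<inter> space P) \<inter> (V -` B \<inter> space P)) = prob (U -` A \<inter> space P) * prob (V -` B \<inter> space P)"
      using A B by (intro indep_setD[OF set]) auto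
    moreover have "(U -` A \<inter> space P) \<inter> (V -` B \<inter> space P) = (\<lambda>\<omega>. (U \<omega>, V \<omega>)) -` (A \<times> B) \<inter> space P"
      by auto
    ultimately show "emeasure (distr P M U) A * emeasure (distr P N V) B =
        emeasure (distr P (M \<Otimes>\<^sub>M N) (\<lambda>\<omega>. (U \<omega>, V \<omega>))) (A \<times> B)"
      using A B U V by (simp add: emeasure_distr emeasure_eq_measure ennreal_mult[symmetric])
  qed simp
qed

lemma independent_rvs_compose:
  assumes P: "prob_space P" and ind: "independent_rvs P M U N V" and h: "h \<in> measurable M M'"
  shows "independent_rvs P M' (\<lambda>\<omega>. h (U \<omega>)) N V"
proof -
  interpret prob_space P by (rule P)
  have U: "U \<in> measurable P M" and V: "V \<in> measurable P N"
    and set: "indep_set {U -` A \<inter> space P | A. A \<in> sets M} {V -` A \<inter> space P | A. A \<in> sets N}"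
    using ind by (auto simp: independent_rvs_def)
  have hU: "(\<lambda>\<omega>. h (U \<omega>)) \<in> measurable P M'"
    by (rule measurable_compose[OF U h])
  have "indep_set {(\<lambda>\<omega>. h (U \<omega>)) -` A \<inter> space P | A. A \<in> sets M'} {V -` A \<inter> space P | A. A \<in> sets N}"
  proof (rule indep_setI)
    show "{(\<lambda>\<omega>. h (U \<omega>)) -` A \<inter> space P | A. A \<in> sets M'} \<subseteq> events"
      using measurable_sets[OF hU] by blast
    show "{V -` A \<inter> space P | A. A \<in> sets N} \<subseteq> events"
      using measurable_sets[OF V] by blast
    fix a b assume "a \<in> {(\<lambda>\<omega>. h (U \<omega>)) -` A \<inter> space P | A. A \<in> sets M'}" and b: "b \<in> {V -` A \<inter> space P | A. A \<in> sets N}"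
    then obtain A where A: "A \<in> sets M'" "a = (\<lambda>\<omega>. h (U \<omega>)) -` A \<inter> space P"
      by blast
    have "a = U -` (h -` A \<inter> space M) \<inter> space P"
      unfolding A(2) using measurable_space[OF U] by auto
    then have "a \<in> {U -` A \<inter> space P | A. A \<in> sets M}"
      using measurable_sets[OF h A(1)] by blast
    then show "prob (a \<inter> b) = prob a * prob b"
      using b by (intro indep_setD[OF set])
  qed
  then show ?thesis
    using hU V by (simp add: independent_rvs_def)
qed

text \<open>
  The transformed marks are independent of \<open>V\<close> and form an independent sequence with common law, so
  the joint law is a product and Tonelli's theorem applies.
\<close>

lemma nn_integral_independent_marks:
  fixes mark :: "nat \<Rightarrow> 'w \<Rightarrow> 'x::polish_space" and s :: "'x \<Rightarrow> 'x"
  assumes P: "prob_space P" and indep: "prob_space.indep_vars P (\<lambda>_. borel) mark UNIV"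
    and law: "\<And>i. distr P borel (mark i) = distr P borel \<xi>" and \<xi>: "\<xi> \<in> borel_measurable P"
    and ind: "independent_rvs P (PiM UNIV (\<lambda>_. borel)) (\<lambda>\<omega> i. mark i \<omega>) N V"
    and s: "s \<in> borel_measurable borel"
    and F: "F \<in> borel_measurable (PiM UNIV (\<lambda>_. borel) \<Otimes>\<^sub>M N)"
  shows "(\<integral>\<^sup>+\<omega>. F (\<lambda>i. s (mark i \<omega>), V \<omega>) \<partial>P) =
    (\<integral>\<^sup>+\<omega>. \<integral>\<^sup>+x. F (x, V \<omega>) \<partial>PiM UNIV (\<lambda>_ :: nat. distr P borel (\<lambda>\<omega>. s (\<xi> \<omega>))) \<partial>P)"
proof -
  interpret prob_space P by (rule P)
  let ?B = "PiM UNIV (\<lambda>_ :: nat. borel :: 'x measure)"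
  let ?q = "distr P borel (\<lambda>\<omega>. s (\<xi> \<omega>))"
  have mark: "mark i \<in> borel_measurable P" for i
    using indep by (simp add: indep_vars_def)
  have "indep_vars (\<lambda>_. borel) (\<lambda>i \<omega>. s (mark i \<omega>)) UNIV"
    by (rule indep_vars_compose2[OF indep s])
  then have "distr P ?B (\<lambda>\<omega>. \<lambda>i\<in>UNIV. s (mark i \<omega>)) = PiM UNIV (\<lambda>i. distr P borel (\<lambda>\<omega>. s (mark i \<omega>)))"
    using mark s by (subst (asm) indep_vars_iff_distr_eq_PiM) (auto intro: measurable_compose)
  moreover have "distr P borel (\<lambda>\<omega>. s (mark i \<omega>)) = ?q" for i
  proof -
    have "distr P borel (\<lambda>\<omega>. s (mark i \<omega>)) = distr (distr P borel (mark i)) borel s"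
      using mark s by (simp add: distr_distr o_def)
    also have "\<dots> = ?q"
      unfolding law using \<xi> s by (simp add: distr_distr o_def)
    finally show ?thesis .
  qed
  ultimately have marks: "distr P ?B (\<lambda>\<omega> i. s (mark i \<omega>)) = PiM UNIV (\<lambda>_. ?q)"
    by (simp add: restrict_def)
  have "(\<lambda>x i. s (x i)) \<in> measurable ?B ?B"
  proof (rule measurable_PiM_single')
    show "(\<lambda>x. s (x i)) \<in> borel_measurable ?B" for i :: nat
      by (rule measurable_compose[OF _ s]) (rule measurable_component_singleton, simp)
  qed simp
  from independent_rvs_compose[OF P ind this]
  have ind': "independent_rvs P ?B (\<lambda>\<omega> i. s (mark i \<omega>)) N V" .
  then have U: "(\<lambda>\<omega> i. s (mark i \<omega>)) \<in> measurable P ?B" and V: "V \<in> measurable P N"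
    by (simp_all add: independent_rvs_def)
  interpret Q: prob_space "PiM UNIV (\<lambda>_ :: nat. ?q)"
    using \<xi> s by (intro prob_space_PiM prob_space_distr measurable_compose[OF \<xi> s])
  interpret V: prob_space "distr P N V"
    by (rule prob_space_distr[OF V])
  interpret pair_sigma_finite "PiM UNIV (\<lambda>_ :: nat. ?q)" "distr P N V" ..
  have sets_Q: "sets (PiM UNIV (\<lambda>_ :: nat. ?q)) = sets ?B"
    by (intro sets_PiM_cong) auto
  have F': "F \<in> borel_measurable (PiM UNIV (\<lambda>_ :: nat. ?q) \<Otimes>\<^sub>M distr P N V)"
    using F by (subst measurable_cong_sets[OF sets_pair_measure_cong[OF sets_Q sets_distr] refl])
  have "(\<integral>\<^sup>+\<omega>. F (\<lambda>i. s (mark i \<omega>), V \<omega>) \<partial>P) =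
      (\<integral>\<^sup>+z. F z \<partial>distr P (?B \<Otimes>\<^sub>M N) (\<lambda>\<omega>. (\<lambda>i. s (mark i \<omega>), V \<omega>)))"
    using F U V by (subst nn_integral_distr) auto
  also have "\<dots> = (\<integral>\<^sup>+z. F z \<partial>(PiM UNIV (\<lambda>_. ?q) \<Otimes>\<^sub>M distr P N V))"
    unfolding distr_independent_pair[OF P ind'] marks ..
  also have "\<dots> = (\<integral>\<^sup>+v. \<integral>\<^sup>+x. F (x, v) \<partial>PiM UNIV (\<lambda>_. ?q) \<partial>distr P N V)"
    by (rule nn_integral_snd[OF F', symmetric])
  also have "\<dots> = (\<integral>\<^sup>+\<omega>. \<integral>\<^sup>+x. F (x, V \<omega>) \<partial>PiM UNIV (\<lambda>_. ?q) \<partial>P)"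
  proof (rule nn_integral_distr[OF V])
    show "(\<lambda>v. \<integral>\<^sup>+x. F (x, v) \<partial>PiM UNIV (\<lambda>_. ?q)) \<in> borel_measurable (distr P N V)"
      using measurable_pair_swap[OF F'] by (intro Q.borel_measurable_nn_integral) (simp add: case_prod_unfold)
  qed
  finally show ?thesis .
qed

section \<open>The tail measure\<close>

text \<open>
  As \<open>T s\<close> preserves both \<open>\<Union>S\<close> and its complement, the same points are dropped before and after
  scaling.
\<close>

lemma (in based_ideal) lifted_scaling_config:
  fixes y :: "nat \<Rightarrow> 'y::polish_space"
  assumes T: "T s \<in> borel_measurable borel" and U: "\<And>x. T s x \<in> \<Union>S \<longleftrightarrow> x \<in> \<Union>S"
  shows "lifted_scaling (mark_scaling T) s (config marks N y x) = config marks N y (\<lambda>i. T s (x i))"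
proof (rule measure_eqI)
  let ?m = "config marks N y x"
  show "sets (lifted_scaling (mark_scaling T) s ?m) = sets (config marks N y (\<lambda>i. T s (x i)))"
    by (simp add: lifted_scaling_def)
  fix A assume "A \<in> sets (lifted_scaling (mark_scaling T) s ?m)"
  then have A: "A \<in> sets borel"
    by (simp add: lifted_scaling_def)
  have scale: "mark_scaling T s \<in> measurable borel (borel :: ('y \<times> 'x) measure)"
  proof -
    have "(\<lambda>z :: 'y \<times> 'x. (fst z, T s (snd z))) \<in> measurable (borel \<Otimes>\<^sub>M borel) (borel \<Otimes>\<^sub>M borel)"
      by (intro measurable_Pair measurable_fst measurable_compose[OF measurable_snd T])
    then show ?thesis
      by (simp add: mark_scaling_def case_prod_unfold borel_prod)
  qed
  have "emeasure (lifted_scaling (mark_scaling T) s ?m) A = emeasure ?m (mark_scaling T s -` A)"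
  proof -
    have "mark_scaling T s \<in> measurable ?m ?m"
      using scale measurable_cong_sets[OF sets_config sets_config] by blast
    then show ?thesis
      unfolding lifted_scaling_def using A by (subst emeasure_distr) simp_all
  qed
  also have "\<dots> = of_nat (card {i. i < N \<and> (y i, x i) \<in> marks \<and> (y i, x i) \<in> mark_scaling T s -` A})"
    using measurable_sets[OF scale A] by (intro emeasure_config) simp
  also have "{i. i < N \<and> (y i, x i) \<in> marks \<and> (y i, x i) \<in> mark_scaling T s -` A} =
      {i. i < N \<and> (y i, T s (x i)) \<in> marks \<and> (y i, T s (x i)) \<in> A}"
    unfolding mem_Union_mark_ideal_iff snd_conv U by (simp add: mark_scaling_def)
  also have "of_nat (card \<dots>) = emeasure (config marks N y (\<lambda>i. T s (x i))) A"
    by (rule emeasure_config[OF A, symmetric])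
  finally show "emeasure (lifted_scaling (mark_scaling T) s ?m) A = emeasure (config marks N y (\<lambda>i. T s (x i))) A" .
qed

context measured_ideal
begin

text \<open>
  The tail measure as the image of a product measure, which makes its additivity evident. The
  configurations in which \<open>config\<close> drops a point come from a null set.
\<close>

definition config_law :: "nat \<Rightarrow> (nat \<Rightarrow> 'y::polish_space) measure \<Rightarrow> ('y \<times> 'x) measure measure" where
  "config_law k \<kappa> = scale_measure (inverse (fact k))
     (distr (\<kappa> \<Otimes>\<^sub>M \<mu>_power k) (borel_of config_space) (\<lambda>p. config marks k (fst p) (snd p)))"

lemma sigma_finite_PiM_\<mu>: "sigma_finite_measure (\<mu>_power k)"
proof -
  interpret product_sigma_finite "\<lambda>_. \<mu>" by (rule product_sigma_finite_\<mu>)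
  interpret finite_product_sigma_finite "\<lambda>_. \<mu>" "{..<k}" by standard simp
  show ?thesis ..
qed

lemma measurable_config_PiM:
  assumes "sets \<kappa> = sets (PiM {..<k} (\<lambda>_. borel :: 'y::polish_space measure))"
  shows "(\<lambda>p. config marks N (fst p) (snd p)) \<in> measurable (\<kappa> \<Otimes>\<^sub>M \<mu>_power k) (borel_of config_space)"
proof -
  have "(\<lambda>v. v) \<in> measurable \<kappa> (borel :: (nat \<Rightarrow> 'y) measure)"
    by (subst measurable_cong_sets[OF assms refl]) (rule measurable_PiM_nat_borel, simp)
  moreover have "(\<lambda>u. u) \<in> measurable (\<mu>_power k) (borel :: (nat \<Rightarrow> 'x) measure)"
    by (rule measurable_PiM_nat_borel) simp
  ultimately have "(\<lambda>p. (fst p, snd p)) \<in> measurable (\<kappa> \<Otimes>\<^sub>M \<mu>_power k) (borel \<Otimes>\<^sub>M borel)"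
    by (intro measurable_Pair measurable_compose[OF measurable_fst] measurable_compose[OF measurable_snd])
  then have "(\<lambda>p. (fst p, snd p)) \<in> measurable (\<kappa> \<Otimes>\<^sub>M \<mu>_power k) (borel :: ((nat \<Rightarrow> 'y) \<times> (nat \<Rightarrow> 'x)) measure)"
    unfolding borel_prod .
  from measurable_compose[OF this measurable_config] show ?thesis
    by simp
qed

lemma sets_config_law [simp]: "sets (config_law k \<kappa>) = sets (borel_of config_space)"
  and space_config_law [simp]: "space (config_law k \<kappa>) = space (borel_of config_space)"
  by (simp_all add: config_law_def space_scale_measure)

lemma nn_integral_config_law:
  fixes \<kappa> :: "(nat \<Rightarrow> 'y::polish_space) measure"
  assumes \<kappa>: "sets \<kappa> = sets (PiM {..<k} (\<lambda>_. borel))"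
    and f: "f \<in> borel_measurable (borel_of config_space)"
  shows "(\<integral>\<^sup>+m. f m \<partial>config_law k \<kappa>) =
    (\<integral>\<^sup>+v. \<integral>\<^sup>+u. f (config marks k v u) \<partial>\<mu>_power k \<partial>\<kappa>) / fact k"
proof -
  interpret sigma_finite_measure "\<mu>_power k" by (rule sigma_finite_PiM_\<mu>)
  note c = measurable_config_PiM[OF \<kappa>, of k]
  have "(\<integral>\<^sup>+m. f m \<partial>config_law k \<kappa>) =
      inverse (fact k) * (\<integral>\<^sup>+p. f (config marks k (fst p) (snd p)) \<partial>(\<kappa> \<Otimes>\<^sub>M \<mu>_power k))"
    unfolding config_law_def using f c by (simp add: nn_integral_scale_measure nn_integral_distr)
  also have "(\<integral>\<^sup>+p. f (config marks k (fst p) (snd p)) \<partial>(\<kappa> \<Otimes>\<^sub>M \<mu>_power k)) =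
      (\<integral>\<^sup>+v. \<integral>\<^sup>+u. f (config marks k v u) \<partial>\<mu>_power k \<partial>\<kappa>)"
    using nn_integral_fst[OF measurable_compose[OF c f]] by simp
  finally show ?thesis
    by (simp add: divide_ennreal_def mult.commute)
qed

text \<open>
  For almost all choices of the marks, all \<open>k\<close> of them lie in \<open>\<Union>S\<close> and \<open>config\<close> keeps every point.
\<close>

lemma tail_mass_eq:
  fixes \<kappa> :: "(nat \<Rightarrow> 'y::polish_space) measure"
  assumes \<kappa>: "sets \<kappa> = sets (PiM {..<k} (\<lambda>_. borel))" and D: "D \<in> sets (borel_of config_space)"
  shows "tail_mass k \<kappa> \<mu> D = emeasure (config_law k \<kappa>) D"
proof -
  have "emeasure (config_law k \<kappa>) D = (\<integral>\<^sup>+m. indicator D m \<partial>config_law k \<kappa>)"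
    using D by simp
  also have "\<dots> = (\<integral>\<^sup>+v. \<integral>\<^sup>+u. indicator D (config marks k v u) \<partial>\<mu>_power k \<partial>\<kappa>) / fact k"
    using D by (intro nn_integral_config_law \<kappa> borel_measurable_indicator)
  also have "(\<integral>\<^sup>+v. \<integral>\<^sup>+u. indicator D (config marks k v u) \<partial>\<mu>_power k \<partial>\<kappa>) =
      (\<integral>\<^sup>+v. \<integral>\<^sup>+u. indicator D (dirac_sum {..<k} borel (\<lambda>i. (v i, u i))) \<partial>\<mu>_power k \<partial>\<kappa>)"
  proof (rule nn_integral_cong, rule nn_integral_cong_AE)
    fix v :: "nat \<Rightarrow> 'y"
    show "AE u in \<mu>_power k. (indicator D (config marks k v u) :: ennreal) =
        indicator D (dirac_sum {..<k} borel (\<lambda>i. (v i, u i)))"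
      using AE_product_\<mu>
    proof eventually_elim
      case (elim u)
      have "{i \<in> {..<k}. (v i, u i) \<in> marks} = {..<k}"
        unfolding mem_Union_mark_ideal_iff using elim by auto
      then show ?case
        by (simp only: config_def)
    qed
  qed
  finally show ?thesis
    by (simp add: tail_mass_def)
qed

lemma tail_measure_eq:
  fixes \<kappa> :: "(nat \<Rightarrow> 'y::polish_space) measure"
  assumes \<kappa>: "sets \<kappa> = sets (PiM {..<k} (\<lambda>_. borel))"
  shows "tail_measure k \<kappa> \<mu> config_space = config_law k \<kappa>"
proof -
  have "tail_measure k \<kappa> \<mu> config_space =
      measure_of (space (borel_of config_space)) (sets (borel_of config_space)) (emeasure (config_law k \<kappa>))"
    unfolding tail_measure_def space_borel_of[symmetric]
    by (intro measure_of_eq tail_mass_eq[OF \<kappa>]) (auto simp: sets.sigma_sets_eq sets.space_closed)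
  also have "\<dots> = config_law k \<kappa>"
    using measure_of_of_measure[of "config_law k \<kappa>"] by simp
  finally show ?thesis .
qed

lemma emeasure_config_law:
  fixes \<kappa> :: "(nat \<Rightarrow> 'y::polish_space) measure"
  assumes "sets \<kappa> = sets (PiM {..<k} (\<lambda>_. borel))" "D \<in> sets (borel_of config_space)"
  shows "emeasure (config_law k \<kappa>) D =
    (\<integral>\<^sup>+v. \<integral>\<^sup>+u. indicator D (config marks k v u) \<partial>\<mu>_power k \<partial>\<kappa>) / fact k"
  using nn_integral_config_law[OF assms(1), of "indicator D"] assms(2) by simp

lemma emeasure_PiM_\<mu>: "B \<in> sets borel \<Longrightarrow> emeasure (\<mu>_power k) (Pi\<^sub>E {..<k} (\<lambda>_. B)) = emeasure \<mu> B ^ k"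
proof -
  assume B: "B \<in> sets borel"
  interpret product_sigma_finite "\<lambda>_. \<mu>" by (rule product_sigma_finite_\<mu>)
  show ?thesis
    using B by (subst emeasure_PiM) auto
qed

lemma config_full_iff:
  assumes "B \<in> S" "B \<in> sets borel"
  shows "of_nat k \<le> emeasure (config marks k v u) (UNIV \<times> B) \<longleftrightarrow> (\<forall>l<k. u l \<in> B)"
proof -
  have "of_nat k \<le> emeasure (config marks k v u) (UNIV \<times> B) \<longleftrightarrow> k \<le> card {i. i < k \<and> u i \<in> B}"
    unfolding emeasure_config_cylinder[OF assms] by simp
  also have "\<dots> \<longleftrightarrow> {i. i < k \<and> u i \<in> B} = {..<k}"
  proof
    assume "k \<le> card {i. i < k \<and> u i \<in> B}"
    then show "{i. i < k \<and> u i \<in> B} = {..<k}"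
      by (intro card_seteq) auto
  qed simp
  also have "\<dots> \<longleftrightarrow> (\<forall>l<k. u l \<in> B)"
    by auto
  finally show ?thesis .
qed

text \<open>
  A configuration of \<open>k\<close> points with \<open>k\<close> of them over \<open>B\<close> has all its marks in \<open>B\<close>, which bounds the mass by
  the \<open>k\<close>-th power of the finite number \<open>\<mu> B\<close> times the total mass of \<open>\<kappa>\<close>. Conversely, finitely many
  marks in \<open>\<Union>S\<close> form a member of \<open>S\<close>, so that almost every such configuration lies in the union of
  the ideal.
\<close>

lemma config_law_ideal_measure:
  fixes \<kappa> :: "(nat \<Rightarrow> 'y::polish_space) measure"
  assumes \<kappa>: "sets \<kappa> = sets (PiM {..<k} (\<lambda>_. borel))" and fin: "emeasure \<kappa> (space \<kappa>) < \<infinity>"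
  shows "config_law k \<kappa> \<in> ideal_measures config_space (config_ideal k)"
  unfolding ideal_measures_def mem_Collect_eq sets_config_law
proof (intro conjI ballI impI refl)
  fix D :: "('y \<times> 'x) measure set"
  assume D: "D \<in> sets (borel_of config_space)"
  {
    assume "D \<in> config_ideal k"
    then obtain B where B: "B \<in> S" "closed B" "\<And>m. m \<in> D \<Longrightarrow> of_nat k \<le> emeasure m (UNIV \<times> B)"
      unfolding config_ideal_iff by blast
    have B': "B \<in> sets borel"
      using B(2) by (rule borel_closed)
    have "(\<integral>\<^sup>+u. indicator D (config marks k v u) \<partial>\<mu>_power k) \<le> emeasure \<mu> B ^ k" for v
    proof -
      have "(\<integral>\<^sup>+u. indicator D (config marks k v u) \<partial>\<mu>_power k) \<le>
          (\<integral>\<^sup>+u. indicator (Pi\<^sub>E {..<k} (\<lambda>_. B)) u \<partial>\<mu>_power k)"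
      proof (rule nn_integral_mono)
        fix u assume "u \<in> space (\<mu>_power k)"
        then have "u \<in> extensional {..<k}"
          by (simp add: space_PiM PiE_def)
        then show "(indicator D (config marks k v u) :: ennreal) \<le> indicator (Pi\<^sub>E {..<k} (\<lambda>_. B)) u"
          using B(3)[of "config marks k v u"] unfolding config_full_iff[OF B(1) B']
          by (auto simp: indicator_def PiE_def)
      qed
      also have "\<dots> = emeasure \<mu> B ^ k"
        using B' by (subst nn_integral_indicator) (auto intro!: sets_PiM_I_finite simp: emeasure_PiM_\<mu>)
      finally show ?thesis .
    qed
    then have "(\<integral>\<^sup>+v. \<integral>\<^sup>+u. indicator D (config marks k v u) \<partial>\<mu>_power k \<partial>\<kappa>) \<le> (\<integral>\<^sup>+v. emeasure \<mu> B ^ k \<partial>\<kappa>)"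
      by (intro nn_integral_mono)
    also have "\<dots> = emeasure \<mu> B ^ k * emeasure \<kappa> (space \<kappa>)"
      by simp
    also have "\<dots> < \<infinity>"
      using \<mu>_finite[OF B' B(1)] fin by (simp add: ennreal_mult_less_top power_less_top_ennreal)
    finally show "emeasure (config_law k \<kappa>) D < \<infinity>"
      unfolding emeasure_config_law[OF \<kappa> D]
      by (simp add: ennreal_divide_eq_top_iff less_top[symmetric])
  }
  {
    assume disj: "D \<inter> \<Union>(config_ideal k) = {}"
    have "(\<integral>\<^sup>+u. indicator D (config marks k v u) \<partial>\<mu>_power k) = (\<integral>\<^sup>+u. 0 \<partial>\<mu>_power k)" for v
    proof (rule nn_integral_cong_AE)
      show "AE u in \<mu>_power k. indicator D (config marks k v u) = (0 :: ennreal)"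
        using AE_product_\<mu>
      proof eventually_elim
        case (elim u)
        have B: "u ` {..<k} \<in> S"
          using elim by (intro finite_subset_mem) auto
        have cl: "closed (u ` {..<k})"
          by (intro finite_imp_closed) simp
        then have "of_nat k \<le> emeasure (config marks k v u) (UNIV \<times> u ` {..<k})"
          by (subst config_full_iff[OF B borel_closed]) auto
        then have "config marks k v u \<in> \<Union>(config_ideal k)"
          unfolding mem_Union_config_ideal_iff using config_counting B cl by blast
        then have "config marks k v u \<notin> D"
          using disj by blast
        then show ?case
          by simp
      qed
    qed
    then show "emeasure (config_law k \<kappa>) D = 0"
      unfolding emeasure_config_law[OF \<kappa> D] by simp
  }
qed

lemma config_law_nontrivial:
  fixes \<kappa> :: "(nat \<Rightarrow> 'y::polish_space) measure"
  assumes \<kappa>: "sets \<kappa> = sets (PiM {..<k} (\<lambda>_. borel))" and pos: "emeasure \<kappa> (space \<kappa>) > 0"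
    and \<mu>: "nontrivial_measure S \<mu>"
  shows "nontrivial_measure (config_ideal k) (config_law k \<kappa>)"
proof -
  obtain B where B: "B \<in> sets borel" "B \<in> S" "emeasure \<mu> B > 0"
    using \<mu> by (auto simp: nontrivial_measure_def)
  let ?C = "closure B"
  have C: "?C \<in> S" "closed ?C" "?C \<in> sets borel"
    using closure_mem[OF B(2)] by auto
  have "emeasure \<mu> B \<le> emeasure \<mu> ?C"
    using C(3) by (intro emeasure_mono closure_subset) simp
  then have "emeasure \<mu> ?C \<noteq> 0"
    using B(3) by (metis leD)
  then have C_pos: "emeasure \<mu> ?C ^ k > 0"
    unfolding zero_less_iff_neq_zero by (rule power_not_zero)
  obtain D where D: "openin (config_space :: ('y \<times> 'x) measure topology) D" "D \<in> config_ideal k"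
    "\<And>m. m \<in> configurations \<Longrightarrow> of_nat k \<le> emeasure m (UNIV \<times> ?C) \<Longrightarrow> m \<in> D"
    using open_neighbourhood_in_config_ideal[OF C(1,2)] by blast
  have D': "D \<in> sets (borel_of config_space)"
    by (rule openin_borel_of[OF D(1)])
  have "emeasure \<mu> ?C ^ k \<le> (\<integral>\<^sup>+u. indicator D (config marks k v u) \<partial>\<mu>_power k)" for v
  proof -
    have "emeasure \<mu> ?C ^ k = (\<integral>\<^sup>+u. indicator (Pi\<^sub>E {..<k} (\<lambda>_. ?C)) u \<partial>\<mu>_power k)"
      using C(3) by (subst nn_integral_indicator) (auto intro!: sets_PiM_I_finite simp: emeasure_PiM_\<mu>)
    also have "\<dots> \<le> (\<integral>\<^sup>+u. indicator D (config marks k v u) \<partial>\<mu>_power k)"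
    proof (rule nn_integral_mono)
      fix u
      show "(indicator (Pi\<^sub>E {..<k} (\<lambda>_. ?C)) u :: ennreal) \<le> indicator D (config marks k v u)"
        using D(3)[OF config_counting, of k v u] unfolding config_full_iff[OF C(1,3)]
        by (auto simp: indicator_def PiE_def)
    qed
    finally show ?thesis .
  qed
  then have "(\<integral>\<^sup>+v. emeasure \<mu> ?C ^ k \<partial>\<kappa>) \<le>
      (\<integral>\<^sup>+v. \<integral>\<^sup>+u. indicator D (config marks k v u) \<partial>\<mu>_power k \<partial>\<kappa>)"
    by (intro nn_integral_mono)
  moreover have "0 < (\<integral>\<^sup>+v. emeasure \<mu> ?C ^ k \<partial>\<kappa>)"
    using C_pos pos by (simp only: nn_integral_const ennreal_zero_less_mult_iff)
  ultimately have "0 < (\<integral>\<^sup>+v. \<integral>\<^sup>+u. indicator D (config marks k v u) \<partial>\<mu>_power k \<partial>\<kappa>)"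
    by (rule less_le_trans[rotated])
  moreover have "(fact k :: ennreal) < top"
    using of_nat_less_top[of "fact k"] by (simp only: of_nat_fact)
  ultimately have "emeasure (config_law k \<kappa>) D > 0"
    unfolding emeasure_config_law[OF \<kappa> D'] ennreal_zero_less_divide by (rule conjI)
  moreover have "D \<in> sets (config_law k \<kappa>)"
    unfolding sets_config_law by (rule D')
  ultimately show ?thesis
    unfolding nontrivial_measure_def using D(2) by blast
qed

end

section \<open>Convergence of the configurations\<close>

lemma test_function_compose:
  assumes f: "f \<in> test_functions E S" and S: "\<And>A B. A \<in> S \<Longrightarrow> B \<subseteq> A \<Longrightarrow> B \<in> S"
    and \<phi>: "continuous_on UNIV \<phi>" "\<phi> 0 = (0 :: real)" "\<And>r. \<bar>\<phi> r\<bar> \<le> \<bar>r\<bar>"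
  shows "(\<lambda>x. \<phi> (f x)) \<in> test_functions E S"
proof -
  have cont: "continuous_map (subtopology E (\<Union>S)) euclideanreal f" and bdd: "bounded (f ` \<Union>S)"
    and supp: "E closure_of {x \<in> \<Union>S. f x \<noteq> 0} \<in> S" and zero: "\<forall>x. x \<notin> \<Union>S \<longrightarrow> f x = 0"
    using f unfolding test_functions_def mem_Collect_eq by blast+
  have "continuous_map (subtopology E (\<Union>S)) euclideanreal (\<phi> \<circ> f)"
    using \<phi>(1) by (intro continuous_map_compose[OF cont]) simp
  moreover have "bounded ((\<lambda>x. \<phi> (f x)) ` \<Union>S)"
  proof -
    obtain c where "\<forall>x\<in>\<Union>S. \<bar>f x\<bar> \<le> c"
      using bdd unfolding bounded_iff by auto
    then have "\<forall>x\<in>\<Union>S. \<bar>\<phi> (f x)\<bar> \<le> c"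
      using \<phi>(3) order_trans by blast
    then show ?thesis
      unfolding bounded_iff by auto
  qed
  moreover have "E closure_of {x \<in> \<Union>S. \<phi> (f x) \<noteq> 0} \<in> S"
  proof (rule S[OF supp], rule closure_of_mono)
    show "{x \<in> \<Union>S. \<phi> (f x) \<noteq> 0} \<subseteq> {x \<in> \<Union>S. f x \<noteq> 0}"
      using \<phi>(2) by force
  qed
  ultimately show ?thesis
    using zero \<phi>(2) unfolding test_functions_def mem_Collect_eq o_def by simp
qed

lemma (in based_ideal) config_ideal_subset:
  "D \<in> config_ideal k \<Longrightarrow> D' \<subseteq> D \<Longrightarrow> D' \<in> config_ideal k"
  unfolding config_ideal_iff by blast

lemma (in based_ideal) measurable_random_config:
  fixes v :: "'w \<Rightarrow> nat \<Rightarrow> 'y::polish_space"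
  assumes "N \<in> measurable M (count_space UNIV)" "v \<in> borel_measurable M" "x \<in> borel_measurable M"
  shows "(\<lambda>\<omega>. config marks (N \<omega>) (v \<omega>) (x \<omega>)) \<in> measurable M (borel_of config_space)"
proof (rule measurable_compose_countable[OF _ assms(1)])
  fix i
  have "(\<lambda>\<omega>. (v \<omega>, x \<omega>)) \<in> measurable M (borel \<Otimes>\<^sub>M borel)"
    using assms(2,3) by (rule measurable_Pair)
  then have "(\<lambda>\<omega>. (v \<omega>, x \<omega>)) \<in> borel_measurable M"
    unfolding borel_prod .
  from measurable_compose[OF this measurable_config]
  show "(\<lambda>\<omega>. config marks i (v \<omega>) (x \<omega>)) \<in> measurable M (borel_of config_space)"
    by simp
qed

lemma config_cong:
  assumes "\<And>i. i < N \<Longrightarrow> v i = v' i" "\<And>i. i < N \<Longrightarrow> u i = u' i"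
  shows "config U N v u = config U N v' u'"
proof (rule measure_eqI)
  fix A assume "A \<in> sets (config U N v u)"
  then have A: "A \<in> sets borel" by simp
  have "{i. i < N \<and> (v i, u i) \<in> U \<and> (v i, u i) \<in> A} = {i. i < N \<and> (v' i, u' i) \<in> U \<and> (v' i, u' i) \<in> A}"
    using assms by auto
  then show "emeasure (config U N v u) A = emeasure (config U N v' u') A"
    by (simp only: emeasure_config[OF A])
qed simp

lemma fact_ennreal: "(fact k :: ennreal) = ennreal (fact k)"
  using ennreal_of_nat_eq_real_of_nat[of "fact k"] by (simp only: of_nat_fact)

lemma inverse_fact_ennreal: "inverse (fact k :: ennreal) = ennreal (inverse (fact k))"
  unfolding fact_ennreal by (rule inverse_ennreal) simp

lemma inverse_fact_cancel: "inverse (fact k) * (fact k * z) = (z :: ennreal)"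
proof -
  have "inverse (fact k) * (fact k :: ennreal) = 1"
    unfolding inverse_fact_ennreal by (subst fact_ennreal) (simp add: ennreal_mult[symmetric])
  then show ?thesis
    by (simp only: mult.assoc[symmetric] mult_1_left)
qed

context vague_sequence
begin

lemma test_function_config_borel:
  fixes f :: "('y::polish_space \<times> 'x) measure \<Rightarrow> real"
  assumes "f \<in> test_functions config_space (config_ideal k)"
  shows "(\<lambda>x. f (config marks N v x)) \<in> borel_measurable borel"
  by (rule measurable_compose[OF measurable_random_config test_function_borel_config[OF assms]]) simp_all

lemma config_limit:
  fixes f :: "('y::polish_space \<times> 'x) measure \<Rightarrow> real"
  assumes f: "f \<in> test_functions config_space (config_ideal k)" and nonneg: "\<And>m. 0 \<le> f m"
  shows "(\<lambda>m. fact k * (ennreal (a m ^ k) * (\<integral>\<^sup>+x. ennreal (f (config marks N v x)) \<partial>marks_law m))) \<longlonglongrightarrow>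
    (\<Sum>j\<in>injections k N. \<integral>\<^sup>+u. ennreal (f (config marks k (\<lambda>l. v (j l)) u)) \<partial>\<mu>_power k)"
proof -
  obtain B c where B: "B \<in> S" "closed B" and c: "0 \<le> c" "\<And>m. \<bar>f m\<bar> \<le> c"
    and supp: "\<And>m. f m \<noteq> 0 \<Longrightarrow> m \<in> configurations \<and> of_nat k \<le> emeasure m (UNIV \<times> B)"
    using test_functionE[OF f] by metis
  have B': "B \<in> sets borel"
    using B(2) by (rule borel_closed)
  have le: "f m \<le> c" for m
    using c(2)[of m] by simp
  show ?thesis
  proof (rule marked_limit[where M=c and B=B])
    show "(\<lambda>x. f (config marks N v x)) \<in> borel_measurable borel"
      by (rule test_function_config_borel[OF f])
    show "(\<lambda>u. f (config marks k (\<lambda>l. v (j l)) u)) \<in> borel_measurable borel" for j :: "nat \<Rightarrow> nat"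
      by (rule test_function_config_borel[OF f])
    show "k \<le> card {i. i < N \<and> x i \<in> B}" if "f (config marks N v x) \<noteq> 0" for x
      using supp[OF that] unfolding emeasure_config_cylinder[OF B(1) B'] by simp
    show "u l \<in> B" if "f (config marks k (\<lambda>l. v (j l)) u) \<noteq> 0" "l < k" for j :: "nat \<Rightarrow> nat" and u l
      using supp[OF that(1)] that(2) unfolding config_full_iff[OF B(1) B'] by blast
    fix j xs u
    assume "j \<in> injections k N" "\<And>l. l < k \<Longrightarrow> (\<lambda>s. xs s (j l)) \<longlonglongrightarrow> u l" "\<And>l. l < k \<Longrightarrow> u l \<in> \<Union>S"
      "\<And>i B. i < N \<Longrightarrow> i \<notin> j ` {..<k} \<Longrightarrow> B \<in> S \<Longrightarrow> \<forall>\<^sub>F s in sequentially. xs s i \<notin> B"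
    then show "(\<lambda>s. f (config marks N v (xs s))) \<longlonglongrightarrow> f (config marks k (\<lambda>l. v (j l)) u)"
      by (rule test_function_config_lim[OF f])
  qed (use nonneg le B in auto)
qed

text \<open>
  Dominated convergence over the ground process. For each realisation the limit is a sum over
  injective index tuples, and the expectation of such a sum is an integral with respect to the
  factorial moment measure.
\<close>

lemma config_expectation_limit:
  fixes f :: "('y::polish_space \<times> 'x) measure \<Rightarrow> real" and y :: "nat \<Rightarrow> 'w \<Rightarrow> 'y"
  assumes P: "prob_space P" and n: "n \<in> measurable P (count_space UNIV)"
    and y: "\<And>i. y i \<in> measurable P borel" and moment: "(\<integral>\<^sup>+\<omega>. of_nat (n \<omega>) ^ k \<partial>P) < \<infinity>"
    and f: "f \<in> test_functions config_space (config_ideal k)" and nonneg: "\<And>m. 0 \<le> f m"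
  shows "(\<lambda>m. ennreal (a m ^ k) *
      (\<integral>\<^sup>+\<omega>. \<integral>\<^sup>+x. ennreal (f (config marks (n \<omega>) (\<lambda>i. y i \<omega>) x)) \<partial>marks_law m \<partial>P)) \<longlonglongrightarrow>
    (\<integral>\<^sup>+m. ennreal (f m) \<partial>config_law k (factorial_moment_measure P k n y))"
proof -
  interpret prob_space P by (rule P)
  let ?\<kappa> = "factorial_moment_measure P k n y"
  let ?M = "\<mu>_power k"
  let ?Q = "\<lambda>m. marks_law m"
  note sets_\<kappa> = sets_factorial_moment_measure[OF P n y, of k]
  obtain B c where B: "B \<in> S" "closed B" and c: "0 \<le> c" "\<And>m. \<bar>f m\<bar> \<le> c"
    and supp: "\<And>m. f m \<noteq> 0 \<Longrightarrow> m \<in> configurations \<and> of_nat k \<le> emeasure m (UNIV \<times> B)"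
    using test_functionE[OF f] by metis
  have B': "B \<in> sets borel"
    using B(2) by (rule borel_closed)
  have le: "f m \<le> c" for m
    using c(2)[of m] by simp
  obtain K where K: "0 \<le> K" "\<And>m. a m * measure (q m) B \<le> K"
    using mass_bounded[OF B(1)] by blast
  have f_borel: "(\<lambda>m. ennreal (f m)) \<in> borel_measurable (borel_of config_space)"
    using test_function_borel_config[OF f] by measurable
  have y': "(\<lambda>\<omega> i. y i \<omega>) \<in> borel_measurable P"
    by (rule measurable_coordinatewise_then_product) (rule y)
  let ?X = "\<lambda>m \<omega>. \<integral>\<^sup>+x. ennreal (f (config marks (n \<omega>) (\<lambda>i. y i \<omega>) x)) \<partial>?Q m"
  let ?L = "\<lambda>\<omega>. \<Sum>j\<in>injections k (n \<omega>). \<integral>\<^sup>+u. ennreal (f (config marks k (\<lambda>l. y (j l) \<omega>) u)) \<partial>?M"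
  have X_meas: "?X m \<in> borel_measurable P" for m
  proof -
    interpret Q: prob_space "?Q m"
      by (intro prob_space_PiM prob_q)
    have x: "snd \<in> measurable (P \<Otimes>\<^sub>M ?Q m) (borel :: (nat \<Rightarrow> 'x) measure)"
      using measurable_snd[of P "?Q m"]
      by (simp add: measurable_cong_sets[OF refl sets_PiM_UNIV_eq_borel[OF sets_q]])
    have "(\<lambda>p. ennreal (f (config marks (n (fst p)) (\<lambda>i. y i (fst p)) (snd p)))) \<in> borel_measurable (P \<Otimes>\<^sub>M ?Q m)"
      by (rule measurable_compose[OF measurable_random_config f_borel])
        (rule measurable_compose[OF measurable_fst n], rule measurable_compose[OF measurable_fst y'], rule x)
    then show ?thesis
      by (intro Q.borel_measurable_nn_integral) (simp add: case_prod_unfold)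
  qed
  have h: "(\<lambda>v. \<integral>\<^sup>+u. ennreal (f (config marks k v u)) \<partial>?M) \<in> borel_measurable (PiM {..<k} (\<lambda>_. borel :: 'y measure))"
  proof -
    interpret M: sigma_finite_measure ?M by (rule sigma_finite_PiM_\<mu>)
    have "(\<lambda>p. ennreal (f (config marks k (fst p) (snd p)))) \<in> borel_measurable (PiM {..<k} (\<lambda>_. borel :: 'y measure) \<Otimes>\<^sub>M ?M)"
      by (rule measurable_compose[OF measurable_config_PiM f_borel]) simp
    then show ?thesis
      by (intro M.borel_measurable_nn_integral) (simp add: case_prod_unfold)
  qed
  have L_eq: "(\<Sum>j\<in>injections k (n \<omega>). \<integral>\<^sup>+u. ennreal (f (config marks k (\<lambda>l\<in>{..<k}. y (j l) \<omega>) u)) \<partial>?M) = ?L \<omega>" for \<omega>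
  proof -
    have "config marks k (\<lambda>l\<in>{..<k}. y (j l) \<omega>) u = config marks k (\<lambda>l. y (j l) \<omega>) u" for j u
      by (rule config_cong) auto
    then show ?thesis
      by (simp only:)
  qed
  have L_meas: "?L \<in> borel_measurable P"
    unfolding L_eq[symmetric]
  proof (rule measurable_compose_countable[OF _ n])
    fix N
    have "(\<lambda>\<omega>. \<integral>\<^sup>+u. ennreal (f (config marks k (\<lambda>l\<in>{..<k}. y (j l) \<omega>) u)) \<partial>?M) \<in> borel_measurable P" for j
      by (rule measurable_compose[OF _ h]) (intro measurable_restrict y)
    then show "(\<lambda>\<omega>. \<Sum>j\<in>injections k N. \<integral>\<^sup>+u. ennreal (f (config marks k (\<lambda>l\<in>{..<k}. y (j l) \<omega>) u)) \<partial>?M) \<in> borel_measurable P"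
      by (intro borel_measurable_sum)
  qed
  have "(\<lambda>m. \<integral>\<^sup>+\<omega>. fact k * (ennreal (a m ^ k) * ?X m \<omega>) \<partial>P) \<longlonglongrightarrow> (\<integral>\<^sup>+\<omega>. ?L \<omega> \<partial>P)"
  proof (rule nn_integral_dominated_convergence)
    let ?w = "\<lambda>\<omega>. fact k * (ennreal (c * K ^ k) * of_nat (n \<omega>) ^ k) :: ennreal"
    show "(\<lambda>\<omega>. fact k * (ennreal (a m ^ k) * ?X m \<omega>)) \<in> borel_measurable P" for m
      by (intro borel_measurable_times_ennreal borel_measurable_const X_meas)
    show "?L \<in> borel_measurable P"
      by (rule L_meas)
    have pow: "(\<lambda>\<omega>. of_nat (n \<omega>) ^ k :: ennreal) \<in> borel_measurable P"
      using measurable_compose[OF n, of "\<lambda>N. of_nat N ^ k :: ennreal" borel] by simp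
    show "?w \<in> borel_measurable P"
      by (intro borel_measurable_times_ennreal borel_measurable_const pow)
    show "AE \<omega> in P. fact k * (ennreal (a m ^ k) * ?X m \<omega>) \<le> ?w \<omega>" for m
    proof (intro AE_I2 mult_left_mono)
      fix \<omega>
      have "ennreal (a m ^ k) * ?X m \<omega> \<le> ennreal (c * K ^ k * real (n \<omega>) ^ k)"
      proof (rule marked_bound[OF le c(1) B' K(2)])
        show "k \<le> card {i. i < n \<omega> \<and> x i \<in> B}" if "f (config marks (n \<omega>) (\<lambda>i. y i \<omega>) x) \<noteq> 0" for x
          using supp[OF that] unfolding emeasure_config_cylinder[OF B(1) B'] by simp
      qed
      also have "\<dots> = ennreal (c * K ^ k) * of_nat (n \<omega>) ^ k"
        using c(1) K(1) by (simp add: ennreal_mult ennreal_power ennreal_of_nat_eq_real_of_nat)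
      finally show "ennreal (a m ^ k) * ?X m \<omega> \<le> ennreal (c * K ^ k) * of_nat (n \<omega>) ^ k" .
    qed simp
    have "(\<integral>\<^sup>+\<omega>. ?w \<omega> \<partial>P) = fact k * (ennreal (c * K ^ k) * (\<integral>\<^sup>+\<omega>. of_nat (n \<omega>) ^ k \<partial>P))"
      using pow by (simp add: nn_integral_cmult)
    also have "\<dots> < \<infinity>"
    proof -
      have "(fact k :: ennreal) < top"
        using of_nat_less_top[of "fact k"] by (simp only: of_nat_fact)
      then show ?thesis
        using moment by (auto intro!: ennreal_mult_less_top[THEN iffD2] simp: ennreal_mult_less_top)
    qed
    finally show "(\<integral>\<^sup>+\<omega>. ?w \<omega> \<partial>P) < \<infinity>" .
    show "AE \<omega> in P. (\<lambda>m. fact k * (ennreal (a m ^ k) * ?X m \<omega>)) \<longlonglongrightarrow> ?L \<omega>"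
      using config_limit[OF f nonneg] by (intro AE_I2)
  qed
  moreover have "(\<integral>\<^sup>+\<omega>. fact k * (ennreal (a m ^ k) * ?X m \<omega>) \<partial>P) = fact k * (ennreal (a m ^ k) * (\<integral>\<^sup>+\<omega>. ?X m \<omega> \<partial>P))" for m
    using X_meas[of m] by (simp add: nn_integral_cmult)
  ultimately have "(\<lambda>m. inverse (fact k) * (fact k * (ennreal (a m ^ k) * (\<integral>\<^sup>+\<omega>. ?X m \<omega> \<partial>P)))) \<longlonglongrightarrow>
      inverse (fact k) * (\<integral>\<^sup>+\<omega>. ?L \<omega> \<partial>P)"
    by (intro ennreal_tendsto_cmult) (simp_all add: inverse_fact_ennreal)
  moreover have "inverse (fact k) * (\<integral>\<^sup>+\<omega>. ?L \<omega> \<partial>P) = (\<integral>\<^sup>+m. ennreal (f m) \<partial>config_law k ?\<kappa>)"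
    unfolding nn_integral_config_law[OF sets_\<kappa> f_borel] nn_integral_factorial_moment_measure[OF P n y h] L_eq
    by (simp add: divide_ennreal_def mult.commute)
  ultimately show ?thesis
    by (simp only: inverse_fact_cancel)
qed

end

section \<open>Regular variation of the marked process\<close>

lemma continuous_scaling_measurable:
  fixes T :: "real \<Rightarrow> 'x::polish_space \<Rightarrow> 'x"
  assumes "continuous_scaling T" "0 < s"
  shows "T s \<in> borel_measurable borel"
proof (rule borel_measurable_continuous_onI)
  have "continuous_on (UNIV \<times> {0<..}) (\<lambda>(x, t). T t x)"
    using assms(1) unfolding continuous_scaling_def by blast
  moreover have "continuous_on UNIV (\<lambda>x :: 'x. (x, s))"
    by (intro continuous_intros)
  moreover have "(\<lambda>x :: 'x. (x, s)) ` UNIV \<subseteq> UNIV \<times> {0<..}"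
    using assms(2) by auto
  ultimately have "continuous_on UNIV (\<lambda>x. (\<lambda>(x, t). T t x) (x, s))"
    by (rule continuous_on_compose2)
  then show "continuous_on UNIV (T s)"
    by simp
qed

lemma scaling_mem_Union_iff:
  assumes T: "continuous_scaling T" and S: "scaling_consistent T S" and s: "0 < s"
  shows "T s x \<in> \<Union>S \<longleftrightarrow> x \<in> \<Union>S"
proof -
  have forward: "T r z \<in> \<Union>S" if r: "0 < r" and z: "z \<in> \<Union>S" for r z
  proof -
    obtain B where "B \<in> S" "z \<in> B"
      using z by blast
    then have "T r ` B \<in> S" "T r z \<in> T r ` B"
      using S r unfolding scaling_consistent_def by blast+
    then show ?thesis
      by blast
  qed
  have "T (inverse s) \<circ> T s = T (inverse s * s)" "T 1 = id"
    using T s unfolding continuous_scaling_def by simp_all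
  then have "T (inverse s) (T s x) = x"
    using s by (metis comp_apply id_apply left_inverse less_irrefl)
  then show ?thesis
    using forward[of "inverse s" "T s x"] forward[OF s, of x] s by auto
qed

lemma ennreal_mult_nn_integral_eq:
  assumes "integrable M f" "\<And>x. 0 \<le> f x" "0 \<le> (r :: real)"
  shows "ennreal r * (\<integral>\<^sup>+x. ennreal (f x) \<partial>M) = ennreal (r * (\<integral>x. f x \<partial>M))"
  using assms by (simp add: nn_integral_eq_integral ennreal_mult)

theorem theorem4p6p16:
  fixes P :: "'w measure"
    and T :: "real \<Rightarrow> 'x::polish_space \<Rightarrow> 'x" and \<X> :: "'x set set"
    and \<Z> :: "('y::polish_space \<times> 'x) set set"
    and n :: "'w \<Rightarrow> nat" and y :: "nat \<Rightarrow> 'w \<Rightarrow> 'y" and \<zeta> :: "'w \<Rightarrow> 'y measure"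
    and \<xi> :: "'w \<Rightarrow> 'x" and mark :: "nat \<Rightarrow> 'w \<Rightarrow> 'x" and \<eta> :: "'w \<Rightarrow> ('y \<times> 'x) measure"
    and g :: "real \<Rightarrow> real" and \<mu> :: "'x measure" and k :: nat
    and \<kappa> :: "(nat \<Rightarrow> 'y) measure" and E :: "('y \<times> 'x) measure topology"
  assumes "prob_space P"
    and "continuous_scaling T"
    and "set_ideal \<X>" and "topologically_consistent \<X>" and "scaling_consistent T \<X>"
    and "countable_open_base \<X>"
    and "\<Z> = mark_ideal \<X>"
    and "E = counting_topology euclidean \<Z>"
    and "n \<in> measurable P (count_space UNIV)" and "\<And>i. y i \<in> measurable P borel"
    and "\<And>\<omega>. \<omega> \<in> space P \<Longrightarrow> \<zeta> \<omega> = dirac_sum {..<n \<omega>} borel (\<lambda>i. y i \<omega>)"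
    and "prob_space.indep_vars P (\<lambda>_. borel) mark UNIV"
    and "\<And>i. distr P borel (mark i) = distr P borel \<xi>"
    and "independent_rvs P
           (\<Pi>\<^sub>M i\<in>UNIV. borel) (\<lambda>\<omega> i. mark i \<omega>)
           (count_space UNIV \<Otimes>\<^sub>M (\<Pi>\<^sub>M i\<in>UNIV. borel)) (\<lambda>\<omega>. (n \<omega>, \<lambda>i. y i \<omega>))"
    and "\<And>\<omega>. \<omega> \<in> space P \<Longrightarrow>
           \<eta> \<omega> = dirac_sum {i \<in> {..<n \<omega>}. (y i \<omega>, mark i \<omega>) \<in> \<Union>\<Z>} borel (\<lambda>i. (y i \<omega>, mark i \<omega>))"
    and "k \<ge> 1"
    and "(\<integral>\<^sup>+\<omega>. emeasure (\<zeta> \<omega>) UNIV ^ k \<partial>P) < \<infinity>"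
    and "measure P {\<omega> \<in> space P. emeasure (\<zeta> \<omega>) UNIV \<ge> of_nat k} > 0"
    and "\<kappa> = factorial_moment_measure P k n y"
    and "regularly_varying P \<xi> euclidean T \<X> g \<mu>"
  shows "regularly_varying P \<eta> E (lifted_scaling (mark_scaling T)) (counting_ideal k euclidean \<Z>)
           (\<lambda>t. g t ^ k) (tail_measure k \<kappa> \<mu> E) \<and>
         (\<forall>D\<in>sets (borel_of E). D \<in> counting_ideal k euclidean \<Z> \<longrightarrow>
           emeasure (tail_measure k \<kappa> \<mu> E) D =
             (\<integral>\<^sup>+ y. (\<integral>\<^sup>+ x. indicator D (dirac_sum {..<k} borel (\<lambda>i. (y i, x i)))
                \<partial>(\<Pi>\<^sub>M i\<in>{..<k}. \<mu>)) \<partial>\<kappa>) / fact k)"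
proof -
  let ?S = "\<lambda>s \<omega>. lifted_scaling (mark_scaling T) s (\<eta> \<omega>)"
  note P = assms(1) and T = assms(2) and n = assms(9) and y = assms(10)
  interpret P: prob_space P by (rule P)
  have \<xi>: "\<xi> \<in> borel_measurable P" and g_nonneg: "\<And>t. 0 \<le> t \<Longrightarrow> 0 \<le> g t"
    and g_meas: "g \<in> borel_measurable (restrict_space borel {0..})" and g_top: "filterlim g at_top at_top"
    and \<mu>: "\<mu> \<in> ideal_measures euclidean \<X>" and \<mu>_pos: "nontrivial_measure \<X> \<mu>"
    and RV: "\<And>f. f \<in> test_functions euclidean \<X> \<Longrightarrow>
      ((\<lambda>t. g t * (\<integral>\<omega>. f (T (inverse t) (\<xi> \<omega>)) \<partial>P)) \<longlongrightarrow> (\<integral>x. f x \<partial>\<mu>)) at_top"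
    using assms(20) unfolding regularly_varying_def borel_of_euclidean by blast+
  interpret measured_ideal \<X> \<mu>
    using assms(3,4,6) \<mu> by unfold_locales
  have E: "E = config_space" and ideal_k: "counting_ideal k euclidean \<Z> = config_ideal k"
    using assms(7,8) by simp_all
  have T_meas: "T s \<in> borel_measurable borel" if "0 < s" for s
    by (rule continuous_scaling_measurable[OF T that])
  have T_U: "T s x \<in> \<Union>\<X> \<longleftrightarrow> x \<in> \<Union>\<X>" if "0 < s" for s x
    by (rule scaling_mem_Union_iff[OF T assms(5) that])
  have mark: "mark i \<in> borel_measurable P" for i
    using assms(12) by (simp add: P.indep_vars_def)
  have y': "(\<lambda>\<omega> i. y i \<omega>) \<in> borel_measurable P"
    by (rule measurable_coordinatewise_then_product) (rule y)
  have \<eta>: "\<eta> \<omega> = config marks (n \<omega>) (\<lambda>i. y i \<omega>) (\<lambda>i. mark i \<omega>)" if "\<omega> \<in> space P" for \<omega>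
    unfolding assms(15)[OF that] config_def assms(7) ..
  have \<eta>_meas: "\<eta> \<in> measurable P (borel_of config_space)"
  proof -
    have "(\<lambda>\<omega>. config marks (n \<omega>) (\<lambda>i. y i \<omega>) (\<lambda>i. mark i \<omega>)) \<in> measurable P (borel_of config_space)"
      by (intro measurable_random_config n y' measurable_coordinatewise_then_product mark)
    then show ?thesis
      by (subst measurable_cong[OF \<eta>])
  qed
  have scaled: "?S s \<omega> =
      config marks (n \<omega>) (\<lambda>i. y i \<omega>) (\<lambda>i. T s (mark i \<omega>))" if "0 < s" "\<omega> \<in> space P" for s \<omega>
    unfolding \<eta>[OF that(2)] by (rule lifted_scaling_config[where T=T and s=s, OF T_meas[OF that(1)] T_U[OF that(1)]])
  have scaled_meas: "(\<lambda>\<omega>. ?S s \<omega>) \<in> measurable P (borel_of config_space)"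
    if "0 < s" for s
  proof -
    have "(\<lambda>\<omega>. config marks (n \<omega>) (\<lambda>i. y i \<omega>) (\<lambda>i. T s (mark i \<omega>))) \<in> measurable P (borel_of config_space)"
      by (intro measurable_random_config n y' measurable_coordinatewise_then_product
          measurable_compose[OF mark T_meas[OF that]])
    then show ?thesis
      by (subst measurable_cong[OF scaled[OF that]])
  qed
  have \<zeta>: "emeasure (\<zeta> \<omega>) UNIV = of_nat (n \<omega>)" if "\<omega> \<in> space P" for \<omega>
    unfolding assms(11)[OF that] by (subst emeasure_dirac_sum) auto
  have moment: "(\<integral>\<^sup>+\<omega>. of_nat (n \<omega>) ^ k \<partial>P) < \<infinity>"
  proof -
    have "(\<integral>\<^sup>+\<omega>. of_nat (n \<omega>) ^ k \<partial>P) = (\<integral>\<^sup>+\<omega>. emeasure (\<zeta> \<omega>) UNIV ^ k \<partial>P)"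
      by (intro nn_integral_cong) (simp add: \<zeta>)
    then show ?thesis
      using assms(17) by simp
  qed
  note sets_\<kappa> = sets_factorial_moment_measure[where y=y and k=k, OF P n y, folded assms(19)]
  have \<kappa>_mass: "emeasure \<kappa> (space \<kappa>) = (\<integral>\<^sup>+\<omega>. of_nat (card (injections k (n \<omega>))) \<partial>P)"
    using nn_integral_factorial_moment_measure[where y=y and k=k and h="\<lambda>_. 1", OF P n y] unfolding assms(19) by simp
  have \<kappa>_fin: "emeasure \<kappa> (space \<kappa>) < \<infinity>"
  proof -
    have "emeasure \<kappa> (space \<kappa>) \<le> (\<integral>\<^sup>+\<omega>. of_nat (n \<omega>) ^ k \<partial>P)"
      unfolding \<kappa>_mass of_nat_power[symmetric] by (intro nn_integral_mono of_nat_mono card_injections_le)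
    then show ?thesis
      using moment by (rule order.strict_trans1)
  qed
  have \<kappa>_pos: "emeasure \<kappa> (space \<kappa>) > 0"
  proof -
    let ?A = "{\<omega> \<in> space P. emeasure (\<zeta> \<omega>) UNIV \<ge> of_nat k}"
    have A: "?A = {\<omega> \<in> space P. k \<le> n \<omega>}"
      using \<zeta> by auto
    have "?A \<in> sets P"
      unfolding A using measurable_sets[OF n, of "{k..}"] by (simp add: vimage_def Int_def conj_commute)
    have "0 < emeasure P ?A"
      using assms(18) by (simp add: P.emeasure_eq_measure)
    also have "\<dots> = (\<integral>\<^sup>+\<omega>. indicator ?A \<omega> \<partial>P)"
      using \<open>?A \<in> sets P\<close> by simp
    also have "\<dots> \<le> (\<integral>\<^sup>+\<omega>. of_nat (card (injections k (n \<omega>))) \<partial>P)"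
    proof (rule nn_integral_mono)
      fix \<omega>
      show "(indicator ?A \<omega> :: ennreal) \<le> of_nat (card (injections k (n \<omega>)))"
      proof (cases "\<omega> \<in> ?A")
        case True
        then have "k \<le> card {..<n \<omega>}"
          unfolding A by simp
        then have "injections k (n \<omega>) \<noteq> {}"
          using exists_injection_into[of k "{..<n \<omega>}" "n \<omega>"] by blast
        then have "1 \<le> card (injections k (n \<omega>))"
          using finite_injections[of k "n \<omega>"] by (simp add: Suc_le_eq card_gt_0_iff)
        then have "(of_nat 1 :: ennreal) \<le> of_nat (card (injections k (n \<omega>)))"
          by (rule of_nat_mono)
        then show ?thesis
          using True by simp
      qed simp
    qed
    finally show ?thesis
      unfolding \<kappa>_mass .
  qed
  let ?law = "config_law k \<kappa>"
  have tail: "tail_measure k \<kappa> \<mu> E = ?law"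
    unfolding E by (rule tail_measure_eq[OF sets_\<kappa>])
  have law_ideal: "?law \<in> ideal_measures config_space (config_ideal k)"
    by (rule config_law_ideal_measure[OF sets_\<kappa> \<kappa>_fin])
  have integrable_law: "integrable ?law f"
    if f: "f \<in> test_functions config_space (config_ideal k)" for f :: "('y \<times> 'x) measure \<Rightarrow> real"
  proof -
    obtain B c where B: "B \<in> \<X>" "closed B" and c: "0 \<le> c" "\<And>m. \<bar>f m\<bar> \<le> c"
      and supp: "\<And>m. f m \<noteq> 0 \<Longrightarrow> m \<in> configurations \<and> of_nat k \<le> emeasure m (UNIV \<times> B)"
      using test_functionE[OF f] by metis
    let ?D = "{m \<in> space (borel_of config_space). f m \<noteq> 0}"
    have f_meas: "f \<in> borel_measurable (borel_of config_space)"
      by (rule test_function_borel_config[OF f])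
    then have D: "?D \<in> sets (borel_of config_space)"
      by measurable
    have "?D \<in> config_ideal k"
      unfolding config_ideal_iff using supp B by blast
    then have fin: "emeasure ?law ?D < \<infinity>"
      using law_ideal D unfolding ideal_measures_def by auto
    have "integrable ?law (\<lambda>m. c * indicator ?D m)"
      using D fin by (intro integrable_mult_right) (simp add: integrable_indicator_iff)
    then show ?thesis
    proof (rule Bochner_Integration.integrable_bound)
      show "f \<in> borel_measurable ?law"
        using f_meas by (simp cong: measurable_cong_sets)
      show "AE m in ?law. norm (f m) \<le> norm (c * indicator ?D m)"
      proof (rule AE_I2)
        fix m assume "m \<in> space ?law"
        then show "norm (f m) \<le> norm (c * indicator ?D m)"
          using c(1) c(2)[of m] by (cases "f m = 0") simp_all
      qed
    qed
  qed
  have integrable_P: "integrable P (\<lambda>\<omega>. f (?S s \<omega>))"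
    if f: "f \<in> test_functions config_space (config_ideal k)" and s: "0 < s"
    for f :: "('y \<times> 'x) measure \<Rightarrow> real" and s
  proof -
    obtain c where c: "\<And>m. \<bar>f m\<bar> \<le> c"
      using test_functionE[OF f] by metis
    show ?thesis
      using measurable_compose[OF scaled_meas[OF s] test_function_borel_config[OF f]] c
      by (intro P.integrable_const_bound[of _ c]) auto
  qed
  have limit_nonneg: "((\<lambda>t. g t ^ k * (\<integral>\<omega>. f (?S (inverse t) \<omega>) \<partial>P)) \<longlongrightarrow>
      (\<integral>m. f m \<partial>?law)) at_top"
    if f: "f \<in> test_functions config_space (config_ideal k)" and nonneg: "\<And>m. 0 \<le> f m"
    for f :: "('y \<times> 'x) measure \<Rightarrow> real"
  proof (rule tendsto_at_topI_sequentially)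
    fix X :: "nat \<Rightarrow> real"
    assume X: "filterlim X at_top sequentially"
    \<comment> \<open>Scaling and normalisation are controlled for positive times only. The change affects finitely
      many terms of the sequence.\<close>
    define t where "t m = max (X m) 1" for m
    have t_pos: "0 < t m" for m
      unfolding t_def by simp
    have t_eq: "\<forall>\<^sub>F m in sequentially. t m = X m"
      using X[unfolded filterlim_at_top, rule_format, of 1] by eventually_elim (simp add: t_def)
    have t_top: "filterlim t at_top sequentially"
      by (rule filterlim_at_top_mono[OF X]) (simp add: t_def)
    define q where "q m = distr P borel (\<lambda>\<omega>. T (inverse (t m)) (\<xi> \<omega>))" for m
    have T\<xi>: "(\<lambda>\<omega>. T (inverse (t m)) (\<xi> \<omega>)) \<in> borel_measurable P" for m
      using t_pos[of m] by (intro measurable_compose[OF \<xi> T_meas]) simp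
    interpret V: vague_sequence \<X> \<mu> q "\<lambda>m. g (t m)"
    proof (intro vague_sequence.intro vague_sequence_axioms.intro)
      show "measured_ideal \<X> \<mu>" ..
      show "prob_space (q m)" for m
        unfolding q_def by (rule P.prob_space_distr[OF T\<xi>])
      show "sets (q m) = sets borel" for m
        unfolding q_def by simp
      show "0 \<le> g (t m)" for m
        using t_pos[of m] by (intro g_nonneg) simp
      show "filterlim (\<lambda>m. g (t m)) at_top sequentially"
        by (rule filterlim_compose[OF g_top t_top])
      fix \<phi> :: "'x \<Rightarrow> real"
      assume \<phi>: "\<phi> \<in> test_functions euclidean \<X>"
      have "\<phi> \<in> borel_measurable borel"
      proof -
        have "continuous_on (\<Union>\<X>) \<phi>" "\<And>x. x \<notin> \<Union>\<X> \<Longrightarrow> \<phi> x = 0"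
          using \<phi> unfolding test_functions_def by auto
        moreover have "(\<lambda>x. indicator (\<Union>\<X>) x *\<^sub>R \<phi> x) \<in> borel_measurable borel"
          using calculation(1) open_Union by (intro borel_measurable_continuous_on_indicator borel_open)
        moreover have "(\<lambda>x. indicator (\<Union>\<X>) x *\<^sub>R \<phi> x) = \<phi>"
          using calculation(2) by (intro ext) (simp add: indicator_def del: Union_iff, metis)
        ultimately show ?thesis by simp
      qed
      then have "(\<integral>x. \<phi> x \<partial>q m) = (\<integral>\<omega>. \<phi> (T (inverse (t m)) (\<xi> \<omega>)) \<partial>P)" for m
        unfolding q_def by (intro integral_distr T\<xi>)
      then show "(\<lambda>m. g (t m) * (\<integral>x. \<phi> x \<partial>q m)) \<longlonglongrightarrow> (\<integral>x. \<phi> x \<partial>\<mu>)"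
        using filterlim_compose[OF RV[OF \<phi>] t_top] by simp
    qed
    have "ennreal (g (t m) ^ k) *
        (\<integral>\<^sup>+\<omega>. \<integral>\<^sup>+x. ennreal (f (config marks (n \<omega>) (\<lambda>i. y i \<omega>) x)) \<partial>PiM UNIV (\<lambda>_. q m) \<partial>P) =
        ennreal (g (t m) ^ k * (\<integral>\<omega>. f (?S (inverse (t m)) \<omega>) \<partial>P))" for m
    proof -
      have s: "0 < inverse (t m)"
        using t_pos[of m] by simp
      let ?F = "\<lambda>z. ennreal (f (config marks (fst (snd z)) (snd (snd z)) (fst z)))"
      let ?B = "PiM UNIV (\<lambda>_ :: nat. borel :: 'x measure)" and ?C = "PiM UNIV (\<lambda>_ :: nat. borel :: 'y measure)"
      have "(\<lambda>z. fst (snd z)) \<in> measurable (?B \<Otimes>\<^sub>M (count_space UNIV \<Otimes>\<^sub>M ?C)) (count_space UNIV)"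
        by (rule measurable_compose[OF measurable_snd measurable_fst])
      moreover have "(\<lambda>z. snd (snd z)) \<in> measurable (?B \<Otimes>\<^sub>M (count_space (UNIV :: nat set) \<Otimes>\<^sub>M ?C)) borel"
        unfolding measurable_cong_sets[OF refl sets_PiM_equal_borel[symmetric]]
        by (rule measurable_compose[OF measurable_snd measurable_snd])
      moreover have "fst \<in> measurable (?B \<Otimes>\<^sub>M (count_space (UNIV :: nat set) \<Otimes>\<^sub>M ?C)) borel"
        unfolding measurable_cong_sets[OF refl sets_PiM_equal_borel[symmetric]] by (rule measurable_fst)
      ultimately have "(\<lambda>z. f (config marks (fst (snd z)) (snd (snd z)) (fst z)))
          \<in> borel_measurable (?B \<Otimes>\<^sub>M (count_space UNIV \<Otimes>\<^sub>M ?C))"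
        by (intro measurable_compose[OF measurable_random_config test_function_borel_config[OF f]])
      then have F: "?F \<in> borel_measurable (?B \<Otimes>\<^sub>M (count_space UNIV \<Otimes>\<^sub>M ?C))"
        by measurable
      have "(\<integral>\<^sup>+\<omega>. \<integral>\<^sup>+x. ennreal (f (config marks (n \<omega>) (\<lambda>i. y i \<omega>) x)) \<partial>PiM UNIV (\<lambda>_. q m) \<partial>P) =
          (\<integral>\<^sup>+\<omega>. ennreal (f (config marks (n \<omega>) (\<lambda>i. y i \<omega>) (\<lambda>i. T (inverse (t m)) (mark i \<omega>)))) \<partial>P)"
        using nn_integral_independent_marks[OF P assms(12,13) \<xi> assms(14) T_meas[OF s] F]
        unfolding q_def by simp
      also have "\<dots> = (\<integral>\<^sup>+\<omega>. ennreal (f (?S (inverse (t m)) \<omega>)) \<partial>P)"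
        by (intro nn_integral_cong) (simp only: scaled[OF s])
      finally show ?thesis
        using V.a_nonneg[of m] by (simp only: ennreal_mult_nn_integral_eq[OF integrable_P[OF f s] nonneg] zero_le_power)
    qed
    moreover have "(\<integral>\<^sup>+m. ennreal (f m) \<partial>?law) = ennreal (\<integral>m. f m \<partial>?law)"
      by (rule nn_integral_eq_integral[OF integrable_law[OF f]]) (simp add: nonneg)
    ultimately have "(\<lambda>m. ennreal (g (t m) ^ k * (\<integral>\<omega>. f (?S (inverse (t m)) \<omega>) \<partial>P)))
        \<longlonglongrightarrow> ennreal (\<integral>m. f m \<partial>?law)"
      using V.config_expectation_limit[where y=y, OF P n y moment f nonneg] unfolding assms(19) by (simp only:)
    then have "(\<lambda>m. g (t m) ^ k * (\<integral>\<omega>. f (?S (inverse (t m)) \<omega>) \<partial>P))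
        \<longlonglongrightarrow> (\<integral>m. f m \<partial>?law)"
      using nonneg V.a_nonneg by (subst (asm) tendsto_ennreal_iff) (auto intro!: mult_nonneg_nonneg always_eventually)
    then show "(\<lambda>m. g (X m) ^ k * (\<integral>\<omega>. f (?S (inverse (X m)) \<omega>) \<partial>P))
        \<longlonglongrightarrow> (\<integral>m. f m \<partial>?law)"
      by (rule Lim_transform_eventually) (use t_eq in eventually_elim, simp)
  qed
  have limit: "((\<lambda>t. g t ^ k * (\<integral>\<omega>. f (?S (inverse t) \<omega>) \<partial>P)) \<longlongrightarrow>
      (\<integral>m. f m \<partial>?law)) at_top"
    if f: "f \<in> test_functions config_space (config_ideal k)" for f :: "('y \<times> 'x) measure \<Rightarrow> real"
  proof -
    \<comment> \<open>The expectations were computed as integrals of nonnegative functions, so the positive and the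
      negative part of \<open>f\<close> are treated separately.\<close>
    let ?p = "\<lambda>m. max (f m) 0" and ?n = "\<lambda>m. max (- f m) 0"
    have p: "?p \<in> test_functions config_space (config_ideal k)"
      by (rule test_function_compose[OF f config_ideal_subset, where \<phi> = "\<lambda>r. max r 0"])
        (auto intro!: continuous_intros)
    have m: "?n \<in> test_functions config_space (config_ideal k)"
      by (rule test_function_compose[OF f config_ideal_subset, where \<phi> = "\<lambda>r. max (- r) 0"])
        (auto intro!: continuous_intros)
    have split: "f z = ?p z - ?n z" for z
      by simp
    have law: "(\<integral>z. f z \<partial>?law) = (\<integral>z. ?p z \<partial>?law) - (\<integral>z. ?n z \<partial>?law)"
      using integrable_law[OF p] integrable_law[OF m] by (subst split) (rule Bochner_Integration.integral_diff)
    have "((\<lambda>t. g t ^ k * (\<integral>\<omega>. ?p (?S (inverse t) \<omega>) \<partial>P) - g t ^ k * (\<integral>\<omega>. ?n (?S (inverse t) \<omega>) \<partial>P)) \<longlongrightarrow>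
        (\<integral>z. f z \<partial>?law)) at_top"
      unfolding law by (intro tendsto_diff limit_nonneg p m) auto
    moreover have "\<forall>\<^sub>F t in at_top. g t ^ k * (\<integral>\<omega>. ?p (?S (inverse t) \<omega>) \<partial>P) - g t ^ k * (\<integral>\<omega>. ?n (?S (inverse t) \<omega>) \<partial>P) =
        g t ^ k * (\<integral>\<omega>. f (?S (inverse t) \<omega>) \<partial>P)"
      using eventually_gt_at_top[of 0]
    proof eventually_elim
      case (elim t)
      then have s: "0 < inverse t"
        by simp
      have "(\<integral>\<omega>. f (?S (inverse t) \<omega>) \<partial>P) = (\<integral>\<omega>. ?p (?S (inverse t) \<omega>) \<partial>P) - (\<integral>\<omega>. ?n (?S (inverse t) \<omega>) \<partial>P)"
        using integrable_P[OF p s] integrable_P[OF m s]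
        by (subst split) (rule Bochner_Integration.integral_diff)
      then show ?case
        by (simp only: right_diff_distrib)
    qed
    ultimately show ?thesis
      by (rule Lim_transform_eventually)
  qed
  have "regularly_varying P \<eta> config_space (lifted_scaling (mark_scaling T)) (config_ideal k) (\<lambda>t. g t ^ k) ?law"
    unfolding regularly_varying_def
  proof (intro conjI ballI allI impI)
    show "\<eta> \<in> measurable P (borel_of config_space)"
      by (rule \<eta>_meas)
    show "0 \<le> g t ^ k" if "0 \<le> t" for t
      using g_nonneg[OF that] by simp
    show "(\<lambda>t. g t ^ k) \<in> borel_measurable (restrict_space borel {0..})"
      using g_meas by (rule borel_measurable_power)
    show "filterlim (\<lambda>t. g t ^ k) at_top at_top"
      using assms(16) g_top by (intro filterlim_pow_at_top) auto
    show "?law \<in> ideal_measures config_space (config_ideal k)"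
      by (rule law_ideal)
    show "nontrivial_measure (config_ideal k) ?law"
      by (rule config_law_nontrivial[OF sets_\<kappa> \<kappa>_pos \<mu>_pos])
    fix f :: "('y \<times> 'x) measure \<Rightarrow> real"
    assume "f \<in> test_functions config_space (config_ideal k)"
    then show "((\<lambda>t. g t ^ k * (\<integral>\<omega>. f (?S (inverse t) \<omega>) \<partial>P)) \<longlongrightarrow>
      (\<integral>m. f m \<partial>?law)) at_top"
      by (rule limit)
  qed
  moreover have "emeasure ?law D = (\<integral>\<^sup>+ y. (\<integral>\<^sup>+ x. indicator D (dirac_sum {..<k} borel (\<lambda>i. (y i, x i)))
      \<partial>(\<Pi>\<^sub>M i\<in>{..<k}. \<mu>)) \<partial>\<kappa>) / fact k" if "D \<in> sets (borel_of config_space)" for D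
    using tail_mass_eq[OF sets_\<kappa> that] unfolding tail_mass_def by (rule sym)
  ultimately show ?thesis
    unfolding tail unfolding E ideal_k by blast
qed

end
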